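(* Let $N=2m$ and let $B$ be a non-degenerate skew-symmetric $N\times N$ matrix over $\mathbb{C}$. (1) Let $V$ be an irreducible jet module for $\widetilde{H_B}$ with finite dimensional weight spaces. Then $V\simeq V_{\mathbf 0}\otimes\mathcal A$, where $V_{\mathbf 0}$ is an irreducible module for $\mathcal T_B$. (2) Let $V_{\mathbf 0}$ be a finite dimensional irreducible module for $\mathcal T_B$. Then $V_{\mathbf 0}$ is an irreducible module for $\mathfrak{sp}_{2m}\oplus R$, and $R$ is central. Conversely, any finite dimensional irreducible module for $\mathfrak{sp}_{2m}\oplus R$ can be extended to an irreducible module for $\mathcal T_B$.
   Context: All is over $\mathbb{C}$; $(\mathbf u|\mathbf v)=\sum u_iv_i$ on $\mathbb{C}^N$. $\mathcal A=\mathbb{C}[t_1^{\pm1},\dots,t_N^{\pm1}]$; $D(\mathbf u,\mathbf r)=\sum_i u_it^{\mathbf r}d_i\in\mathrm{Der}\,\mathcal A$ with $d_i=t_i\frac{d}{dt_i}$, for $\mathbf u\in\mathbb{C}^N$, $\mathbf r\in\mathbb{Z}^N$. $\widetilde{H_B}=\mathrm{span}\{D(B\mathbf r,\mathbf r):\mathbf r\in\mathbb{Z}^N\setminus\{\mathbf 0\}\}\oplus\mathcal D$, $\mathcal D=\mathrm{span}\{D(\mathbf u,\mathbf 0):\mathbf u\in\mathbb{C}^N\}$, a subalgebra of $\mathrm{Der}\,\mathcal A$. A jet module for $\widetilde{H_B}$ is a vector space with an action of the Lie algebra $\widetilde{H_B}$ and a unital associative action of $\mathcal A$ such that $\eta(fv)=\eta(f)v+f(\eta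 v)$ for $\eta\in\widetilde{H_B}$, $f\in\mathcal A$; irreducible means irreducible under the joint action. Weight spaces are with respect to $\mathcal D\oplus\mathbb{C}$ (where $\mathbb{C}=\mathbb{C}t^{\mathbf 0}$ acts by scalars); $V$ has a non-zero weight space, so by irreducibility $V=\bigoplus_{\mathbf r\in\mathbb{Z}^N}V_{\mathbf r}$ with $V_{\mathbf r}=\{v: D(\mathbf u,\mathbf 0)v=(\mathbf u|\mathbf r+\boldsymbol\beta)v\ \forall\,\mathbf u\in\mathbb{C}^N\}$ for some fixed $\boldsymbol\beta\in\mathbb{C}^N$. $\mathcal T_B$ is the Lie algebra spanned by $T(\mathbf r)=t^{-\mathbf r}D(B\mathbf r,\mathbf r)-D(B\mathbf r,\mathbf 0)$, $\mathbf r\in\mathbb{Z}^N$, inside $U(\widetilde{H_B}\ltimes\mathcal A)$ modulo the two-sided ideal generated by $t^{\mathbf r}t^{\mathbf s}-t^{\mathbf r+\mathbf s}$ and $t^{\mathbf 0}-1$, with the commutator bracket $[T(\mathbf r),T(\mathbf s)]=(B\mathbf r|\mathbf s)(T(\mathbf r+\mathbf s)-T(\mathbf r)-T(\mathbf s))$. The jet module structure on $V_{\mathbf 0}\otimes\mathcal A$, for a $\mathcal T_B$-module $V_{\mathbf 0}$ and $\boldsymbol\beta\in\mathbb{C}^N$: $D(B\mathbf r,\mathbf r)(v\otimes t^{\mathbf k})=(B\mathbf r|\mathbf k+\boldsymbol\beta)v\otimes t^{\mathbf k+\mathbf r}+(T(\mathbf r)v)\otimes t^{\mathbf k+\mathbf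 r}$, $D(\mathbf u,\mathbf 0)(v\otimes t^{\mathbf k})=(\mathbf u|\mathbf k+\boldsymbol\beta)v\otimes t^{\mathbf k}$, $t^{\mathbf r}(v\otimes t^{\mathbf k})=v\otimes t^{\mathbf k+\mathbf r}$. Meaning of $R$: let $I_3\subset\mathcal T_B$ be the ideal spanned by all $\sum_{S\subseteq\{1,2,3\}}(-1)^{|S|}T(\mathbf s+\sum_{i\in S}\mathbf r_i)$, $\mathbf s,\mathbf r_1,\mathbf r_2,\mathbf r_3\in\mathbb{Z}^N$. Let $\mathfrak G_B=\{X\in\mathfrak{gl}(N,\mathbb{C}):BX=-X^TB\}\cong\mathfrak{sp}_{2m}$, and let $\psi_B:\mathcal T_B\to\mathfrak G_B$ be the Lie algebra homomorphism $\psi_B(T(\mathbf r))=\mathbf r(B\mathbf r)^T$, whose kernel contains $I_3$. Then $R$ stands for $\ker\psi_B/I_3$, and modules for $\mathfrak{sp}_{2m}\oplus R$ and for $\mathcal T_B$ are compared via the quotient map from $\mathcal T_B$ to $\mathcal T_B/I_3$, identified with $\mathfrak{sp}_{2m}\oplus R$. *)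

theory Defs
  imports
    "HOL-Analysis.Analysis"
    "HOL-Algebra.QuotRing"
    "HOL-Library.Poly_Mapping"
begin

section \<open>Complex Lie algebras and their modules\<close>

text \<open>
  Lie algebras are given by an explicit carrier and explicit operations, because
  most of the ones needed below are quotients by subspaces that depend on parameters.
\<close>

record 'b lie =
  lcarrier :: "'b set"
  lzero :: 'b
  ladd :: "'b \<Rightarrow> 'b \<Rightarrow> 'b"
  lsmult :: "complex \<Rightarrow> 'b \<Rightarrow> 'b"
  lbr :: "'b \<Rightarrow> 'b \<Rightarrow> 'b"

inductive_set lspan :: "'b lie \<Rightarrow> 'b set \<Rightarrow> 'b set" for L S where
  zero: "lzero L \<in> lspan L S"
| base: "x \<in> S \<Longrightarrow> x \<in> lspan L S"
| add: "x \<in> lspan L S \<Longrightarrow> y \<in> lspan L S \<Longrightarrow> ladd L x y \<in> lspan L S"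
| smult: "x \<in> lspan L S \<Longrightarrow> lsmult L c x \<in> lspan L S"

definition lie_restrict :: "'b lie \<Rightarrow> 'b set \<Rightarrow> 'b lie" where
  "lie_restrict L S = L\<lparr>lcarrier := S\<rparr>"

definition lie_hom :: "'b lie \<Rightarrow> 'c lie \<Rightarrow> ('b \<Rightarrow> 'c) \<Rightarrow> bool" where
  "lie_hom L M f \<longleftrightarrow>
     (\<forall>x\<in>lcarrier L. f x \<in> lcarrier M) \<and>
     (\<forall>x\<in>lcarrier L. \<forall>y\<in>lcarrier L. f (ladd L x y) = ladd M (f x) (f y)) \<and>
     (\<forall>c. \<forall>x\<in>lcarrier L. f (lsmult L c x) = lsmult M c (f x)) \<and>
     (\<forall>x\<in>lcarrier L. \<forall>y\<in>lcarrier L. f (lbr L x y) = lbr M (f x) (f y))"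

definition lie_iso :: "'b lie \<Rightarrow> 'c lie \<Rightarrow> ('b \<Rightarrow> 'c) \<Rightarrow> bool" where
  "lie_iso L M f \<longleftrightarrow> lie_hom L M f \<and> bij_betw f (lcarrier L) (lcarrier M)"

definition lie_ker :: "'b lie \<Rightarrow> 'c lie \<Rightarrow> ('b \<Rightarrow> 'c) \<Rightarrow> 'b set" where
  "lie_ker L M f = {x \<in> lcarrier L. f x = lzero M}"

definition lie_center :: "'b lie \<Rightarrow> 'b set" where
  "lie_center L = {x \<in> lcarrier L. \<forall>y\<in>lcarrier L. lbr L x y = lzero L}"

definition lie_sum :: "'b lie \<Rightarrow> 'c lie \<Rightarrow> ('b \<times> 'c) lie" where
  "lie_sum L M =
     \<lparr>lcarrier = lcarrier L \<times> lcarrier M,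
      lzero = (lzero L, lzero M),
      ladd = (\<lambda>(x, y) (x', y'). (ladd L x x', ladd M y y')),
      lsmult = (\<lambda>c (x, y). (lsmult L c x, lsmult M c y)),
      lbr = (\<lambda>(x, y) (x', y'). (lbr L x x', lbr M y y'))\<rparr>"

definition lie_coset :: "'b lie \<Rightarrow> 'b set \<Rightarrow> 'b \<Rightarrow> 'b set" where
  "lie_coset L I x = {ladd L x i | i. i \<in> I}"

definition lie_quot :: "'b lie \<Rightarrow> 'b set \<Rightarrow> 'b set lie" where
  "lie_quot L I =
     \<lparr>lcarrier = lie_coset L I ` lcarrier L,
      lzero = I,
      ladd = (\<lambda>X Y. \<Union>x\<in>X. \<Union>y\<in>Y. lie_coset L I (ladd L x y)),
      lsmult = (\<lambda>c X. \<Union>x\<in>X. lie_coset L I (lsmult L c x)),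
      lbr = (\<lambda>X Y. \<Union>x\<in>X. \<Union>y\<in>Y. lie_coset L I (lbr L x y))\<rparr>"

text \<open>
  A module for \<open>L\<close> is a subspace \<open>V\<close> of some complex vector space (with scalar
  multiplication \<open>s\<close>) together with an action \<open>\<rho>\<close>, of which only the values
  \<open>\<rho> x v\<close> for \<open>x\<close> in the carrier of \<open>L\<close> and \<open>v \<in> V\<close> matter.
\<close>

locale lie_module =
  fixes L :: "'b lie"
    and s :: "complex \<Rightarrow> 'v::ab_group_add \<Rightarrow> 'v"
    and V :: "'v set"
    and \<rho> :: "'b \<Rightarrow> 'v \<Rightarrow> 'v"
  assumes vs: "vector_space s"
    and subsp: "module.subspace s V"
    and act_closed: "\<lbrakk>x \<in> lcarrier L; v \<in> V\<rbrakk> \<Longrightarrow> \<rho> x v \<in> V"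
    and act_add: "\<lbrakk>x \<in> lcarrier L; v \<in> V; w \<in> V\<rbrakk> \<Longrightarrow> \<rho> x (v + w) = \<rho> x v + \<rho> x w"
    and act_scale: "\<lbrakk>x \<in> lcarrier L; v \<in> V\<rbrakk> \<Longrightarrow> \<rho> x (s c v) = s c (\<rho> x v)"
    and ladd_act: "\<lbrakk>x \<in> lcarrier L; y \<in> lcarrier L; v \<in> V\<rbrakk> \<Longrightarrow> \<rho> (ladd L x y) v = \<rho> x v + \<rho> y v"
    and lsmult_act: "\<lbrakk>x \<in> lcarrier L; v \<in> V\<rbrakk> \<Longrightarrow> \<rho> (lsmult L c x) v = s c (\<rho> x v)"
    and lbr_act: "\<lbrakk>x \<in> lcarrier L; y \<in> lcarrier L; v \<in> V\<rbrakk> \<Longrightarrow>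
                    \<rho> (lbr L x y) v = \<rho> x (\<rho> y v) - \<rho> y (\<rho> x v)"

definition irreducible_lie_module ::
    "'b lie \<Rightarrow> (complex \<Rightarrow> 'v::ab_group_add \<Rightarrow> 'v) \<Rightarrow> 'v set \<Rightarrow> ('b \<Rightarrow> 'v \<Rightarrow> 'v) \<Rightarrow> bool" where
  "irreducible_lie_module L s V \<rho> \<longleftrightarrow>
     lie_module L s V \<rho> \<and> V \<noteq> {0} \<and>
     (\<forall>W. module.subspace s W \<and> W \<subseteq> V \<and> (\<forall>x\<in>lcarrier L. \<forall>w\<in>W. \<rho> x w \<in> W)
        \<longrightarrow> W = {0} \<or> W = V)"

definition finite_dim :: "(complex \<Rightarrow> 'v::ab_group_add \<Rightarrow> 'v) \<Rightarrow> 'v set \<Rightarrow> bool" where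
  "finite_dim s V \<longleftrightarrow> (\<exists>S. finite S \<and> V = module.span s S)"


section \<open>Universal enveloping algebras\<close>

text \<open>
  The free monoid, written additively so that \<open>'a fmon \<Rightarrow>\<^sub>0 complex\<close>, with the
  convolution product of \<^theory>\<open>HOL-Library.Poly_Mapping\<close>, is the free associative algebra.
\<close>

datatype 'a fmon = FMon (letters: "'a list")

instantiation fmon :: (type) monoid_add
begin

definition zero_fmon :: "'a fmon" where
  "zero_fmon = FMon []"

definition plus_fmon :: "'a fmon \<Rightarrow> 'a fmon \<Rightarrow> 'a fmon" where
  "plus_fmon v w = FMon (letters v @ letters w)"

instance
  by standard (simp_all add: zero_fmon_def plus_fmon_def)

end

definition free_alg :: "'a set \<Rightarrow> ('a fmon \<Rightarrow>\<^sub>0 complex) ring" where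
  "free_alg X =
     \<lparr>carrier = {p. \<forall>w\<in>Poly_Mapping.keys p. set (letters w) \<subseteq> X},
      mult = (*), one = 1, zero = 0, add = (+)\<rparr>"

definition gen :: "'a \<Rightarrow> 'a fmon \<Rightarrow>\<^sub>0 complex" where
  "gen x = Poly_Mapping.single (FMon [x]) 1"

definition fconst :: "complex \<Rightarrow> 'a fmon \<Rightarrow>\<^sub>0 complex" where
  "fconst c = Poly_Mapping.single 0 c"

definition uea_ideal :: "'b lie \<Rightarrow> ('b fmon \<Rightarrow>\<^sub>0 complex) set" where
  "uea_ideal L = Idl\<^bsub>free_alg (lcarrier L)\<^esub>
     ({gen (ladd L x y) - (gen x + gen y) | x y. x \<in> lcarrier L \<and> y \<in> lcarrier L} \<union>
      {gen (lsmult L c x) - fconst c * gen x | c x. x \<in> lcarrier L} \<union>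
      {gen x * gen y - gen y * gen x - gen (lbr L x y) | x y. x \<in> lcarrier L \<and> y \<in> lcarrier L})"

definition uea :: "'b lie \<Rightarrow> ('b fmon \<Rightarrow>\<^sub>0 complex) set ring" where
  "uea L = free_alg (lcarrier L) Quot uea_ideal L"

definition uea_class :: "'b lie \<Rightarrow> ('b fmon \<Rightarrow>\<^sub>0 complex) \<Rightarrow> ('b fmon \<Rightarrow>\<^sub>0 complex) set" where
  "uea_class L p = uea_ideal L +>\<^bsub>free_alg (lcarrier L)\<^esub> p"


section \<open>Laurent polynomials and Hamiltonian vector fields\<close>

text \<open>
  \<open>N = CARD('n)\<close>; a Laurent polynomial is its family of coefficients, and the
  product of \<^theory>\<open>HOL-Library.Poly_Mapping\<close> is the convolution product.
\<close>

type_synonym 'n laurent = "int ^ 'n \<Rightarrow>\<^sub>0 complex"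
type_synonym 'n vfield = "'n laurent \<Rightarrow> 'n laurent"

definition tmon :: "int ^ 'n::finite \<Rightarrow> 'n laurent" where
  "tmon r = Poly_Mapping.single r 1"

definition lscale :: "complex \<Rightarrow> 'n::finite laurent \<Rightarrow> 'n laurent" where
  "lscale c f = Poly_Mapping.map (\<lambda>a. c * a) f"

definition cvec :: "int ^ 'n::finite \<Rightarrow> complex ^ 'n" where
  "cvec r = (\<chi> i. of_int (r $ i))"

text \<open>The complex-bilinear form \<open>(u|v)\<close>, not the Hermitian inner product.\<close>

definition bform :: "complex ^ 'n::finite \<Rightarrow> complex ^ 'n \<Rightarrow> complex" where
  "bform u v = (\<Sum>i\<in>UNIV. u $ i * v $ i)"

definition partial_deriv :: "'n::finite \<Rightarrow> 'n vfield" where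
  "partial_deriv i f =
     (\<Sum>k\<in>Poly_Mapping.keys f.
        Poly_Mapping.single (k - axis i 1) (of_int (k $ i) * Poly_Mapping.lookup f k))"

definition euler_d :: "'n::finite \<Rightarrow> 'n vfield" where
  "euler_d i f = tmon (axis i 1) * partial_deriv i f"

definition D :: "complex ^ 'n::finite \<Rightarrow> int ^ 'n \<Rightarrow> 'n vfield" where
  "D u r f = (\<Sum>i\<in>UNIV. lscale (u $ i) (tmon r * euler_d i f))"

definition der_alg :: "'n::finite vfield lie" where
  "der_alg =
     \<lparr>lcarrier = {X. (\<forall>f g. X (f + g) = X f + X g) \<and> (\<forall>c f. X (lscale c f) = lscale c (X f)) \<and>
                     (\<forall>f g. X (f * g) = X f * g + f * X g)},
      lzero = (\<lambda>f. 0),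
      ladd = (\<lambda>X Y f. X f + Y f),
      lsmult = (\<lambda>c X f. lscale c (X f)),
      lbr = (\<lambda>X Y f. X (Y f) - Y (X f))\<rparr>"

text \<open>\<open>D(Br, r)\<close>\<close>

definition DB :: "complex ^ 'n ^ 'n \<Rightarrow> int ^ 'n::finite \<Rightarrow> 'n vfield" where
  "DB B r = D (B *v cvec r) r"

definition ham :: "complex ^ 'n ^ 'n::finite \<Rightarrow> 'n vfield lie" where
  "ham B = lie_restrict der_alg
     (lspan der_alg ({DB B r | r. r \<noteq> 0} \<union> {D u 0 | u. True}))"

text \<open>The semidirect product of \<open>ham B\<close> with the abelian Lie algebra \<open>\<A>\<close>.\<close>

definition ham_semi :: "complex ^ 'n ^ 'n::finite \<Rightarrow> ('n vfield \<times> 'n laurent) lie" where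
  "ham_semi B =
     \<lparr>lcarrier = lcarrier (ham B) \<times> UNIV,
      lzero = (lzero (ham B), 0),
      ladd = (\<lambda>(X, f) (Y, g). (ladd (ham B) X Y, f + g)),
      lsmult = (\<lambda>c (X, f). (lsmult (ham B) c X, lscale c f)),
      lbr = (\<lambda>(X, f) (Y, g). (lbr (ham B) X Y, X g - Y f))\<rparr>"


section \<open>Jet modules\<close>

locale jet_module = lie_module "ham B" s V \<rho>
  for B :: "complex ^ 'n ^ 'n::finite"
    and s :: "complex \<Rightarrow> 'v::ab_group_add \<Rightarrow> 'v"
    and V :: "'v set"
    and \<rho> :: "'n vfield \<Rightarrow> 'v \<Rightarrow> 'v"
    and \<alpha> :: "'n laurent \<Rightarrow> 'v \<Rightarrow> 'v" +
  assumes alg_closed: "v \<in> V \<Longrightarrow> \<alpha> f v \<in> V"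
    and alg_add: "\<lbrakk>v \<in> V; w \<in> V\<rbrakk> \<Longrightarrow> \<alpha> f (v + w) = \<alpha> f v + \<alpha> f w"
    and alg_scale: "v \<in> V \<Longrightarrow> \<alpha> f (s c v) = s c (\<alpha> f v)"
    and add_alg: "v \<in> V \<Longrightarrow> \<alpha> (f + g) v = \<alpha> f v + \<alpha> g v"
    and scale_alg: "v \<in> V \<Longrightarrow> \<alpha> (lscale c f) v = s c (\<alpha> f v)"
    and mult_alg: "v \<in> V \<Longrightarrow> \<alpha> (f * g) v = \<alpha> f (\<alpha> g v)"
    and one_alg: "v \<in> V \<Longrightarrow> \<alpha> 1 v = v"
    and compat: "\<lbrakk>\<eta> \<in> lcarrier (ham B); v \<in> V\<rbrakk> \<Longrightarrow> \<rho> \<eta> (\<alpha> f v) = \<alpha> (\<eta> f) v + \<alpha> f (\<rho> \<eta> v)"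

definition irreducible_jet_module ::
    "complex ^ 'n ^ 'n::finite \<Rightarrow> (complex \<Rightarrow> 'v::ab_group_add \<Rightarrow> 'v) \<Rightarrow> 'v set \<Rightarrow>
     ('n vfield \<Rightarrow> 'v \<Rightarrow> 'v) \<Rightarrow> ('n laurent \<Rightarrow> 'v \<Rightarrow> 'v) \<Rightarrow> bool" where
  "irreducible_jet_module B s V \<rho> \<alpha> \<longleftrightarrow>
     jet_module B s V \<rho> \<alpha> \<and> V \<noteq> {0} \<and>
     (\<forall>W. module.subspace s W \<and> W \<subseteq> V \<and>
          (\<forall>\<eta>\<in>lcarrier (ham B). \<forall>w\<in>W. \<rho> \<eta> w \<in> W) \<and> (\<forall>f. \<forall>w\<in>W. \<alpha> f w \<in> W)
        \<longrightarrow> W = {0} \<or> W = V)"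

text \<open>
  The weight space of weight \<open>u \<mapsto> (u|\<gamma>)\<close>; every linear functional on \<open>\<complex>\<^sup>N\<close> has this
  form, and \<open>t\<^sup>0 = 1\<close> acts as the identity, so it imposes no condition.
\<close>

definition weight_space ::
    "(complex \<Rightarrow> 'v \<Rightarrow> 'v) \<Rightarrow> 'v set \<Rightarrow> ('n vfield \<Rightarrow> 'v \<Rightarrow> 'v) \<Rightarrow>
     complex ^ 'n::finite \<Rightarrow> 'v set" where
  "weight_space s V \<rho> \<gamma> = {v \<in> V. \<forall>u. \<rho> (D u 0) v = s (bform u \<gamma>) v}"

definition jet_iso ::
    "complex ^ 'n ^ 'n::finite \<Rightarrow>
     (complex \<Rightarrow> 'v \<Rightarrow> 'v) \<Rightarrow> 'v::ab_group_add set \<Rightarrow>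
       ('n vfield \<Rightarrow> 'v \<Rightarrow> 'v) \<Rightarrow> ('n laurent \<Rightarrow> 'v \<Rightarrow> 'v) \<Rightarrow>
     (complex \<Rightarrow> 'w \<Rightarrow> 'w) \<Rightarrow> 'w::ab_group_add set \<Rightarrow>
       ('n vfield \<Rightarrow> 'w \<Rightarrow> 'w) \<Rightarrow> ('n laurent \<Rightarrow> 'w \<Rightarrow> 'w) \<Rightarrow>
     ('v \<Rightarrow> 'w) \<Rightarrow> bool" where
  "jet_iso B s V \<rho> \<alpha> s' V' \<rho>' \<alpha>' \<phi> \<longleftrightarrow>
     bij_betw \<phi> V V' \<and>
     (\<forall>v\<in>V. \<forall>w\<in>V. \<phi> (v + w) = \<phi> v + \<phi> w) \<and>
     (\<forall>c. \<forall>v\<in>V. \<phi> (s c v) = s' c (\<phi> v)) \<and>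
     (\<forall>\<eta>\<in>lcarrier (ham B). \<forall>v\<in>V. \<phi> (\<rho> \<eta> v) = \<rho>' \<eta> (\<phi> v)) \<and>
     (\<forall>f. \<forall>v\<in>V. \<phi> (\<alpha> f v) = \<alpha>' f (\<phi> v))"


section \<open>The Lie algebra \<open>\<T>\<^sub>B\<close>\<close>

text \<open>
  \<open>jet_alg B\<close> is the universal enveloping algebra of \<open>ham_semi B\<close> modulo the ideal
  generated by \<open>t\<^sup>r t\<^sup>s - t\<^sup>r\<^sup>+\<^sup>s\<close> and \<open>t\<^sup>0 - 1\<close>; \<open>jet_class B p\<close> is the image in it of
  an element \<open>p\<close> of the free algebra.
\<close>

definition jet_ideal where
  "jet_ideal B = Idl\<^bsub>uea (ham_semi B)\<^esub>
     ({uea_class (ham_semi B) (gen (lzero der_alg, tmon r)) \<otimes>\<^bsub>uea (ham_semi B)\<^esub>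
         uea_class (ham_semi B) (gen (lzero der_alg, tmon q)) \<ominus>\<^bsub>uea (ham_semi B)\<^esub>
         uea_class (ham_semi B) (gen (lzero der_alg, tmon (r + q))) | r q. True} \<union>
      {uea_class (ham_semi B) (gen (lzero der_alg, tmon 0)) \<ominus>\<^bsub>uea (ham_semi B)\<^esub>
         \<one>\<^bsub>uea (ham_semi B)\<^esub>})"

definition jet_alg where
  "jet_alg B = uea (ham_semi B) Quot jet_ideal B"

definition jet_class where
  "jet_class B p = jet_ideal B +>\<^bsub>uea (ham_semi B)\<^esub> uea_class (ham_semi B) p"

definition vf_elt where
  "vf_elt B X = jet_class B (gen (X, 0))"

definition fun_elt where
  "fun_elt B f = jet_class B (gen (lzero der_alg, f))"

definition T where
  "T B r = fun_elt B (tmon (- r)) \<otimes>\<^bsub>jet_alg B\<^esub> vf_elt B (DB B r) \<ominus>\<^bsub>jet_alg B\<^esub>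
             vf_elt B (D (B *v cvec r) 0)"

definition jet_lie where
  "jet_lie B =
     \<lparr>lcarrier = carrier (jet_alg B),
      lzero = \<zero>\<^bsub>jet_alg B\<^esub>,
      ladd = (\<lambda>x y. x \<oplus>\<^bsub>jet_alg B\<^esub> y),
      lsmult = (\<lambda>c x. jet_class B (fconst c) \<otimes>\<^bsub>jet_alg B\<^esub> x),
      lbr = (\<lambda>x y. x \<otimes>\<^bsub>jet_alg B\<^esub> y \<ominus>\<^bsub>jet_alg B\<^esub> y \<otimes>\<^bsub>jet_alg B\<^esub> x)\<rparr>"

definition TB where
  "TB B = lie_restrict (jet_lie B) (lspan (jet_lie B) {T B r | r. True})"

definition third_diff where
  "third_diff B q r =
     (\<Oplus>\<^bsub>jet_alg B\<^esub>S\<in>Pow {1, 2, 3 :: nat}.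
        lsmult (jet_lie B) ((- 1) ^ card S) (T B (q + (\<Sum>i\<in>S. r i))))"

definition I3 where
  "I3 B = lspan (TB B) {third_diff B q r | q r. True}"


section \<open>The symplectic Lie algebra and the homomorphism \<open>\<psi>\<^sub>B\<close>\<close>

text \<open>
  The realisation \<open>{X. BX = -X\<^sup>TB}\<close> of \<open>sp(2m)\<close> attached to the symplectic form \<open>B\<close>.
\<close>

definition sp_alg :: "complex ^ 'n ^ 'n::finite \<Rightarrow> (complex ^ 'n ^ 'n) lie" where
  "sp_alg B =
     \<lparr>lcarrier = {X. B ** X = - (transpose X ** B)},
      lzero = 0,
      ladd = (+),
      lsmult = (\<lambda>c X. \<chi> i j. c * X $ i $ j),
      lbr = (\<lambda>X Y. X ** Y - Y ** X)\<rparr>"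

text \<open>
  The two conditions determine \<open>\<psi>\<close> on \<open>\<T>\<^sub>B\<close>, since the \<open>T(r)\<close> span it; the matrix is \<open>r (Br)\<^sup>T\<close>.
\<close>

definition is_psi where
  "is_psi B \<psi> \<longleftrightarrow> lie_hom (TB B) (sp_alg B) \<psi> \<and>
     (\<forall>r. \<psi> (T B r) = (\<chi> i j. cvec r $ i * (B *v cvec r) $ j))"

definition R_alg where
  "R_alg B \<psi> = lie_quot (lie_restrict (TB B) (lie_ker (TB B) (sp_alg B) \<psi>)) (I3 B)"

text \<open>
  \<open>\<Theta>\<close> identifies \<open>\<T>\<^sub>B / I\<^sub>3\<close> with \<open>sp \<oplus> R\<close>: it is an isomorphism that induces
  \<open>\<psi>\<^sub>B\<close> on the first summand and is the identity on \<open>R = ker \<psi>\<^sub>B / I\<^sub>3\<close>.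
\<close>

definition is_identification where
  "is_identification B \<psi> \<Theta> \<longleftrightarrow>
     lie_iso (lie_quot (TB B) (I3 B)) (lie_sum (sp_alg B) (R_alg B \<psi>)) \<Theta> \<and>
     (\<forall>x\<in>lcarrier (TB B). fst (\<Theta> (lie_coset (TB B) (I3 B) x)) = \<psi> x) \<and>
     (\<forall>y\<in>lcarrier (R_alg B \<psi>). \<Theta> y = (0, y))"


section \<open>The jet module \<open>V\<^sub>0 \<otimes> \<A>\<close>\<close>

text \<open>
  \<open>V\<^sub>0 \<otimes> \<A>\<close> is realised as the space of Laurent polynomials with coefficients in \<open>V\<^sub>0\<close>;
  the universal property of the tensor product is proved below.
\<close>

definition tensor_space :: "'v::zero set \<Rightarrow> (int ^ 'n::finite \<Rightarrow>\<^sub>0 'v) set" where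
  "tensor_space V = {p. \<forall>k. Poly_Mapping.lookup p k \<in> V}"

definition tensor_scale ::
    "(complex \<Rightarrow> 'v \<Rightarrow> 'v) \<Rightarrow> complex \<Rightarrow> (int ^ 'n::finite \<Rightarrow>\<^sub>0 'v::zero) \<Rightarrow> (int ^ 'n \<Rightarrow>\<^sub>0 'v)" where
  "tensor_scale s c p = Poly_Mapping.map (s c) p"

definition tensor ::
    "(complex \<Rightarrow> 'v \<Rightarrow> 'v) \<Rightarrow> 'v \<Rightarrow> 'n::finite laurent \<Rightarrow> (int ^ 'n \<Rightarrow>\<^sub>0 'v::comm_monoid_add)" where
  "tensor s v f =
     (\<Sum>k\<in>Poly_Mapping.keys f. Poly_Mapping.single k (s (Poly_Mapping.lookup f k) v))"

text \<open>
  The conditions determine the two actions on \<open>V \<otimes> \<A>\<close>, since \<open>ham B\<close> is spanned by the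
  \<open>D(Br, r)\<close> and \<open>D(u, 0)\<close>, and \<open>V \<otimes> \<A>\<close> by the \<open>v \<otimes> t\<^sup>k\<close>.
\<close>

definition jet_tensor_module ::
    "complex ^ 'n ^ 'n \<Rightarrow> complex ^ 'n::finite \<Rightarrow>
     (complex \<Rightarrow> 'v::ab_group_add \<Rightarrow> 'v) \<Rightarrow> 'v set \<Rightarrow> _ \<Rightarrow>
     ('n vfield \<Rightarrow> (int ^ 'n \<Rightarrow>\<^sub>0 'v) \<Rightarrow> (int ^ 'n \<Rightarrow>\<^sub>0 'v)) \<Rightarrow>
     ('n laurent \<Rightarrow> (int ^ 'n \<Rightarrow>\<^sub>0 'v) \<Rightarrow> (int ^ 'n \<Rightarrow>\<^sub>0 'v)) \<Rightarrow> bool" where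
  "jet_tensor_module B \<beta> s V \<tau> \<rho> \<alpha> \<longleftrightarrow>
     jet_module B (tensor_scale s) (tensor_space V) \<rho> \<alpha> \<and>
     (\<forall>v\<in>V. \<forall>r k. \<rho> (DB B r) (tensor s v (tmon k)) =
        tensor_scale s (bform (B *v cvec r) (cvec k + \<beta>)) (tensor s v (tmon (k + r))) +
        tensor s (\<tau> (T B r) v) (tmon (k + r))) \<and>
     (\<forall>v\<in>V. \<forall>u k. \<rho> (D u 0) (tensor s v (tmon k)) =
        tensor_scale s (bform u (cvec k + \<beta>)) (tensor s v (tmon k))) \<and>
     (\<forall>v\<in>V. \<forall>r k. \<alpha> (tmon r) (tensor s v (tmon k)) = tensor s v (tmon (k + r)))"

lemma lookup_tensor:
  assumes "vector_space s"
  shows "Poly_Mapping.lookup (tensor s v f) k = s (Poly_Mapping.lookup f k) v"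
proof -
  interpret vector_space s by fact
  show ?thesis
    by (simp add: tensor_def lookup_sum lookup_single when_def sum.delta in_keys_iff)
qed

lemma lookup_tensor_scale:
  assumes "vector_space s"
  shows "Poly_Mapping.lookup (tensor_scale s c p) k = s c (Poly_Mapping.lookup p k)"
proof -
  interpret vector_space s by fact
  show ?thesis
    by (simp add: tensor_scale_def Poly_Mapping.map.rep_eq when_def)
qed

lemma lookup_lscale: "Poly_Mapping.lookup (lscale c f) k = c * Poly_Mapping.lookup f k"
  by (simp add: lscale_def Poly_Mapping.map.rep_eq when_def)

lemma tensor_universal:
  fixes s :: "complex \<Rightarrow> 'v::ab_group_add \<Rightarrow> 'v" and s' :: "complex \<Rightarrow> 'w::ab_group_add \<Rightarrow> 'w"
    and b :: "'v \<Rightarrow> 'n::finite laurent \<Rightarrow> 'w"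
  assumes s: "vector_space s" and V: "module.subspace s V" and s': "vector_space s'"
    and b1: "\<And>v w f. v \<in> V \<Longrightarrow> w \<in> V \<Longrightarrow> b (v + w) f = b v f + b w f"
    and b2: "\<And>c v f. v \<in> V \<Longrightarrow> b (s c v) f = s' c (b v f)"
    and b3: "\<And>v f g. v \<in> V \<Longrightarrow> b v (f + g) = b v f + b v g"
    and b4: "\<And>c v f. v \<in> V \<Longrightarrow> b v (lscale c f) = s' c (b v f)"
  defines "P \<equiv> \<lambda>h. (\<forall>p\<in>tensor_space V. \<forall>q\<in>tensor_space V. h (p + q) = h p + h q) \<and>
                 (\<forall>c. \<forall>p\<in>tensor_space V. h (tensor_scale s c p) = s' c (h p)) \<and>
                 (\<forall>v\<in>V. \<forall>f. h (tensor s v f) = b v f)"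
  shows "\<exists>h. P h \<and> (\<forall>h'. P h' \<longrightarrow> (\<forall>p\<in>tensor_space V. h' p = h p))"
proof -
  interpret s: vector_space s by fact
  interpret s': vector_space s' by fact
  have V0: "0 \<in> V" and Vadd: "\<And>v w. v \<in> V \<Longrightarrow> w \<in> V \<Longrightarrow> v + w \<in> V"
    and Vsc: "\<And>c v. v \<in> V \<Longrightarrow> s c v \<in> V"
    using V by (auto simp: s.subspace_def)
  have b0: "b 0 f = 0" for f
    using b2[OF V0, of 0 f] by simp
  define h where "h p = (\<Sum>k\<in>Poly_Mapping.keys p. b (Poly_Mapping.lookup p k) (tmon k))"
    for p :: "int ^ 'n \<Rightarrow>\<^sub>0 'v"
  have h_eq: "h p = (\<Sum>k\<in>K. b (Poly_Mapping.lookup p k) (tmon k))"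
    if "finite K" "Poly_Mapping.keys p \<subseteq> K" for p :: "int ^ 'n \<Rightarrow>\<^sub>0 'v" and K
    unfolding h_def
    by (rule sum.mono_neutral_left) (use that b0 in \<open>auto simp: in_keys_iff\<close>)
  have decomp: "p = (\<Sum>k\<in>Poly_Mapping.keys p. tensor s (Poly_Mapping.lookup p k) (tmon k))"
    for p :: "int ^ 'n \<Rightarrow>\<^sub>0 'v"
    by (rule poly_mapping_eqI)
      (simp add: lookup_sum lookup_tensor[OF s] tmon_def lookup_single when_def if_distrib[of "\<lambda>c. s c _"]
        sum.delta in_keys_iff cong: if_cong)
  have tens: "tensor s v f \<in> tensor_space V" if "v \<in> V" for v and f :: "'n laurent"
    using that by (simp add: tensor_space_def lookup_tensor[OF s] Vsc)
  have lin0: "h' 0 = 0" if "P h'" for h'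
  proof -
    have "(0 :: int ^ 'n \<Rightarrow>\<^sub>0 'v) \<in> tensor_space V"
      by (simp add: tensor_space_def V0)
    then have "h' (0 + 0) = h' 0 + h' 0"
      using that unfolding P_def by blast
    then show ?thesis by simp
  qed
  have tsum: "(\<Sum>k\<in>K. g k) \<in> tensor_space V"
    if "finite K" "\<And>k. k \<in> K \<Longrightarrow> g k \<in> tensor_space V" for g :: "int ^ 'n \<Rightarrow> int ^ 'n \<Rightarrow>\<^sub>0 'v" and K
    using that by (induction K) (auto simp: tensor_space_def lookup_add V0 Vadd)
  have linsum: "h' (\<Sum>k\<in>K. g k) = (\<Sum>k\<in>K. h' (g k))"
    if "P h'" "finite K" "\<And>k. k \<in> K \<Longrightarrow> g k \<in> tensor_space V"
    for h' and g :: "int ^ 'n \<Rightarrow> int ^ 'n \<Rightarrow>\<^sub>0 'v" and K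
    using that(2,3)
  proof (induction K)
    case empty
    then show ?case using lin0[OF that(1)] by simp
  next
    case (insert k K)
    then have "h' (g k + sum g K) = h' (g k) + h' (sum g K)"
      using that(1) tsum[of K g] unfolding P_def by simp
    with insert show ?case by simp
  qed
  have "P h" unfolding P_def
  proof (intro conjI ballI allI)
    fix p q :: "int ^ 'n \<Rightarrow>\<^sub>0 'v" assume pq: "p \<in> tensor_space V" "q \<in> tensor_space V"
    let ?K = "Poly_Mapping.keys p \<union> Poly_Mapping.keys q"
    have "h (p + q) = (\<Sum>k\<in>?K. b (Poly_Mapping.lookup (p + q) k) (tmon k))"
      by (rule h_eq) (use keys_add[of p q] in auto)
    also have "\<dots> = (\<Sum>k\<in>?K. b (Poly_Mapping.lookup p k) (tmon k)) +
                    (\<Sum>k\<in>?K. b (Poly_Mapping.lookup q k) (tmon k))"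
      using pq by (simp add: lookup_add b1 tensor_space_def sum.distrib)
    also have "\<dots> = h p + h q"
      using h_eq[of ?K p] h_eq[of ?K q] by simp
    finally show "h (p + q) = h p + h q" .
  next
    fix c and p :: "int ^ 'n \<Rightarrow>\<^sub>0 'v" assume p: "p \<in> tensor_space V"
    have "h (tensor_scale s c p) =
        (\<Sum>k\<in>Poly_Mapping.keys p. b (Poly_Mapping.lookup (tensor_scale s c p) k) (tmon k))"
      by (rule h_eq) (auto simp: in_keys_iff lookup_tensor_scale[OF s])
    also have "\<dots> = s' c (h p)"
      using p by (simp add: lookup_tensor_scale[OF s] b2 tensor_space_def h_def s'.scale_sum_right)
    finally show "h (tensor_scale s c p) = s' c (h p)" .
  next
    fix v and f :: "'n laurent" assume v: "v \<in> V"
    have bsum: "b v (\<Sum>k\<in>K. g k) = (\<Sum>k\<in>K. b v (g k))"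
      if "finite K" for g :: "int ^ 'n \<Rightarrow> 'n laurent" and K
      using that
    proof (induction K)
      case empty
      then show ?case using b3[OF v, of 0 0] by simp
    next
      case (insert k K)
      then show ?case by (simp add: b3[OF v])
    qed
    have "h (tensor s v f) =
        (\<Sum>k\<in>Poly_Mapping.keys f. b (Poly_Mapping.lookup (tensor s v f) k) (tmon k))"
      by (rule h_eq) (auto simp: in_keys_iff lookup_tensor[OF s])
    also have "\<dots> = (\<Sum>k\<in>Poly_Mapping.keys f. b v (lscale (Poly_Mapping.lookup f k) (tmon k)))"
      by (simp add: lookup_tensor[OF s] b2[OF v] b4[OF v])
    also have "\<dots> = b v (\<Sum>k\<in>Poly_Mapping.keys f. lscale (Poly_Mapping.lookup f k) (tmon k))"
      by (simp add: bsum)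
    also have "(\<Sum>k\<in>Poly_Mapping.keys f. lscale (Poly_Mapping.lookup f k) (tmon k)) = f"
      by (rule poly_mapping_eqI)
        (simp add: lookup_sum lookup_lscale tmon_def lookup_single when_def if_distrib[of "\<lambda>c. _ * c"]
          sum.delta in_keys_iff cong: if_cong)
    finally show "h (tensor s v f) = b v f" .
  qed
  moreover have "h' p = h p" if h': "P h'" and p: "p \<in> tensor_space V" for h' and p :: "int ^ 'n \<Rightarrow>\<^sub>0 'v"
  proof -
    have *: "g p = (\<Sum>k\<in>Poly_Mapping.keys p. b (Poly_Mapping.lookup p k) (tmon k))" if "P g" for g
    proof -
      have pV: "Poly_Mapping.lookup p k \<in> V" for k
        using p by (simp add: tensor_space_def)
      have "g p = g (\<Sum>k\<in>Poly_Mapping.keys p. tensor s (Poly_Mapping.lookup p k) (tmon k))"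
        using decomp[of p] by simp
      also have "\<dots> = (\<Sum>k\<in>Poly_Mapping.keys p. g (tensor s (Poly_Mapping.lookup p k) (tmon k)))"
        by (rule linsum[OF that]) (simp_all add: tens pV)
      also have "\<dots> = (\<Sum>k\<in>Poly_Mapping.keys p. b (Poly_Mapping.lookup p k) (tmon k))"
        using that pV unfolding P_def by simp
      finally show ?thesis .
    qed
    show ?thesis by (simp add: *[OF h'] h_def)
  qed
  ultimately show ?thesis by blast
qed

end

theory Submission
  imports Defs "HOL-Library.Function_Algebras" "HOL-Computational_Algebra.Fundamental_Theorem_Algebra"
begin

text \<open>
  (1) The weight space \<open>V\<^sub>0\<close> is stable under \<open>T(r)\<close>, and the \<open>t\<^sup>k\<close> carry it isomorphically onto the
  other weight spaces, so that \<open>V\<close> is \<open>V\<^sub>0 \<otimes> \<A>\<close>; a submodule of \<open>V\<^sub>0\<close> generates a graded submodule of \<open>V\<close>.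

  (2) The point is that third differences of \<open>T\<close> act by zero on a finite-dimensional irreducible
  module. On a line \<open>s + \<int>r\<close> with \<open>\<omega>(r, s) = (Br|s) \<noteq> 0\<close> the operators \<open>ad T(mr) / (m \<omega>(r, s))\<close> shift differences of \<open>T\<close>
  along the line. If \<open>T\<close> were not polynomial on lines with many different values of \<open>\<omega>(r, s)\<close>, a
  Vandermonde argument would produce too many linearly independent operators; the bracket relation
  then spreads polynomiality to all lines. The value at \<open>0\<close> is exceptional and is first replaced by the
  extrapolated one. If \<open>k \<ge> 3\<close> is the order of the top non-zero differences, these span an abelian
  ideal, which acts by scalars by Lie's lemma; hence
  \<open>[T(a), \<Delta>\<^bsub>s\<^esub> T] = \<Sum>\<^bsub>i\<^esub> \<omega>(a, s\<^sub>i) \<Delta>\<^bsub>s[i := a]\<^esub> T\<close> vanishes, and this forces the top differences to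
  vanish. In \<open>\<T>\<^sub>B / I\<^sub>3\<close> the odd part \<open>(T(r) - T(-r)) / 2\<close> is central and the even part spans a copy of \<open>sp\<close>.
\<close>


section \<open>Finite differences\<close>

text \<open>In \<open>[T(a), T(b)] = om(a, b)(T(a + b) - T(a) - T(b))\<close> a value at 0 enters
  only with coefficient 0, because \<open>om(a, -a) = om(0, b) = 0\<close>. The relation therefore
  says nothing about \<open>T(0)\<close>, polynomiality is proved for a corrected function
  \<open>F\<close>, and \<open>F 0 = 0\<close> is a separate fact: \<open>F 0\<close> is a scalar
  operator, a non-zero multiple of it is a commutator, and Lie's lemma forces it to vanish. Finite
  dimension enters by counting: the operators on the module are spanned by \<open>d\<close>
  elements, so at most \<open>d\<close> non-zero values of \<open>om r\<close> belong to lines with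
  a non-zero difference of order \<open>d + 2\<close>. Such bad lines are repaired from good ones,
  since the bracket of \<open>T(u)\<close> and \<open>T(q - u)\<close> expresses
  \<open>om(u, q) T(q)\<close> through \<open>T(q - u)\<close>, and \<open>u\<close> can be chosen
  so that \<open>q - u\<close> runs on a good line. The \<open>T(r)\<close> live in a quotient of a
  free algebra, where unexpected relations among them are hard to exclude. All computations are done
  with formal combinations of symbols \<open>T(k)\<close>, stored as Laurent polynomials
  \<open>c\<close> with image \<open>Tm c\<close>; \<open>psi\<close> respects every relation
  because it can be read off from one concrete jet module.\<close>

definition fdiff :: "'a::ab_group_add \<Rightarrow> ('a \<Rightarrow> 'b::ab_group_add) \<Rightarrow> 'a \<Rightarrow> 'b" where
  "fdiff r F = (\<lambda>q. F (q + r) - F q)"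

definition fdiffs :: "'a::ab_group_add list \<Rightarrow> ('a \<Rightarrow> 'b::ab_group_add) \<Rightarrow> 'a \<Rightarrow> 'b" where
  "fdiffs rs F = fold fdiff rs F"

lemma fdiffs_simps [simp]: "fdiffs [] F = F" "fdiffs (r # rs) F = fdiffs rs (fdiff r F)"
  by (simp_all add: fdiffs_def)

lemma fdiff_commute: "fdiff r (fdiff s F) = fdiff s (fdiff r F)"
  by (simp add: fdiff_def algebra_simps)

lemma fdiffs_fdiff: "fdiffs rs (fdiff r F) = fdiff r (fdiffs rs F)"
  by (induction rs arbitrary: F) (simp_all add: fdiff_commute[of _ r])

lemma fdiffs_append: "fdiffs (rs @ ss) F = fdiffs ss (fdiffs rs F)"
  by (induction rs arbitrary: F) auto

lemma fdiffs_commute: "fdiffs rs (fdiffs ss F) = fdiffs ss (fdiffs rs F)"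
  by (induction rs arbitrary: F) (auto simp: fdiffs_fdiff)

lemma fdiff_add: "fdiff r (\<lambda>q. F q + G q) = (\<lambda>q. fdiff r F q + fdiff r G q)"
  and fdiff_minus: "fdiff r (\<lambda>q. F q - G q) = (\<lambda>q. fdiff r F q - fdiff r G q)"
  and fdiff_const: "fdiff r (\<lambda>q. c) = (\<lambda>q. 0)"
  and fdiff_shift: "fdiff r (\<lambda>q. F (q + a)) = (\<lambda>q. fdiff r F (q + a))"
  by (simp_all add: fdiff_def fun_eq_iff algebra_simps)

lemma fdiffs_add: "fdiffs rs (\<lambda>q. F q + G q) = (\<lambda>q. fdiffs rs F q + fdiffs rs G q)"
  by (induction rs arbitrary: F G) (simp_all add: fdiff_add)

lemma fdiffs_minus: "fdiffs rs (\<lambda>q. F q - G q) = (\<lambda>q. fdiffs rs F q - fdiffs rs G q)"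
  by (induction rs arbitrary: F G) (simp_all add: fdiff_minus)

lemma fdiffs_zero: "fdiffs rs (\<lambda>q. 0) = (\<lambda>q. 0)"
  by (induction rs) (simp_all add: fdiff_const)

lemma fdiffs_const: "rs \<noteq> [] \<Longrightarrow> fdiffs rs (\<lambda>q. c) = (\<lambda>q. 0)"
  by (cases rs) (simp_all add: fdiff_const fdiffs_zero)

lemma fdiffs_shift: "fdiffs rs (\<lambda>q. F (q + a)) = (\<lambda>q. fdiffs rs F (q + a))"
  by (induction rs arbitrary: F) (simp_all add: fdiff_shift)

lemma fdiffs_perm: "mset rs = mset ss \<Longrightarrow> fdiffs rs F = fdiffs ss F"
proof (induction rs arbitrary: ss F)
  case (Cons r rs)
  then obtain xs ys where ss: "ss = xs @ r # ys"
    by (metis list.set_intros(1) mset_eq_setD split_list)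
  then have "mset rs = mset (xs @ ys)"
    using Cons.prems by simp
  then have "fdiffs rs (fdiff r F) = fdiffs (xs @ ys) (fdiff r F)"
    by (rule Cons.IH)
  then show ?case
    by (simp add: ss fdiffs_append fdiffs_fdiff)
qed auto

lemma fdiffs_closed:
  assumes "\<And>x y. x \<in> A \<Longrightarrow> y \<in> A \<Longrightarrow> x - y \<in> A" "\<And>q. F q \<in> A"
  shows "fdiffs rs F q \<in> A"
  using assms(2) by (induction rs arbitrary: F) (simp_all add: fdiff_def assms(1))

lemma fdiffs_hom_on:
  assumes A: "\<And>x y. x \<in> A \<Longrightarrow> y \<in> A \<Longrightarrow> x - y \<in> A"
    and h: "\<And>x y. x \<in> A \<Longrightarrow> y \<in> A \<Longrightarrow> h (x - y) = h x - h y"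
    and F: "\<And>q. F q \<in> A"
  shows "fdiffs rs (\<lambda>q. h (F q)) = (\<lambda>q. h (fdiffs rs F q))"
  using F
proof (induction rs arbitrary: F)
  case (Cons r rs)
  have "fdiff r (\<lambda>q. h (F q)) = (\<lambda>q. h (fdiff r F q))"
    by (simp add: fdiff_def h Cons.prems)
  moreover have "fdiff r F q \<in> A" for q
    by (simp add: fdiff_def A Cons.prems)
  ultimately show ?case
    by (simp add: Cons.IH)
qed auto

text \<open>The iterated difference at \<open>q\<close> samples \<open>h\<close> only on the ray
  \<open>q\<close>, \<open>q + r\<close>, \<open>q + 2r\<close>, ...; if all later samples vanish,
  only the term \<open>(-1)^e h(q)\<close> survives. This carries identities known off an
  exceptional point over to that point.\<close>

lemma fdiffs_replicate_point:
  assumes "\<And>j. j \<ge> 1 \<Longrightarrow> h (q + int j *s r) = 0"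
  shows "fdiffs (replicate e r) h q = (if even e then h q else - h q)"
proof -
  have "fdiffs (replicate e r) h (q + int j *s r) = (if j > 0 then 0 else if even e then h q else - h q)" for j
  proof (induction e arbitrary: j)
    case 0
    then show ?case using assms[of j] by auto
  next
    case (Suc e)
    have "fdiffs (replicate (Suc e) r) h (q + int j *s r) =
      fdiffs (replicate e r) h (q + int j *s r + r) - fdiffs (replicate e r) h (q + int j *s r)"
      by (simp add: fdiffs_fdiff) (simp add: fdiff_def)
    also have "q + int j *s r + r = q + int (Suc j) *s r"
      by (simp add: vector_sadd_rdistrib algebra_simps)
    finally show ?case using Suc.IH[of j] Suc.IH[of "Suc j"] by auto
  qed
  from this[of 0] show ?thesis by simp
qed

text \<open>\<open>F\<close> is polynomial of degree less than \<open>k\<close>.\<close>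

definition pol :: "'a::ab_group_add set \<Rightarrow> nat \<Rightarrow> ('a \<Rightarrow> 'b::ab_group_add) \<Rightarrow> bool" where
  "pol S k F \<longleftrightarrow> (\<forall>rs. set rs \<subseteq> S \<and> length rs = k \<longrightarrow> fdiffs rs F = (\<lambda>q. 0))"

lemma pol_0: "pol S 0 F \<longleftrightarrow> F = (\<lambda>q. 0)"
  by (simp add: pol_def)

lemma pol_Suc: "pol S (Suc k) F \<longleftrightarrow> (\<forall>r\<in>S. pol S k (fdiff r F))"
proof
  assume F: "pol S (Suc k) F"
  show "\<forall>r\<in>S. pol S k (fdiff r F)"
    unfolding pol_def
  proof (intro ballI allI impI)
    fix r rs assume "r \<in> S" "set rs \<subseteq> S \<and> length rs = k"
    then show "fdiffs rs (fdiff r F) = (\<lambda>q. 0)"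
      using F[unfolded pol_def, rule_format, of "r # rs"] by simp
  qed
next
  assume F: "\<forall>r\<in>S. pol S k (fdiff r F)"
  show "pol S (Suc k) F"
    unfolding pol_def
  proof (intro allI impI)
    fix rs assume "set rs \<subseteq> S \<and> length rs = Suc k"
    then show "fdiffs rs F = (\<lambda>q. 0)"
      using F by (cases rs) (auto simp: pol_def)
  qed
qed

lemma pol_zero: "pol S k (\<lambda>q. 0)"
  by (simp add: pol_def fdiffs_zero)

lemma pol_minus: "pol S k F \<Longrightarrow> pol S k G \<Longrightarrow> pol S k (\<lambda>q. F q - G q)"
  by (simp add: pol_def fdiffs_minus)

lemma pol_shift: "pol S k F \<Longrightarrow> pol S k (\<lambda>q. F (q + a))"
  by (simp add: pol_def fdiffs_shift fun_eq_iff)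

lemma pol_fdiff: "pol S k F \<Longrightarrow> pol S k (fdiff r F)"
  by (simp add: fdiff_def pol_minus pol_shift)

lemma pol_mono:
  assumes "pol S k F" "k \<le> l"
  shows "pol S l F"
  using assms(2)
proof (induction rule: dec_induct)
  case base
  show ?case by fact
next
  case (step n)
  then show ?case by (auto simp: pol_Suc pol_fdiff)
qed

text \<open>Pigeonhole: among \<open>k + e\<close> directions from \<open>insert u S\<close> there
  are \<open>k\<close> from \<open>S\<close> or \<open>e\<close> copies of \<open>u\<close>. The
  induction strips one direction and lowers \<open>k\<close> or \<open>e\<close>
  accordingly.\<close>

lemma pol_insert:
  "pol S k F \<Longrightarrow> fdiffs (replicate e u) F = (\<lambda>q. 0) \<Longrightarrow> pol (insert u S) (k + e) F"
proof (induction "k + e" arbitrary: k e F)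
  case 0
  then show ?case by (simp add: pol_0)
next
  case (Suc n)
  show ?case
  proof (cases "k = 0 \<or> e = 0")
    case True
    then have "F = (\<lambda>q. 0)" using Suc.prems by (auto simp: pol_0)
    then show ?thesis by (simp add: pol_zero)
  next
    case False
    then obtain k' e' where ke: "k = Suc k'" "e = Suc e'"
      by (metis not0_implies_Suc)
    have "pol (insert u S) n (fdiff r F)" if r: "r \<in> insert u S" for r
    proof (cases "r \<in> S")
      case True
      have "pol (insert u S) (k' + e) (fdiff r F)"
      proof (rule Suc.hyps)
        show "pol S k' (fdiff r F)" using Suc.prems(1) True by (simp add: ke pol_Suc)
        show "fdiffs (replicate e u) (fdiff r F) = (\<lambda>q. 0)"
          using Suc.prems(2) by (simp add: fdiffs_fdiff fdiff_const)
      qed (use Suc.hyps(2) ke in simp)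
      then show ?thesis using Suc.hyps(2) ke by simp
    next
      case False
      then have [simp]: "r = u" using r by simp
      have "pol (insert u S) (k + e') (fdiff r F)"
      proof (rule Suc.hyps)
        show "pol S k (fdiff r F)" using Suc.prems(1) by (rule pol_fdiff)
        show "fdiffs (replicate e' u) (fdiff r F) = (\<lambda>q. 0)"
          using Suc.prems(2) by (simp add: ke)
      qed (use Suc.hyps(2) ke in simp)
      then show ?thesis using Suc.hyps(2) ke by simp
    qed
    then show ?thesis using Suc.hyps(2) by (metis pol_Suc)
  qed
qed

inductive_set add_closure :: "'a::ab_group_add set \<Rightarrow> 'a set" for S where
  zero: "0 \<in> add_closure S"
| base: "x \<in> S \<Longrightarrow> x \<in> add_closure S"
| minus: "x \<in> add_closure S \<Longrightarrow> y \<in> add_closure S \<Longrightarrow> x - y \<in> add_closure S"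

text \<open>A difference in direction \<open>x - y\<close> is a translate of the difference in
  direction \<open>x\<close> minus a translate of the one in direction \<open>y\<close>, so the
  directions that lower the degree form a subgroup. Hence bounds along generators hold along all
  directions.\<close>

lemma pol_fdiff_closure:
  assumes "r \<in> add_closure S" "pol S (Suc k) F"
  shows "pol S k (fdiff r F)"
  using assms(1)
proof induction
  case zero
  then show ?case by (simp add: fdiff_def pol_zero)
next
  case (base x)
  then show ?case using assms(2) by (simp add: pol_Suc)
next
  case (minus x y)
  have "fdiff (x - y) F = (\<lambda>q. fdiff x F (q - y) - fdiff y F (q - y))"
    by (simp add: fdiff_def algebra_simps)
  then show ?case
    using pol_minus[OF pol_shift[OF minus.IH(1), of "- y"] pol_shift[OF minus.IH(2), of "- y"]] by simp
qed

lemma pol_closure: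
  assumes "pol S k F"
  shows "pol (add_closure S) k F"
  using assms
proof (induction k arbitrary: F)
  case 0
  then show ?case by (simp add: pol_0)
next
  case (Suc k)
  then show ?case by (auto simp: pol_Suc[of "add_closure S"] intro: pol_fdiff_closure)
qed

lemma add_closure_sum:
  "(\<And>i. i \<in> I \<Longrightarrow> f i \<in> add_closure S) \<Longrightarrow> (\<Sum>i\<in>I. f i) \<in> add_closure S"
proof (induction I rule: infinite_finite_induct)
  case (insert x F)
  have "f x - (0 - sum f F) \<in> add_closure S"
    using insert by (intro add_closure.minus add_closure.zero) auto
  then show ?case using insert by simp
qed (auto intro: add_closure.zero)

lemma add_closure_smult:
  assumes "x \<in> add_closure S"
  shows "(k::int) *s x \<in> add_closure (S :: (int ^ 'n::finite) set)"
proof (induction k rule: int_induct[of _ 0])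
  case base
  then show ?case by (simp add: add_closure.zero)
next
  case (step1 i)
  have "i *s x - (0 - x) \<in> add_closure S"
    using step1 assms by (intro add_closure.minus add_closure.zero) auto
  then show ?case by (simp add: vector_sadd_rdistrib algebra_simps)
next
  case (step2 i)
  have "i *s x - x \<in> add_closure S"
    using step2 assms by (intro add_closure.minus) auto
  then show ?case by (simp add: vector_ssub_ldistrib vector_sadd_rdistrib algebra_simps)
qed

lemma add_closure_axis: "add_closure (range (\<lambda>i. axis i (1::int))) = (UNIV :: (int ^ 'n::finite) set)"
proof -
  have "x \<in> add_closure (range (\<lambda>i. axis i (1::int)))" for x :: "int ^ 'n"
  proof -
    have "x = (\<Sum>i\<in>UNIV. (x $ i) *s axis i 1)"
      by (simp add: vec_eq_iff sum_component axis_def if_distrib cong: if_cong)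
    also have "\<dots> \<in> add_closure (range (\<lambda>i. axis i (1::int)))"
      by (intro add_closure_sum add_closure_smult add_closure.base) auto
    finally show ?thesis .
  qed
  then show ?thesis by auto
qed

abbreviation del :: "'a::ab_group_add \<Rightarrow> nat \<Rightarrow> ('a \<Rightarrow> 'b::ab_group_add) \<Rightarrow> 'a \<Rightarrow> 'b" where
  "del r i \<equiv> fdiffs (replicate i r)"

lemma del_Suc: "del r (Suc i) F q = del r i F (q + r) - del r i F q"
  by (simp add: fdiffs_fdiff) (simp add: fdiff_def)

lemma del_commute: "del r i (del s j F) = del s j (del r i F)"
  by (rule fdiffs_commute)

lemma del_cong:
  assumes "\<And>k. F (q + int k *s r) = H (q + int k *s r)"
  shows "del r e F q = del r e H q"
proof -
  have "del r e F (q + int k *s r) = del r e H (q + int k *s r)" for k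
  proof (induction e arbitrary: k)
    case (Suc e)
    have "q + int k *s r + r = q + int (Suc k) *s r"
      by (simp add: vector_sadd_rdistrib algebra_simps)
    then show ?case by (metis Suc.IH del_Suc)
  qed (simp add: assms)
  from this[of 0] show ?thesis by simp
qed

text \<open>A non-constant affine function of an integer is injective, so it meets a finite set only
  finitely often.\<close>

lemma exists_int_avoiding:
  fixes b :: complex
  assumes "finite A" "b \<noteq> 0"
  shows "\<exists>k::int. k \<noteq> 0 \<and> a + of_int k * b \<notin> A"
proof (rule ccontr)
  assume "\<not> ?thesis"
  then have "(\<lambda>k::int. a + of_int k * b) ` (UNIV - {0}) \<subseteq> A" by blast
  then have "finite ((\<lambda>k::int. a + of_int k * b) ` (UNIV - {0}))"
    using assms(1) by (rule finite_subset)
  moreover have "inj_on (\<lambda>k::int. a + of_int k * b) (UNIV - {0})"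
    using assms(2) by (auto simp: inj_on_def)
  ultimately have "finite (UNIV - {0::int})" by (rule finite_imageD)
  then show False by (simp add: infinite_UNIV_int)
qed

section \<open>Vandermonde systems and the Leibniz rule for differences\<close>

context vector_space
begin

text \<open>Subtracting \<open>lam x\<close> times equation \<open>a\<close> from equation
  \<open>a + 1\<close> eliminates the index \<open>x\<close> and leaves the same kind of system for
  the vectors \<open>(lam i - lam x) Z i\<close>. The exponents start at 1, as the operators to be
  used produce only positive powers; this is why the nodes have to be non-zero.\<close>

lemma vandermonde_zero:
  assumes "finite I" "inj_on lam I" "\<And>i. i \<in> I \<Longrightarrow> lam i \<noteq> 0"
    and "\<And>a. 1 \<le> a \<Longrightarrow> a \<le> card I \<Longrightarrow> (\<Sum>i\<in>I. scale (lam i ^ a) (Z i)) = 0"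
  shows "\<forall>i\<in>I. Z i = 0"
  using assms
proof (induction I arbitrary: Z rule: finite_induct)
  case (insert x I)
  have "\<forall>i\<in>I. scale (lam i - lam x) (Z i) = 0"
  proof (rule insert.IH)
    show "inj_on lam I" "\<And>i. i \<in> I \<Longrightarrow> lam i \<noteq> 0" using insert.prems by auto
    fix a :: nat assume a: "1 \<le> a" "a \<le> card I"
    have 1: "(\<Sum>i\<in>insert x I. scale (lam i ^ Suc a) (Z i)) = 0"
      and 2: "(\<Sum>i\<in>insert x I. scale (lam i ^ a) (Z i)) = 0"
      by (rule insert.prems(3); use a insert.hyps in simp)+
    have "(\<Sum>i\<in>I. scale (lam i ^ a) (scale (lam i - lam x) (Z i))) =
       (\<Sum>i\<in>insert x I. scale (lam i ^ a) (scale (lam i - lam x) (Z i)))"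
      using insert.hyps by simp
    also have "\<dots> = (\<Sum>i\<in>insert x I. scale (lam i ^ Suc a) (Z i)) -
       scale (lam x) (\<Sum>i\<in>insert x I. scale (lam i ^ a) (Z i))"
      by (simp only: scale_sum_right sum_subtractf[symmetric])
        (rule sum.cong, simp_all add: algebra_simps)
    finally show "(\<Sum>i\<in>I. scale (lam i ^ a) (scale (lam i - lam x) (Z i))) = 0"
      using 1 2 by simp
  qed
  then have I: "\<forall>i\<in>I. Z i = 0"
    using insert.prems(1) insert.hyps by (auto simp: inj_on_def)
  have "scale (lam x ^ 1) (Z x) = 0"
    using insert.prems(3)[of 1] insert.hyps I by simp
  then show ?case using I insert.prems(2) by auto
qed auto

text \<open>Stated for families, so that repeated vectors also count as a dependence: if
  \<open>f i = f j\<close>, the relation has coefficients 1 and -1.\<close>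

lemma family_dependent:
  assumes "finite Bs" "finite I" "card Bs < card I" "f ` I \<subseteq> span Bs"
  shows "\<exists>c. (\<exists>i\<in>I. c i \<noteq> 0) \<and> (\<Sum>i\<in>I. scale (c i) (f i)) = 0"
proof (cases "inj_on f I")
  case True
  have "dependent (f ` I)"
    using independent_span_bound[OF assms(1) _ assms(4)] assms(3) card_image[OF True] by auto
  then obtain u where u: "\<exists>v\<in>f ` I. u v \<noteq> 0" "(\<Sum>v\<in>f ` I. scale (u v) v) = 0"
    using dependent_finite[of "f ` I"] assms(2) by auto
  then show ?thesis
    by (intro exI[of _ "u \<circ> f"]) (use True in \<open>auto simp: sum.reindex\<close>)
next
  case False
  then obtain i j where ij: "i \<in> I" "j \<in> I" "i \<noteq> j" "f i = f j"
    by (auto simp: inj_on_def)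
  let ?c = "\<lambda>k. if k = i then 1 else if k = j then -1 else 0"
  have "(\<Sum>k\<in>I. scale (?c k) (f k)) = (\<Sum>k\<in>{i,j}. scale (?c k) (f k))"
    by (rule sum.mono_neutral_right) (use ij assms(2) in auto)
  also have "\<dots> = 0" using ij by simp
  finally show ?thesis
    using ij(1) by (intro exI[of _ ?c]) auto
qed

lemma fdiffs_scale: "fdiffs rs (\<lambda>q. scale c (F q)) q = scale c (fdiffs rs F q)"
  using fdiffs_hom_on[of UNIV "scale c" F rs] by (simp add: scale_right_diff_distrib)

lemma fdiffs_scale_invariant:
  assumes "\<And>q. l (q + r) = l q"
  shows "del r e (\<lambda>q. scale (l q) (F q)) q = scale (l q) (del r e F q)"
  by (induction e arbitrary: q) (simp_all add: del_Suc assms scale_right_diff_distrib del: replicate_Suc)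

text \<open>As \<open>l\<close> is additive, its first differences are constant and its second ones
  vanish; so at most one of the directions can fall on \<open>l\<close>. The shift
  \<open>q + rs ! i\<close> comes from the discrete product rule.\<close>

lemma fdiffs_leibniz:
  assumes "\<And>q r. l (q + r) = l q + l r"
  shows "fdiffs rs (\<lambda>q. scale (l q) (F q)) q = scale (l q) (fdiffs rs F q) +
    (\<Sum>i<length rs. scale (l (rs ! i)) (fdiffs (take i rs @ drop (Suc i) rs) F (q + rs ! i)))"
proof (induction rs arbitrary: F)
  case (Cons r rs)
  have "fdiff r (\<lambda>q. scale (l q) (F q)) = (\<lambda>q. scale (l q) (fdiff r F q) + scale (l r) (F (q + r)))"
    by (simp add: fdiff_def assms fun_eq_iff scale_left_distrib scale_right_diff_distrib algebra_simps)
  then have "fdiffs (r # rs) (\<lambda>q. scale (l q) (F q)) q =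
    fdiffs rs (\<lambda>q. scale (l q) (fdiff r F q)) q + scale (l r) (fdiffs rs F (q + r))"
    by (simp add: fdiffs_add fdiffs_scale fdiffs_shift)
  also have "\<dots> = scale (l q) (fdiffs (r # rs) F q) + (scale (l r) (fdiffs rs F (q + r)) +
    (\<Sum>i<length rs. scale (l (rs ! i)) (fdiffs (take i rs @ drop (Suc i) rs) (fdiff r F) (q + rs ! i))))"
    by (simp add: Cons.IH)
  finally show ?case
    by (simp add: sum.lessThan_Suc_shift del: sum.lessThan_Suc)
qed simp

text \<open>A linear weight costs one more difference. Only the base points \<open>s\<close> and
  \<open>s + r\<close> occur: the first-order terms sit at \<open>s + r\<close>, and the remaining
  term is the difference of the values there. This locality matters because vanishing is known line
  by line only.\<close>

lemma del_leibniz_zero: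
  assumes "\<And>q r. l (q + r) = l q + l r" "\<And>q. q \<in> {s, s + r} \<Longrightarrow> del r e F q = 0"
  shows "del r (Suc e) (\<lambda>q. scale (l q) (F q)) s = 0"
proof -
  have "take i (replicate (Suc e) r) @ drop (Suc i) (replicate (Suc e) r) = replicate e r" if "i < Suc e" for i
    using that by (simp del: replicate_Suc add: min_def replicate_add[symmetric])
  moreover have "del r (Suc e) F s = 0"
    using assms(2) unfolding del_Suc by simp
  ultimately show ?thesis
    using assms(2) unfolding fdiffs_leibniz[where l=l, OF assms(1)]
    by (auto simp del: replicate_Suc fdiffs_simps intro!: sum.neutral simp: nth_replicate)
qed

end


section \<open>Functions on the lattice with a bracket relation\<close>

text \<open>\<open>G\<close> stands for the operators on a finite-dimensional module and
  \<open>X\<close> for \<open>T\<close>. The condition \<open>om_indep\<close> says that the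
  functionals \<open>om _ s\<close> and \<open>om _ (axis i 1)\<close> are linearly independent, by
  a non-zero 2 by 2 determinant, unless \<open>s\<close> is an integer multiple of the axis vector.
  Axis directions are primitive, so the exceptional \<open>s\<close> form exactly one lattice line
  through 0.\<close>

locale diff_lie = vector_space scale
  for scale :: "complex \<Rightarrow> 'h::ab_group_add \<Rightarrow> 'h" +
  fixes G :: "'h set" and Bs :: "'h set" and br :: "'h \<Rightarrow> 'h \<Rightarrow> 'h"
    and X :: "int ^ 'n::finite \<Rightarrow> 'h" and om :: "int ^ 'n \<Rightarrow> int ^ 'n \<Rightarrow> complex"
  assumes subG: "subspace G" and finB: "finite Bs" and G_span: "G \<subseteq> span Bs"
    and br_in: "\<And>x y. x \<in> G \<Longrightarrow> y \<in> G \<Longrightarrow> br x y \<in> G"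
    and br_add_left: "\<And>x y z. x \<in> G \<Longrightarrow> y \<in> G \<Longrightarrow> z \<in> G \<Longrightarrow> br (x + y) z = br x z + br y z"
    and br_scale_left: "\<And>c x z. x \<in> G \<Longrightarrow> z \<in> G \<Longrightarrow> br (scale c x) z = scale c (br x z)"
    and br_anti: "\<And>x y. x \<in> G \<Longrightarrow> y \<in> G \<Longrightarrow> br x y = - br y x"
    and X_in: "\<And>u. X u \<in> G"
    and br_X: "\<And>a b. br (X a) (X b) = scale (om a b) (X (a + b) - X a - X b)"
    and om_add_left: "\<And>a b c. om (a + b) c = om a c + om b c"
    and om_anti: "\<And>a b. om a b = - om b a"
    and om_indep: "\<And>s i. s \<notin> range (\<lambda>k. vector_scalar_mult k (axis i 1)) \<Longrightarrow>
      \<exists>w w'. om w s * om w' (axis i 1) \<noteq> om w (axis i 1) * om w' s"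
    and card2: "\<exists>i j :: 'n. i \<noteq> j"
begin

notation vector_scalar_mult (infixr "\<odot>" 75)

lemma G0: "0 \<in> G" and G_add: "x \<in> G \<Longrightarrow> y \<in> G \<Longrightarrow> x + y \<in> G"
  and G_diff: "x \<in> G \<Longrightarrow> y \<in> G \<Longrightarrow> x - y \<in> G" and G_scale: "x \<in> G \<Longrightarrow> scale c x \<in> G"
  using subG by (auto intro: subspace_0 subspace_add subspace_diff subspace_scale)

lemma G_sum: "(\<And>i. i \<in> I \<Longrightarrow> f i \<in> G) \<Longrightarrow> sum f I \<in> G"
  using subG by (rule subspace_sum)

lemma br_diff_left: "x \<in> G \<Longrightarrow> y \<in> G \<Longrightarrow> z \<in> G \<Longrightarrow> br (x - y) z = br x z - br y z"
  using br_add_left[of "x - y" y z] by (simp add: G_diff)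

lemma br_add_right: "x \<in> G \<Longrightarrow> y \<in> G \<Longrightarrow> z \<in> G \<Longrightarrow> br x (y + z) = br x y + br x z"
  using br_anti[of x "y + z"] br_anti[of x y] br_anti[of x z] br_add_left[of y z x] by (simp add: G_add)

lemma br_diff_right: "x \<in> G \<Longrightarrow> y \<in> G \<Longrightarrow> z \<in> G \<Longrightarrow> br x (y - z) = br x y - br x z"
  using br_add_right[of x "y - z" z] by (simp add: G_diff)

lemma br_scale_right: "x \<in> G \<Longrightarrow> y \<in> G \<Longrightarrow> br x (scale c y) = scale c (br x y)"
  using br_anti[of x "scale c y"] br_anti[of x y] br_scale_left[of y x c] by (simp add: G_scale)

lemma br_self: "x \<in> G \<Longrightarrow> br x x = 0"
proof -
  assume "x \<in> G"
  then have "scale 2 (br x x) = 0"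
    using br_anti[of x x] by (metis add.right_inverse scale_left_distrib scale_one one_add_one)
  then show ?thesis by simp
qed

lemma om_add_right: "om a (b + c) = om a b + om a c"
  using om_anti[of a "b + c"] om_anti[of a b] om_anti[of a c] om_add_left[of b c a] by simp

lemma om_self: "om a a = 0"
  using om_anti[of a a] by simp

lemma om_0: "om 0 a = 0" "om a 0 = 0"
  using om_add_left[of 0 0 a] om_add_right[of a 0 0] by simp_all

lemma om_diff_left: "om (a - b) c = om a c - om b c"
  using om_add_left[of "a - b" b c] by simp

lemma om_diff_right: "om c (a - b) = om c a - om c b"
  using om_add_right[of c "a - b" b] by simp

lemma om_smult_left: "om (k \<odot> a) b = of_int k * om a b"
proof (induction k rule: int_induct[of _ 0])
  case base
  then show ?case by (simp add: om_0)
next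
  case (step1 i)
  then show ?case by (simp add: vector_sadd_rdistrib om_add_left algebra_simps)
next
  case (step2 i)
  then show ?case
    using om_diff_left[of "i \<odot> a" a b]
    by (simp add: vector_sub_rdistrib algebra_simps vec_eq_iff)
qed

lemma om_smult_right: "om b (k \<odot> a) = of_int k * om b a"
  using om_smult_left[of k a b] om_anti[of b "k \<odot> a"] om_anti[of b a] by simp

lemma om_invariant: "om r (q + r) = om r q"
  by (simp add: om_add_right om_self)

lemma diffs_in: "(\<And>q. F q \<in> G) \<Longrightarrow> fdiffs rs F q \<in> G"
  by (rule fdiffs_closed) (auto intro: G_diff)

lemma br_fdiffs: "x \<in> G \<Longrightarrow> (\<And>q. F q \<in> G) \<Longrightarrow> br x (fdiffs rs F q) = fdiffs rs (\<lambda>q. br x (F q)) q"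
  using fdiffs_hom_on[of G "br x" F rs] by (simp add: G_diff br_diff_right)

section \<open>Operators built from ad X(mr), and lines without bad differences\<close>

definition lin :: "('h \<Rightarrow> 'h) \<Rightarrow> bool" where
  "lin C \<longleftrightarrow> (\<forall>x\<in>G. C x \<in> G) \<and> (\<forall>x\<in>G. \<forall>y\<in>G. C (x + y) = C x + C y) \<and>
     (\<forall>c. \<forall>x\<in>G. C (scale c x) = scale c (C x))"

lemma lin_diff: "lin C \<Longrightarrow> lin C' \<Longrightarrow> lin (\<lambda>x. C x - C' x)"
  by (simp add: lin_def G_diff scale_right_diff_distrib)

lemma lin_comp: "lin C \<Longrightarrow> lin C' \<Longrightarrow> lin (\<lambda>x. C (C' x))"
  by (simp add: lin_def)

lemma lin_sum:
  assumes "lin C" "\<And>i. i \<in> I \<Longrightarrow> f i \<in> G"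
  shows "C (\<Sum>i\<in>I. scale (c i) (f i)) = (\<Sum>i\<in>I. scale (c i) (C (f i)))"
  using assms(2)
proof (induction I rule: infinite_finite_induct)
  case (insert x I)
  have "C (scale (c x) (f x) + (\<Sum>i\<in>I. scale (c i) (f i))) =
    C (scale (c x) (f x)) + C (\<Sum>i\<in>I. scale (c i) (f i))"
    using assms(1) insert.prems by (simp add: lin_def G_scale G_sum)
  also have "C (scale (c x) (f x)) = scale (c x) (C (f x))"
    using assms(1) insert.prems by (simp add: lin_def)
  finally show ?case using insert by simp
next
  case empty
  have "C (scale 0 0) = scale 0 (C 0)" using assms(1) G0 by (simp only: lin_def)
  then show ?case by simp
next
  case (infinite A)
  have "C (scale 0 0) = scale 0 (C 0)" using assms(1) G0 by (simp only: lin_def)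
  then show ?case using infinite by simp
qed

text \<open>The operator is \<open>ad X(m r) / m\<close>. Along a line in direction \<open>r\<close>
  the factor \<open>om r\<close> is constant and can be pulled out of the differences, and at least
  one difference removes the constant \<open>X(m r)\<close>. The same operator serves all orders and
  all base points. For \<open>m = 0\<close> both sides vanish.\<close>

lemma multiple_op:
  "\<exists>C. lin C \<and> (\<forall>i s. C (del r (Suc i) X s) =
     scale (om r s) (del r (Suc i) X (s + int m \<odot> r) - del r (Suc i) X s))"
proof (cases "m = 0")
  case True
  then show ?thesis by (intro exI[of _ "\<lambda>x. 0"]) (simp add: lin_def G0)
next
  case False
  let ?u = "int m \<odot> r"
  let ?C = "\<lambda>x. scale (1 / of_nat m) (br (X ?u) x)"
  have "?C (del r (Suc i) X s) = scale (om r s) (del r (Suc i) X (s + ?u) - del r (Suc i) X s)" for i s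
  proof -
    have "br (X ?u) (del r (Suc i) X s) = del r (Suc i) (\<lambda>q. br (X ?u) (X q)) s"
      by (rule br_fdiffs) (rule X_in)+
    also have "(\<lambda>q. br (X ?u) (X q)) = (\<lambda>q. scale (of_nat m) (scale (om r q) (X (q + ?u) - X ?u - X q)))"
      by (simp add: br_X om_smult_left add.commute)
    also have "del r (Suc i) \<dots> s = scale (of_nat m) (scale (om r s) (del r (Suc i) (\<lambda>q. X (q + ?u) - X ?u - X q) s))"
      by (simp only: fdiffs_scale fdiffs_scale_invariant[of "om r", OF om_invariant])
    also have "del r (Suc i) (\<lambda>q. X (q + ?u) - X ?u - X q) s = del r (Suc i) X (s + ?u) - del r (Suc i) X s"
      by (simp add: fdiffs_minus fdiffs_const fdiffs_zero fdiffs_shift fdiff_minus fdiff_const fdiff_shift)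
    finally show ?thesis using False by simp
  qed
  moreover have "lin ?C"
    by (simp add: lin_def br_in X_in G_scale br_add_right br_scale_right scale_right_distrib mult.commute)
  ultimately show ?thesis by blast
qed

lemma del_next: "del r i F (s + int (Suc m) \<odot> r) - del r i F (s + int m \<odot> r) = del r (Suc i) F (s + int m \<odot> r)"
proof -
  have "s + int (Suc m) \<odot> r = s + int m \<odot> r + r"
    by (simp add: vector_sadd_rdistrib algebra_simps)
  then show ?thesis by (simp only: del_Suc)
qed

text \<open>Subtracting the operators for two consecutive \<open>m\<close> turns a translation by
  \<open>r\<close> into one more difference; iterating this raises the order without raising the
  power of \<open>om r s\<close>.\<close>

lemma shift_op:
  "\<exists>C. lin C \<and> (\<forall>i s. C (del r (Suc i) X s) =
     scale (om r s) (del r (Suc i + Suc j) X (s + int m \<odot> r)))"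
proof (induction j arbitrary: m)
  case 0
  obtain C where C: "lin C" "\<And>i s. C (del r (Suc i) X s) =
     scale (om r s) (del r (Suc i) X (s + int (Suc m) \<odot> r) - del r (Suc i) X s)"
    using multiple_op by blast
  obtain C' where C': "lin C'" "\<And>i s. C' (del r (Suc i) X s) =
     scale (om r s) (del r (Suc i) X (s + int m \<odot> r) - del r (Suc i) X s)"
    using multiple_op by blast
  show ?case
    by (intro exI[of _ "\<lambda>x. C x - C' x"])
      (simp add: lin_diff C C' scale_right_diff_distrib[symmetric] del_next del: replicate_Suc fdiffs_simps of_nat_Suc)
next
  case (Suc j)
  obtain C where C: "lin C" "\<And>i s. C (del r (Suc i) X s) =
     scale (om r s) (del r (Suc i + Suc j) X (s + int (Suc m) \<odot> r))"
    using Suc.IH by blast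
  obtain C' where C': "lin C'" "\<And>i s. C' (del r (Suc i) X s) =
     scale (om r s) (del r (Suc i + Suc j) X (s + int m \<odot> r))"
    using Suc.IH by blast
  show ?case
    by (intro exI[of _ "\<lambda>x. C x - C' x"])
      (simp add: lin_diff C C' scale_right_diff_distrib[symmetric] del_next del: replicate_Suc fdiffs_simps of_nat_Suc)
qed

text \<open>The order of the resulting difference and the exponent of \<open>om r s\<close> can be
  prescribed independently: one factor comes from an operator that raises the order as far as
  necessary, each further one from an operator that raises it by 1. A fixed final order with all
  exponents up to a bound is what the Vandermonde system requires.\<close>

lemma power_op:
  assumes "j \<ge> a"
  shows "\<exists>C. lin C \<and> (\<forall>i s. C (del r (Suc i) X s) = scale (om r s ^ Suc a) (del r (Suc i + Suc j) X s))"
  using assms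
proof (induction a arbitrary: j)
  case 0
  then show ?case using shift_op[of r j 0] by simp
next
  case (Suc a)
  then obtain j' where j: "j = Suc j'" "j' \<ge> a" by (metis Suc_le_D Suc_le_mono)
  obtain C where C: "lin C" "\<And>i s. C (del r (Suc i) X s) = scale (om r s ^ Suc a) (del r (Suc i + Suc j') X s)"
    using Suc.IH[OF j(2)] by blast
  obtain C' where C': "lin C'" "\<And>i s. C' (del r (Suc i) X s) = scale (om r s) (del r (Suc i + Suc 0) X s)"
    using shift_op[of r 0 0] by auto
  have "C' (C (del r (Suc i) X s)) = scale (om r s ^ Suc (Suc a)) (del r (Suc i + Suc j) X s)" for i s
  proof -
    have "C' (C (del r (Suc i) X s)) = scale (om r s ^ Suc a) (C' (del r (Suc (i + Suc j')) X s))"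
      using C'(1) by (simp add: C(2) lin_def diffs_in X_in del: replicate_Suc fdiffs_simps)
    then show ?thesis
      by (simp add: C'(2) j del: replicate_Suc fdiffs_simps)
  qed
  then show ?case using lin_comp[OF C'(1) C(1)] by blast
qed

abbreviation "d \<equiv> card Bs"

text \<open>Lines in direction \<open>r\<close> on which \<open>X\<close> is not polynomial are seen by linearly independent
  differences, by a Vandermonde argument in the value of \<open>om r\<close>; so there are at most
  \<open>d\<close> such values.\<close>

lemma finite_bad: "finite {om r s | s. om r s \<noteq> 0 \<and> del r (d + 2) X s \<noteq> 0}" (is "finite ?A")
proof (rule ccontr)
  assume "infinite ?A"
  then obtain L where L: "finite L" "card L = d + 1" "L \<subseteq> ?A"
    by (meson infinite_arbitrarily_large)
  then have "\<forall>l\<in>L. \<exists>s. l = om r s \<and> om r s \<noteq> 0 \<and> del r (d + 2) X s \<noteq> 0" by blast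
  then obtain s where s: "\<And>l. l \<in> L \<Longrightarrow> om r (s l) = l \<and> l \<noteq> 0 \<and> del r (d + 2) X (s l) \<noteq> 0"
    by metis
  let ?f = "\<lambda>l. del r (Suc 0) X (s l)"
  have fG: "?f l \<in> G" for l by (rule diffs_in) (rule X_in)
  \<comment> \<open>These are \<open>d + 1\<close> vectors in the span of \<open>d\<close>
    elements.\<close>
  obtain c where c: "\<exists>l\<in>L. c l \<noteq> 0" "(\<Sum>l\<in>L. scale (c l) (?f l)) = 0"
    using family_dependent[OF finB L(1), of ?f] L(2) fG G_span by auto
  have "\<forall>l\<in>L. scale (c l) (del r (d + 2) X (s l)) = 0"
  proof (rule vandermonde_zero[OF L(1), of "\<lambda>l. l"])
    fix a assume a: "1 \<le> a" "a \<le> card L"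
    then obtain a' where a': "a = Suc a'" "a' \<le> d" using L(2) by (cases a) auto
    \<comment> \<open>Starting from order 1, the final order is \<open>1 + (d + 1) = d + 2\<close>
      for every exponent \<open>a\<close> from 1 to \<open>d + 1\<close>; applying \<open>C\<close>
      to the one linear dependence yields the \<open>d + 1\<close> equations of the system.\<close>
    obtain C where C: "lin C" "\<And>i s. C (del r (Suc i) X s) = scale (om r s ^ Suc a') (del r (Suc i + Suc d) X s)"
      using power_op[OF a'(2)] by blast
    have "0 = C (scale 0 0)" using C(1) G0 unfolding lin_def by (metis scale_zero_left)
    also have "\<dots> = C (\<Sum>l\<in>L. scale (c l) (?f l))" using c by simp
    also have "\<dots> = (\<Sum>l\<in>L. scale (c l) (C (?f l)))" by (rule lin_sum[OF C(1) fG])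
    also have "\<dots> = (\<Sum>l\<in>L. scale (l ^ a) (scale (c l) (del r (d + 2) X (s l))))"
    proof (rule sum.cong)
      fix l assume "l \<in> L"
      then have "C (?f l) = scale (l ^ a) (del r (d + 2) X (s l))"
        unfolding C(2) a' using s by (simp del: replicate_Suc fdiffs_simps)
      then show "scale (c l) (C (?f l)) = scale (l ^ a) (scale (c l) (del r (d + 2) X (s l)))"
        by (simp only: scale_left_commute)
    qed simp
    finally show "(\<Sum>l\<in>L. scale (l ^ a) (scale (c l) (del r (d + 2) X (s l)))) = 0" by simp
  qed (use s in auto)
  then show False using c(1) s by auto
qed

text \<open>Solving the bracket relation for its leading term gives
  \<open>om(u, q) X(q) = om(u, q)(X(q - u) + X(u)) + [X(u), X(q - u)]\<close>, where everything on
  the right lives on the line through \<open>s - u\<close>. If that line is good, the weighted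
  function is polynomial on the line through \<open>s\<close>, whether or not the latter is
  good.\<close>

lemma weighted_good:
  assumes "om r (s - u) \<notin> insert 0 {om r s | s. om r s \<noteq> 0 \<and> del r (d + 2) X s \<noteq> 0}"
  shows "del r (Suc (d + 2)) (\<lambda>q. scale (om u q) (X q)) s = 0"
proof -
  have good: "del r (d + 2) X q = 0" if q: "om r q = om r (s - u)" for q
  proof (rule ccontr)
    assume "del r (d + 2) X q \<noteq> 0"
    moreover have "om r q \<noteq> 0" using assms q by (simp only: insert_iff) blast
    ultimately have "om r q \<in> {om r s | s. om r s \<noteq> 0 \<and> del r (d + 2) X s \<noteq> 0}"
      by blast
    then show False using assms unfolding q by blast
  qed
  have 0: "del r (d + 2) X (s - u) = 0" "del r (d + 2) X (s + r - u) = 0"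
    by (rule good; simp add: om_add_right om_diff_right om_self)+
  let ?e = "d + 2" and ?Y = "\<lambda>q. X (q + - u)"
  have shift: "del r e ?Y q = del r e X (q - u)" for e q
    using fun_cong[OF fdiffs_shift[of "replicate e r" X "- u"], of q] by simp
  have "(\<lambda>q. scale (om u q) (X q)) = (\<lambda>q. scale (om u q) (?Y q + X u) + br (X u) (?Y q))"
    by (simp add: br_X om_diff_right om_self scale_right_diff_distrib scale_right_distrib)
  moreover have "del r (Suc ?e) (\<lambda>q. scale (om u q) (?Y q + X u)) s = 0"
  proof (rule del_leibniz_zero)
    fix q assume "q \<in> {s, s + r}"
    then have "del r ?e X (q - u) = 0" using 0 by auto
    then show "del r ?e (\<lambda>q. ?Y q + X u) q = 0"
      by (simp only: fdiffs_add shift fdiffs_const) (simp add: fdiff_const fdiffs_zero)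
  qed (simp add: om_add_right)
  moreover have "del r (Suc ?e) (\<lambda>q. br (X u) (?Y q)) s = br (X u) (del r (Suc ?e) ?Y s)"
    by (rule br_fdiffs[symmetric]) (rule X_in)+
  moreover have "del r (Suc ?e) ?Y s = 0"
    using 0 by (simp only: del_Suc shift) (simp add: algebra_simps)
  moreover have "br (X u) 0 = 0"
    using br_diff_right[of "X u" 0 0] X_in G0 by simp
  ultimately show ?thesis
    by (simp only: fdiffs_add add_0)
qed

text \<open>Two vectors \<open>u\<close>, \<open>u'\<close> give two weights \<open>om u\<close> and
  \<open>om u'\<close> for which the weighted \<open>X\<close> has vanishing differences. By
  independence some combination of the weights is constant along the axis and equal to 1 at
  \<open>s\<close>, which removes the weight.\<close>

lemma axis_line:
  assumes s: "s \<notin> range (\<lambda>k. k \<odot> axis i 1)"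
  shows "del (axis i 1) (Suc (d + 2)) X s = 0"
proof -
  let ?r = "axis i 1 :: int ^ 'n"
  let ?A = "{om ?r s | s. om ?r s \<noteq> 0 \<and> del ?r (d + 2) X s \<noteq> 0}"
  have fin: "finite (insert 0 ?A)" using finite_bad by simp
  obtain v v' where v: "om v s * om v' ?r \<noteq> om v ?r * om v' s"
    using om_indep[OF s] by blast
  \<comment> \<open>If \<open>om v ?r = 0\<close>, the non-zero determinant forces
    \<open>om v' ?r\<close> to be non-zero, and the two vectors exchange their roles.\<close>
  have "\<exists>w w'. om w s * om w' ?r \<noteq> om w ?r * om w' s \<and> om w ?r \<noteq> 0"
  proof (cases "om v ?r = 0")
    case True
    with v show ?thesis by (intro exI[of _ v'] exI[of _ v]) (auto simp: mult.commute)
  next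
    case False
    with v show ?thesis by blast
  qed
  then obtain w w' where w: "om w s * om w' ?r \<noteq> om w ?r * om w' s" "om w ?r \<noteq> 0"
    by blast
  have w0: "om ?r w \<noteq> 0" using w(2) om_anti[of w ?r] by auto
  \<comment> \<open>Since \<open>om ?r w\<close> is non-zero, adding multiples of \<open>w\<close>
    moves \<open>om ?r (s - u)\<close> through infinitely many values, of which finitely many are
    bad. The condition \<open>k \<noteq> 0\<close> keeps \<open>u\<close> and \<open>u'\<close>
    independent: the determinant \<open>dt\<close> is \<open>k\<close> times that of
    \<open>w\<close> and \<open>w'\<close>.\<close>
  obtain k where k: "k \<noteq> 0" "om ?r s + of_int k * - om ?r w \<notin> insert 0 ?A"
    using exists_int_avoiding[OF fin, of "- om ?r w" "om ?r s"] w0 by auto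
  obtain k' where k': "om ?r s - om ?r w' + of_int k' * - om ?r w \<notin> insert 0 ?A"
    using exists_int_avoiding[OF fin, of "- om ?r w" "om ?r s - om ?r w'"] w0 by auto
  define u where "u = k \<odot> w"
  define u' where "u' = w' + k' \<odot> w"
  have "del ?r (Suc (d + 2)) (\<lambda>q. scale (om u q) (X q)) s = 0"
    by (rule weighted_good) (use k in \<open>simp add: u_def om_diff_right om_smult_right\<close>)
  moreover have "del ?r (Suc (d + 2)) (\<lambda>q. scale (om u' q) (X q)) s = 0"
    by (rule weighted_good) (use k' in \<open>simp add: u'_def om_diff_right om_add_right om_smult_right algebra_simps\<close>)
  ultimately have zero: "del ?r (Suc (d + 2)) (\<lambda>q. scale (a * om u q + b * om u' q) (X q)) s = 0" for a b
    by (simp only: scale_left_distrib scale_scale[symmetric] fdiffs_add fdiffs_scale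
        scale_zero_right add_0)
  define dt where "dt = om u s * om u' ?r - om u ?r * om u' s"
  have "dt = of_int k * (om w s * om w' ?r - om w ?r * om w' s)"
    by (simp add: dt_def u_def u'_def om_add_left om_smult_left algebra_simps)
  then have dt: "dt \<noteq> 0" using k(1) w(1) by simp
  \<comment> \<open>Cramer's rule for the combination of \<open>om u\<close> and
    \<open>om u'\<close> that takes the value 0 at \<open>?r\<close> and 1 at
    \<open>s\<close>.\<close>
  define l where "l q = om u' ?r / dt * om u q + - (om u ?r / dt) * om u' q" for q
  have "l (q + ?r) = l q" for q
    by (simp add: l_def om_add_right algebra_simps)
  then have "scale (l s) (del ?r (Suc (d + 2)) X s) = 0"
    using zero[of "om u' ?r / dt" "- (om u ?r / dt)"] fdiffs_scale_invariant[of l ?r "Suc (d + 2)" X s]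
    by (simp add: l_def del: replicate_Suc fdiffs_simps)
  moreover have "l s = 1"
  proof -
    have "l s = (om u' ?r * om u s - om u ?r * om u' s) / dt"
      by (simp add: l_def diff_divide_distrib)
    also have "om u' ?r * om u s - om u ?r * om u' s = dt"
      by (simp add: dt_def mult.commute)
    finally show ?thesis using dt by simp
  qed
  ultimately show ?thesis by simp
qed

end

section \<open>Extrapolation to the origin and polynomiality in all directions\<close>

context diff_lie
begin

text \<open>The value of \<open>X\<close> at \<open>0\<close> is not constrained by the bracket relation, so it has to be replaced
  by the value extrapolated from the other points.\<close>

lemma polynomial_along_axes:
  "\<exists>F e. (\<forall>u. u \<noteq> 0 \<longrightarrow> F u = X u) \<and> (\<forall>u. F u \<in> G) \<and> (\<forall>i. del (axis i 1) e F = (\<lambda>q. 0))"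
proof -
  obtain i1 i2 :: 'n where i12: "i1 \<noteq> i2" using card2 by blast
  define e where "e = Suc (d + 2)"
  let ?a = "\<lambda>i. axis i 1 :: int ^ 'n"
  let ?Z = "\<lambda>i. range (\<lambda>k. k \<odot> ?a i)"
  have off: "del (?a i) e X s = 0" if "s \<notin> ?Z i" for i s
    using axis_line[OF that] unfolding e_def .
  have notin: "k \<odot> ?a i + l \<odot> ?a j \<notin> ?Z j" if "k \<noteq> 0" "i \<noteq> j" for i j k l
  proof
    assume "k \<odot> ?a i + l \<odot> ?a j \<in> ?Z j"
    then obtain m where "k \<odot> ?a i + l \<odot> ?a j = m \<odot> ?a j" by blast
    then have "(k \<odot> ?a i + l \<odot> ?a j) $ i = (m \<odot> ?a j) $ i" by simp
    then show False using that by (simp add: axis_def)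
  qed
  \<comment> \<open>At 0 this is the value that makes the \<open>e\<close>-th difference in
    direction \<open>i2\<close> vanish: \<open>(-1)^e\<close> times that difference is
    \<open>X 0\<close> plus terms at other points, so \<open>X 0\<close> cancels. At the other
    points of the \<open>i1\<close>-axis the correction is zero and \<open>R\<close> agrees with
    \<open>X\<close>. Writing it uniformly in \<open>q\<close> lets differences in direction
    \<open>i1\<close> act on it.\<close>
  define R where "R q = X q - (if even e then del (?a i2) e X q else - del (?a i2) e X q)" for q
  define F where "F u = (if u = 0 then R 0 else X u)" for u
  have Rrow: "R (k \<odot> ?a i1) = F (k \<odot> ?a i1)" for k
  proof (cases "k = 0")
    case False
    then have "k \<odot> ?a i1 \<noteq> 0" by (auto simp: vec_eq_iff axis_def)
    moreover have "del (?a i2) e X (k \<odot> ?a i1) = 0"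
      using off[OF notin[OF False i12, of 0]] by simp
    ultimately show ?thesis by (simp add: R_def F_def)
  qed (simp add: F_def)
  have FX: "F u = X u" if "u \<noteq> 0" for u using that by (simp add: F_def)
  have FG: "F u \<in> G" for u
    by (auto simp: F_def R_def X_in diffs_in G_diff)
      (metis G_add X_in diff_minus_eq_add diffs_in)+
  have Foff: "del (?a i) e F s = 0" if "s \<notin> ?Z i" for i s
  proof -
    have "s + int k \<odot> ?a i \<noteq> 0" for k
    proof
      assume "s + int k \<odot> ?a i = 0"
      then have "s = (- int k) \<odot> ?a i"
        by (simp add: add_eq_0_iff2 vec_eq_iff)
      then show False using that by blast
    qed
    then have "del (?a i) e F s = del (?a i) e X s"
      by (intro del_cong) (auto simp: FX)
    then show ?thesis using off[OF that] by simp
  qed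
  have Frow: "del (?a i1) e F s = 0" for s
  proof (cases "s \<in> ?Z i1")
    case True
    then obtain k where s: "s = k \<odot> ?a i1" by blast
    have "s + int j \<odot> ?a i1 = (k + int j) \<odot> ?a i1" for j
      by (simp add: s vector_sadd_rdistrib)
    then have "del (?a i1) e F s = del (?a i1) e R s"
      by (intro del_cong) (simp only: Rrow)
    also have "\<dots> = 0"
    proof -
      let ?Y = "del (?a i1) e X"
      \<comment> \<open>\<open>?Y\<close> vanishes off the \<open>i1\<close>-axis, hence on the ray
        that leaves the axis at \<open>s\<close> in direction \<open>i2\<close>. As the two
        differences commute, the correction in \<open>R\<close> contributes exactly
        \<open>?Y s\<close> and cancels it.\<close>
      have Y: "del (?a i2) e ?Y s = (if even e then ?Y s else - ?Y s)"
      proof (rule fdiffs_replicate_point)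
        fix j :: nat assume "1 \<le> j"
        then have "int j \<odot> ?a i2 + k \<odot> ?a i1 \<notin> ?Z i1" using i12 by (intro notin) auto
        then show "?Y (s + int j \<odot> ?a i2) = 0" by (intro off) (simp add: s add.commute)
      qed
      have "del (?a i1) e R s = ?Y s - (if even e then del (?a i1) e (del (?a i2) e X) s
          else - del (?a i1) e (del (?a i2) e X) s)"
      proof -
        have "R = (\<lambda>q. X q - (if even e then del (?a i2) e X q else - del (?a i2) e X q))"
          by (rule ext) (rule R_def)
        then show ?thesis by (cases "even e") (simp_all add: fdiffs_minus fdiffs_add)
      qed
      also have "del (?a i1) e (del (?a i2) e X) = del (?a i2) e ?Y" by (rule del_commute)
      finally show ?thesis using Y by simp
    qed
    finally show ?thesis .
  qed (rule Foff)
  have "del (?a i) e F s = 0" for i s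
  proof (cases "i = i1 \<or> s \<notin> ?Z i")
    case True
    then show ?thesis using Frow Foff by blast
  next
    case False
    then obtain k where s: "s = k \<odot> ?a i" and i: "i \<noteq> i1" by blast
    let ?h = "del (?a i) e F"
    \<comment> \<open>The same argument with the directions exchanged: \<open>?h\<close> is known to
      vanish off the \<open>i\<close>-axis, and its differences in direction \<open>i1\<close>
      vanish because those of \<open>F\<close> do.\<close>
    have "del (?a i1) e ?h s = (if even e then ?h s else - ?h s)"
    proof (rule fdiffs_replicate_point)
      fix j :: nat assume "1 \<le> j"
      then have "int j \<odot> ?a i1 + k \<odot> ?a i \<notin> ?Z i" using i by (intro notin) auto
      then show "?h (s + int j \<odot> ?a i1) = 0" by (intro Foff) (simp add: s add.commute)
    qed
    moreover have "del (?a i1) e ?h s = 0"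
    proof -
      have "del (?a i1) e F = (\<lambda>q. 0)" using Frow by blast
      then show ?thesis by (simp only: del_commute[of e "?a i1" e "?a i" F] fdiffs_zero)
    qed
    ultimately show ?thesis by (simp split: if_splits)
  qed
  then show ?thesis using FX FG by blast
qed

lemma polynomial_extension:
  "\<exists>F K. (\<forall>u. u \<noteq> 0 \<longrightarrow> F u = X u) \<and> (\<forall>u. F u \<in> G) \<and> pol UNIV K F \<and>
     (\<forall>a b. br (F a) (F b) = scale (om a b) (F (a + b) - F a - F b))"
proof -
  obtain F e where FX: "\<And>u. u \<noteq> 0 \<Longrightarrow> F u = X u" and FG: "\<And>u. F u \<in> G"
    and Fe: "\<And>i. del (axis i 1) e F = (\<lambda>q. 0)"
    using polynomial_along_axes by blast
  \<comment> \<open>The bound starts at 1: for the empty set of directions order 1 is vacuous,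
    whereas order 0 would say that \<open>F\<close> is zero.\<close>
  have polI: "pol ((\<lambda>i. axis i 1) ` I) (Suc (card I * e)) F" for I :: "'n set"
    using finite[of I]
  proof (induction I rule: finite_induct)
    case empty
    then show ?case by (simp add: pol_def)
  next
    case (insert i I)
    then show ?case using pol_insert[OF insert.IH Fe[of i]] by (simp add: add.commute)
  qed
  have polF: "pol UNIV (Suc (CARD('n) * e)) F"
    using pol_closure[OF polI[of UNIV]] by (simp only: add_closure_axis)
  define K where "K = Suc (CARD('n) * e)"
  have polK: "fdiffs rs F q = 0" if "length rs \<ge> K" for rs q
    using pol_mono[OF polF, of "length rs"] that by (simp add: pol_def K_def fun_eq_iff)
  \<comment> \<open>The corrected value at 0 can occur only for \<open>b = - a\<close>, and then its
    coefficient \<open>om a b\<close> is 0.\<close>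
  have off0: "br (F a) (F b) = scale (om a b) (F (a + b) - F a - F b)" if "a \<noteq> 0" "b \<noteq> 0" for a b
  proof (cases "a + b = 0")
    case True
    then have "om a b = 0" by (metis add_eq_0_iff om_invariant om_0(2) add.commute add_0)
    then show ?thesis using that by (simp add: FX br_X)
  qed (use that in \<open>simp add: FX br_X\<close>)
  have zero: "br (F 0) (F b) = 0" for b
  proof (cases "b = 0")
    case True
    then show ?thesis by (simp add: br_self FG)
  next
    case False
    obtain i :: 'n where True by simp
    let ?r = "axis i 1 :: int ^ 'n"
    let ?g = "\<lambda>a. F (a + b) - F a - F b"
    \<comment> \<open>The defect of the relation, as a function of \<open>a\<close>, is polynomial:
      its \<open>K + 1\<close>-st differences vanish, one more than for \<open>F\<close> because of
      the linear weight. It is zero at all positive multiples of \<open>?r\<close>, hence also at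
      0.\<close>
    let ?h = "\<lambda>a. br (F a) (F b) - scale (om a b) (?g a)"
    have "del ?r (Suc K) ?h 0 = (if even (Suc K) then ?h 0 else - ?h 0)"
    proof (rule fdiffs_replicate_point)
      fix j :: nat assume "1 \<le> j"
      then have "0 + int j \<odot> ?r \<noteq> 0" by (auto simp: vec_eq_iff axis_def)
      then show "?h (0 + int j \<odot> ?r) = 0" using off0[OF _ False] by simp
    qed
    moreover have "del ?r (Suc K) ?h 0 = 0"
    proof -
      have "del ?r (Suc K) (\<lambda>a. br (F a) (F b)) 0 = br (del ?r (Suc K) F 0) (F b)"
        using fun_cong[OF fdiffs_hom_on[of G "\<lambda>x. br x (F b)" F "replicate (Suc K) ?r"], of 0]
        by (simp add: G_diff br_diff_left FG del: replicate_Suc fdiffs_simps)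
      also have "del ?r (Suc K) F 0 = 0" by (rule polK) simp
      also have "br 0 (F b) = 0" using br_diff_left[of 0 0 "F b"] by (simp add: G0 FG)
      finally have 1: "del ?r (Suc K) (\<lambda>a. br (F a) (F b)) 0 = 0" .
      have "del ?r K (\<lambda>a. F b) = (\<lambda>a. 0)" by (rule fdiffs_const) (simp add: K_def)
      then have "del ?r K ?g q = 0" for q
        by (simp only: fdiffs_minus fun_cong[OF fdiffs_shift[of _ F]]) (simp add: polK)
      then have 2: "del ?r (Suc K) (\<lambda>a. scale (om a b) (?g a)) 0 = 0"
        by (intro del_leibniz_zero) (auto simp: om_add_left)
      show ?thesis using 1 2 by (simp only: fdiffs_minus) simp
    qed
    ultimately have "?h 0 = 0" by (metis (no_types, lifting) neg_equal_0_iff_equal)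
    then show ?thesis by (simp add: om_0)
  qed
  have "br (F a) (F b) = scale (om a b) (F (a + b) - F a - F b)" for a b
  proof (cases "a = 0 \<or> b = 0")
    case True
    then show ?thesis using zero[of b] zero[of a] br_anti[of "F a" "F b"] by (auto simp: om_0 FG)
  qed (use off0 in blast)
  then show ?thesis using FX FG polF by blast
qed

end


section \<open>Operators on a finite-dimensional space\<close>

locale op_space = vector_space scale
  for scale :: "complex \<Rightarrow> 'w::ab_group_add \<Rightarrow> 'w" +
  fixes V Sp :: "'w set"
  assumes finS: "finite Sp" and V_span: "V = span Sp"
begin

lemma subV: "subspace V"
  by (simp add: V_span)

lemma V_closed: "0 \<in> V" "x \<in> V \<Longrightarrow> y \<in> V \<Longrightarrow> x + y \<in> V" "x \<in> V \<Longrightarrow> y \<in> V \<Longrightarrow> x - y \<in> V"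
  "x \<in> V \<Longrightarrow> scale c x \<in> V" "x \<in> V \<Longrightarrow> - x \<in> V"
  using subV by (auto intro: subspace_0 subspace_add subspace_diff subspace_scale subspace_neg)

text \<open>Operators are cut off to 0 outside \<open>V\<close>. Equality of operators on
  \<open>V\<close> is then equality of functions, and \<open>End\<close> is a subspace of the
  function space with pointwise operations.\<close>

definition End :: "('w \<Rightarrow> 'w) set" where
  "End = {f. (\<forall>v\<in>V. f v \<in> V) \<and> (\<forall>v\<in>V. \<forall>w\<in>V. f (v + w) = f v + f w) \<and>
     (\<forall>c. \<forall>v\<in>V. f (scale c v) = scale c (f v)) \<and> (\<forall>v. v \<notin> V \<longrightarrow> f v = 0)}"

definition oscale :: "complex \<Rightarrow> ('w \<Rightarrow> 'w) \<Rightarrow> 'w \<Rightarrow> 'w" where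
  "oscale c f = (\<lambda>v. scale c (f v))"

definition obr :: "('w \<Rightarrow> 'w) \<Rightarrow> ('w \<Rightarrow> 'w) \<Rightarrow> 'w \<Rightarrow> 'w" where
  "obr f g = (\<lambda>v. f (g v) - g (f v))"

lemma sum_apply: "sum f I x = (\<Sum>i\<in>I. f i x)"
  by (induction I rule: infinite_finite_induct) simp_all

lemma vector_space_oscale: "vector_space oscale"
  by unfold_locales
    (simp_all add: oscale_def fun_eq_iff plus_fun_def scale_right_distrib scale_left_distrib)

sublocale op: vector_space oscale
  by (rule vector_space_oscale)

lemma End_in: "f \<in> End \<Longrightarrow> v \<in> V \<Longrightarrow> f v \<in> V"
  and End_add: "f \<in> End \<Longrightarrow> v \<in> V \<Longrightarrow> w \<in> V \<Longrightarrow> f (v + w) = f v + f w"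
  and End_scale: "f \<in> End \<Longrightarrow> v \<in> V \<Longrightarrow> f (scale c v) = scale c (f v)"
  and End_off: "f \<in> End \<Longrightarrow> v \<notin> V \<Longrightarrow> f v = 0"
  by (auto simp: End_def)

lemma End_0: "f \<in> End \<Longrightarrow> f 0 = 0"
  using End_add[of f 0 0] V_closed(1) by simp

lemma End_sum:
  assumes "f \<in> End" "\<And>i. i \<in> I \<Longrightarrow> g i \<in> V"
  shows "f (sum g I) = (\<Sum>i\<in>I. f (g i))"
  using assms(2)
proof (induction I rule: infinite_finite_induct)
  case (insert x I)
  then have "sum g I \<in> V" by (intro subspace_sum subV) auto
  then show ?case using insert by (simp add: End_add assms(1))
qed (simp_all add: End_0 assms(1))

lemma subspace_End: "op.subspace End"
  unfolding op.subspace_def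
  by (auto simp: End_def oscale_def V_closed scale_right_distrib scale_left_commute zero_fun_def plus_fun_def algebra_simps)

lemma obr_End: "f \<in> End \<Longrightarrow> g \<in> End \<Longrightarrow> obr f g \<in> End"
  unfolding obr_def
  by (subst End_def) (auto simp: End_in End_add End_scale End_off End_0 V_closed scale_right_diff_distrib algebra_simps)

lemma obr_anti: "obr f g = - obr g f"
  by (simp add: obr_def fun_eq_iff)

lemma obr_add_left: "f \<in> End \<Longrightarrow> g \<in> End \<Longrightarrow> h \<in> End \<Longrightarrow> obr (f + g) h = obr f h + obr g h"
proof -
  assume a: "f \<in> End" "g \<in> End" "h \<in> End"
  have "f v \<in> V" "g v \<in> V" for v using a V_closed(1) by (cases "v \<in> V"; simp add: End_in End_off)+
  then show ?thesis using a by (simp add: obr_def fun_eq_iff plus_fun_def End_add)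
qed

lemma obr_scale_left: "f \<in> End \<Longrightarrow> h \<in> End \<Longrightarrow> obr (oscale c f) h = oscale c (obr f h)"
proof -
  assume a: "f \<in> End" "h \<in> End"
  have "f v \<in> V" for v using a V_closed(1) by (cases "v \<in> V"; simp add: End_in End_off)+
  then show ?thesis using a by (simp add: obr_def oscale_def fun_eq_iff End_scale scale_right_diff_distrib)
qed

lemma finite_independent: "\<not> dependent A \<Longrightarrow> A \<subseteq> V \<Longrightarrow> finite A"
  using independent_span_bound[OF finS, of A] by (simp add: V_span)

text \<open>The spanning set consists of the matrix units with respect to a basis \<open>A\<close>
  of \<open>V\<close>: \<open>E (b, c)\<close> sends \<open>b\<close> to \<open>c\<close> and the
  other basis vectors to 0.\<close>

lemma End_finite_span: "\<exists>Bs. finite Bs \<and> End \<subseteq> op.span Bs"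
proof -
  obtain A where A: "A \<subseteq> V" "\<not> dependent A" "V \<subseteq> span A"
    by (rule basis_exists[of V]) blast
  have finA: "finite A" using A by (intro finite_independent)
  have spA: "span A = V" using A subV by (simp add: span_subspace)
  define E where "E = (\<lambda>(b, c) v. if v \<in> V then scale (representation A v b) c else 0)"
  have "f \<in> op.span (E ` (A \<times> A))" if f: "f \<in> End" for f
  proof -
    have "f = (\<Sum>(b, c)\<in>A \<times> A. oscale (representation A (f b) c) (E (b, c)))"
    proof
      fix v
      have sumapp: "(\<Sum>(b, c)\<in>A \<times> A. oscale (representation A (f b) c) (E (b, c))) v =
        (\<Sum>(b, c)\<in>A \<times> A. scale (representation A (f b) c) (E (b, c) v))"
        by (simp add: sum_apply split_def oscale_def)
      show "f v = (\<Sum>(b, c)\<in>A \<times> A. oscale (representation A (f b) c) (E (b, c))) v"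
      proof (cases "v \<in> V")
        case True
        have "v = (\<Sum>b\<in>A. scale (representation A v b) b)"
          using sum_representation_eq[of A v A] A True finA spA by simp
        then have "f v = f (\<Sum>b\<in>A. scale (representation A v b) b)" by simp
        also have "\<dots> = (\<Sum>b\<in>A. scale (representation A v b) (f b))"
          using A(1) by (subst End_sum[OF f]) (auto simp: V_closed End_scale[OF f] intro!: sum.cong)
        also have "\<dots> = (\<Sum>b\<in>A. scale (representation A v b) (\<Sum>c\<in>A. scale (representation A (f b) c) c))"
        proof (rule sum.cong)
          fix b assume "b \<in> A"
          then have "f b \<in> V" using A(1) f by (auto intro: End_in)
          then have "f b \<in> span A" by (simp only: spA)
          then show "scale (representation A v b) (f b) = scale (representation A v b) (\<Sum>c\<in>A. scale (representation A (f b) c) c)"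
            using sum_representation_eq[of A "f b" A] A finA by simp
        qed simp
        also have "\<dots> = (\<Sum>b\<in>A. \<Sum>c\<in>A. scale (representation A (f b) c) (E (b, c) v))"
          using True by (simp add: E_def scale_sum_right mult.commute)
        finally show ?thesis by (simp add: sumapp sum.cartesian_product)
      next
        case False
        then show ?thesis unfolding sumapp using f by (simp add: E_def End_off split_def)
      qed
    qed
    also have "\<dots> \<in> op.span (E ` (A \<times> A))"
      by (rule op.span_sum) (clarsimp, rule op.span_scale, rule op.span_base, simp)
    finally show ?thesis .
  qed
  then show ?thesis using finA by (intro exI[of _ "E ` (A \<times> A)"]) auto
qed

lemma dim_psubset:
  assumes "subspace W" "subspace W'" "W' \<subset> W" "W \<subseteq> V"
  shows "dim W' < dim W"
proof -
  obtain A' where A': "A' \<subseteq> W'" "\<not> dependent A'" "W' \<subseteq> span A'" "card A' = dim W'"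
    by (rule basis_exists[of W']) blast
  obtain A where A: "A \<subseteq> W" "\<not> dependent A" "W \<subseteq> span A" "card A = dim W"
    by (rule basis_exists[of W]) blast
  obtain x where x: "x \<in> W" "x \<notin> W'" using assms(3) by blast
  have "span A' = W'" using A' assms(2) by (simp add: span_subspace)
  then have xs: "x \<notin> span A'" using x by simp
  then have "\<not> dependent (insert x A')" using A'(2) by (simp add: independent_insert)
  moreover have "insert x A' \<subseteq> span A" using A A' x assms(3) by blast
  moreover have "finite A" using A assms(4) by (intro finite_independent) auto
  ultimately have "card (insert x A') \<le> card A"
    using independent_span_bound by blast
  moreover have "x \<notin> A'" using xs span_base by blast
  moreover have "finite A'" using A' assms(3,4) by (intro finite_independent) auto
  ultimately show ?thesis using A A' by simp
qed

section \<open>Eigenvectors and Lie's lemma\<close>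

lemma funpow_in: "f \<in> End \<Longrightarrow> w \<in> V \<Longrightarrow> (f ^^ i) w \<in> V"
  by (induction i) (simp_all add: End_in)

text \<open>With \<open>pa p = p(f) w\<close>, a polynomial of least degree annihilating
  \<open>w\<close> has a root \<open>t\<close> over the complex numbers; dividing by the linear
  factor leaves a \<open>q\<close> with \<open>q(f) w\<close> non-zero and annihilated by
  \<open>f - t\<close>.\<close>

lemma eigenvector:
  assumes f: "f \<in> End" and W: "subspace W" "W \<subseteq> V" "W \<noteq> {0}" and inv: "\<And>w. w \<in> W \<Longrightarrow> f w \<in> W"
  shows "\<exists>w\<in>W. \<exists>c. w \<noteq> 0 \<and> f w = scale c w"
proof -
  obtain w where w: "w \<in> W" "w \<noteq> 0" using W subspace_0 by blast
  define pa where "pa p = (\<Sum>i\<le>degree p. scale (coeff p i) ((f ^^ i) w))" for p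
  have pa_eq: "pa p = (\<Sum>i\<le>n. scale (coeff p i) ((f ^^ i) w))" if "degree p \<le> n" for p n
    unfolding pa_def by (rule sum.mono_neutral_left) (use that in \<open>auto simp: coeff_eq_0\<close>)
  have iter: "(f ^^ i) w \<in> W" for i by (induction i) (use w inv in auto)
  have pa_W: "pa p \<in> W" for p
    unfolding pa_def by (intro subspace_sum W subspace_scale iter)
  have pa_mult: "pa ([:-t, 1:] * q) = f (pa q) - scale t (pa q)" for t q
  proof -
    let ?n = "degree q"
    have "degree ([:-t, 1:] * q) \<le> Suc ?n"
      using degree_mult_le[of "[:-t, 1:]" q] by simp
    then have "pa ([:-t, 1:] * q) = (\<Sum>i\<le>Suc ?n. scale (coeff ([:-t, 1:] * q) i) ((f ^^ i) w))"
      by (rule pa_eq)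
    also have "\<dots> = (\<Sum>i\<le>Suc ?n. scale (coeff (pCons 0 q) i) ((f ^^ i) w)) -
       scale t (\<Sum>i\<le>Suc ?n. scale (coeff q i) ((f ^^ i) w))"
      by (simp add: scale_sum_right sum_subtractf[symmetric] scale_left_diff_distrib del: sum.atMost_Suc)
    also have "(\<Sum>i\<le>Suc ?n. scale (coeff q i) ((f ^^ i) w)) = pa q"
      by (rule pa_eq[symmetric]) simp
    also have "(\<Sum>i\<le>Suc ?n. scale (coeff (pCons 0 q) i) ((f ^^ i) w)) = (\<Sum>i\<le>?n. scale (coeff q i) (f ((f ^^ i) w)))"
      by (simp add: sum.atMost_Suc_shift del: sum.atMost_Suc)
    also have "\<dots> = f (pa q)"
      unfolding pa_def using iter W(2)
      by (subst End_sum[OF f]) (auto simp: V_closed End_scale[OF f] subset_iff intro!: sum.cong)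
    finally show ?thesis .
  qed
  let ?I = "{..card Sp}"
  obtain c where c: "\<exists>i\<in>?I. c i \<noteq> 0" "(\<Sum>i\<in>?I. scale (c i) ((f ^^ i) w)) = 0"
    using family_dependent[OF finS, of ?I "\<lambda>i. (f ^^ i) w"] iter W(2) V_span by auto
  define p0 where "p0 = (\<Sum>i\<in>?I. monom (c i) i)"
  have coeff_p0: "coeff p0 i = (if i \<in> ?I then c i else 0)" for i
    by (simp add: p0_def coeff_sum coeff_monom)
  have p0: "p0 \<noteq> 0 \<and> pa p0 = 0"
  proof
    show "p0 \<noteq> 0" using c(1) coeff_p0 by (metis coeff_0)
    have "degree p0 \<le> card Sp" by (rule degree_le) (simp add: coeff_p0)
    then show "pa p0 = 0" using pa_eq[of p0 "card Sp"] c(2) by (simp add: coeff_p0)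
  qed
  obtain p where p: "p \<noteq> 0" "pa p = 0" and pmin: "\<And>q. q \<noteq> 0 \<and> pa q = 0 \<Longrightarrow> degree p \<le> degree q"
    using ex_has_least_nat[of "\<lambda>p. p \<noteq> 0 \<and> pa p = 0" p0 degree] p0 by blast
  have "degree p \<noteq> 0"
  proof
    assume "degree p = 0"
    then obtain a where "p = [:a:]" by (rule degree_eq_zeroE)
    then show False using p w by (simp add: pa_def)
  qed
  then obtain t where "poly p t = 0"
    using fundamental_theorem_of_algebra[of p] constant_degree[of p] by auto
  then obtain q where q: "p = [:-t, 1:] * q" by (auto simp: poly_eq_0_iff_dvd)
  have "q \<noteq> 0" using p(1) q by auto
  then have "degree q < degree p"
    unfolding q by (subst degree_mult_eq) auto
  then have "pa q \<noteq> 0" using pmin[of q] \<open>q \<noteq> 0\<close> by auto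
  moreover have "f (pa q) = scale t (pa q)" using pa_mult[of t q] p(2) q by simp
  ultimately show ?thesis using pa_W by blast
qed

text \<open>In a non-zero invariant subspace of least dimension every eigenspace of a member of
  \<open>J\<close> is again invariant, as the members commute; by minimality it is the whole
  subspace, so all of \<open>J\<close> acts there by scalars.\<close>

lemma common_eigenvector:
  assumes J: "J \<subseteq> End" and comm: "\<And>x y v. x \<in> J \<Longrightarrow> y \<in> J \<Longrightarrow> v \<in> V \<Longrightarrow> x (y v) = y (x v)"
    and V0: "V \<noteq> {0}"
  shows "\<exists>w\<in>V. w \<noteq> 0 \<and> (\<forall>x\<in>J. \<exists>c. x w = scale c w)"
proof -
  define P where "P W \<longleftrightarrow> subspace W \<and> W \<subseteq> V \<and> W \<noteq> {0} \<and> (\<forall>x\<in>J. \<forall>w\<in>W. x w \<in> W)" for W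
  have "P V" unfolding P_def using subV V0 J End_in by blast
  then obtain W where PW: "P W" and min: "\<And>W'. P W' \<Longrightarrow> dim W \<le> dim W'"
    using ex_has_least_nat[of P V dim] by blast
  have W: "subspace W" "W \<subseteq> V" "W \<noteq> {0}" "\<forall>x\<in>J. \<forall>w\<in>W. x w \<in> W"
    using PW by (auto simp: P_def)
  have "\<exists>c. \<forall>w\<in>W. x w = scale c w" if x: "x \<in> J" for x
  proof -
    obtain w c where w: "w \<in> W" "w \<noteq> 0" "x w = scale c w"
      using eigenvector[of x W] x W J by blast
    let ?W' = "{w \<in> W. x w = scale c w}"
    have xE: "x \<in> End" and WV: "\<And>w. w \<in> W \<Longrightarrow> w \<in> V" using x J W by auto
    have PW': "P ?W'"
      unfolding P_def
    proof (intro conjI ballI)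
      show "subspace ?W'"
        unfolding subspace_def
        using W WV by (auto simp: End_0[OF xE] End_add[OF xE] End_scale[OF xE] subspace_0 subspace_add subspace_scale scale_right_distrib scale_left_commute)
      show "?W' \<noteq> {0}" using w by blast
      fix y v assume y: "y \<in> J" and v: "v \<in> ?W'"
      have yE: "y \<in> End" using y J by blast
      have "x (y v) = y (x v)" using comm[OF x y] v WV by blast
      also have "\<dots> = scale c (y v)" using v WV by (simp add: End_scale[OF yE])
      finally show "y v \<in> ?W'" using y v W by blast
    qed (use W in auto)
    then have "dim W \<le> dim ?W'" by (rule min)
    then have "?W' = W" using dim_psubset[of W ?W'] W PW' unfolding P_def by fastforce
    then show ?thesis by blast
  qed
  moreover obtain w where "w \<in> W" "w \<noteq> 0" using W subspace_0 by blast
  ultimately show ?thesis using W by blast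
qed

text \<open>Lie's lemma. With \<open>a k = y\<^sup>k w\<close>, the operator \<open>x\<close> is upper triangular on
  the span of the \<open>a k\<close> and maps \<open>a k\<close> to \<open>lam x a k + k lam [x, y] a (k - 1)\<close> up to lower terms;
  as some \<open>a n\<close> depends on the earlier ones, \<open>lam [x, y]\<close> has to vanish.\<close>

lemma weight_bracket_zero:
  assumes y: "y \<in> End" and J: "J \<subseteq> End" and w: "w \<in> V" "w \<noteq> 0"
    and wt: "\<And>x. x \<in> J \<Longrightarrow> x w = scale (lam x) w" and Jy: "\<And>x. x \<in> J \<Longrightarrow> obr x y \<in> J"
    and x: "x \<in> J"
  shows "lam (obr x y) = 0"
proof -
  define a where "a k = (y ^^ k) w" for k
  define U where "U k = span (a ` {..<k})" for k
  have aV: "a k \<in> V" for k unfolding a_def using y w(1) by (rule funpow_in)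
  have ya: "y (a k) = a (Suc k)" for k by (simp add: a_def)
  have UV: "U k \<subseteq> V" for k unfolding U_def by (rule span_minimal) (use aV subV in auto)
  have Umono: "u \<in> U k \<Longrightarrow> k \<le> l \<Longrightarrow> u \<in> U l" for u k l
    unfolding U_def by (meson image_mono in_mono lessThan_subset_iff span_mono)
  have aU: "k < l \<Longrightarrow> a k \<in> U l" for k l unfolding U_def by (rule span_base) auto
  have Uops: "0 \<in> U k" "u \<in> U k \<Longrightarrow> v \<in> U k \<Longrightarrow> u + v \<in> U k" "u \<in> U k \<Longrightarrow> v \<in> U k \<Longrightarrow> u - v \<in> U k"
    "u \<in> U k \<Longrightarrow> scale c u \<in> U k" for u v k c
    by (auto simp: U_def span_zero span_add span_diff span_scale)
  have map_U: "f u \<in> U l" if f: "f \<in> End" and u: "u \<in> U k" and fa: "\<And>i. i < k \<Longrightarrow> f (a i) \<in> U l" for f u k l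
  proof -
    have "subspace {u \<in> V. f u \<in> U l}"
      unfolding subspace_def
      by (auto simp: End_0[OF f] End_add[OF f] End_scale[OF f] V_closed Uops)
    moreover have "a ` {..<k} \<subseteq> {u \<in> V. f u \<in> U l}"
      using aV fa by auto
    ultimately show ?thesis
      using u span_minimal unfolding U_def[of k] by blast
  qed
  have yU: "y u \<in> U (Suc k)" if "u \<in> U k" for u k
    by (rule map_U[OF y that]) (simp add: ya aU)
  \<comment> \<open>The claim is made for all of \<open>J\<close> at once, since the step for
    \<open>x\<close> uses the claim for \<open>[x, y]\<close>. At \<open>k = 0\<close> the truncated
    index \<open>k - 1\<close> is harmless: its coefficient is 0, and \<open>U 0\<close> is
    zero.\<close>
  have main: "\<forall>x\<in>J. x (a k) - scale (lam x) (a k) - scale (of_nat k * lam (obr x y)) (a (k - 1)) \<in> U (k - 1)" for k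
  proof (induction k)
    case 0
    then show ?case using wt by (simp add: a_def Uops)
  next
    case (Suc k)
    show ?case
    proof
      fix x assume x: "x \<in> J"
      let ?z = "obr x y"
      have xE: "x \<in> End" and z: "?z \<in> J" using x J Jy by auto
      define u where "u = x (a k) - scale (lam x) (a k) - scale (of_nat k * lam ?z) (a (k - 1))"
      have u: "u \<in> U (k - 1)" using Suc x by (simp add: u_def)
      have "?z (a k) - scale (lam ?z) (a k) - scale (of_nat k * lam (obr ?z y)) (a (k - 1)) \<in> U (k - 1)"
        using Suc z by blast
      moreover have "scale (of_nat k * lam (obr ?z y)) (a (k - 1)) \<in> U k"
        by (cases k) (simp_all add: Uops aU)
      ultimately have zk: "?z (a k) - scale (lam ?z) (a k) \<in> U k"
        using Uops(2) Umono[of _ "k - 1" k] by (metis diff_add_cancel diff_le_self)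
      have yu: "y u \<in> U k"
      proof (cases k)
        case 0
        then have "u = 0" using u by (simp add: U_def)
        then show ?thesis using y by (simp add: End_0 Uops)
      next
        case (Suc j)
        then show ?thesis using yU[OF u] by simp
      qed
      have "x (a k) = scale (lam x) (a k) + scale (of_nat k * lam ?z) (a (k - 1)) + u"
        by (simp add: u_def)
      then have "y (x (a k)) = scale (lam x) (a (Suc k)) + scale (of_nat k * lam ?z) (y (a (k - 1))) + y u"
        using aV u UV[of "k - 1"] by (simp add: End_add[OF y] End_scale[OF y] V_closed ya subset_iff)
      also have "scale (of_nat k * lam ?z) (y (a (k - 1))) = scale (of_nat k * lam ?z) (a k)"
        by (cases k) (simp_all add: ya)
      finally have "x (a (Suc k)) = scale (lam x) (a (Suc k)) + scale (of_nat k * lam ?z) (a k) + y u + ?z (a k)"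
        by (simp add: obr_def ya)
      then have "x (a (Suc k)) - scale (lam x) (a (Suc k)) - scale (of_nat (Suc k) * lam ?z) (a (Suc k - 1)) =
        y u + (?z (a k) - scale (lam ?z) (a k))"
        by (simp add: algebra_simps scale_left_distrib)
      then show "x (a (Suc k)) - scale (lam x) (a (Suc k)) - scale (of_nat (Suc k) * lam ?z) (a (Suc k - 1)) \<in> U (Suc k - 1)"
        using yu zk by (simp add: Uops)
    qed
  qed
  have "\<exists>n. a n \<in> U n"
  proof (rule ccontr)
    assume no: "\<not> ?thesis"
    have ind: "\<not> dependent (a ` {..<k}) \<and> inj_on a {..<k}" for k
    proof (induction k)
      case (Suc k)
      have "a k \<notin> span (a ` {..<k})" using no by (auto simp: U_def)
      then show ?case using Suc span_base by (auto simp: lessThan_Suc independent_insert)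
    qed (simp add: independent_empty)
    have "card (a ` {..<Suc (card Sp)}) \<le> card Sp"
      using independent_span_bound[OF finS, of "a ` {..<Suc (card Sp)}"] ind aV V_span by blast
    then show False using card_image[of a "{..<Suc (card Sp)}"] ind by simp
  qed
  then obtain n where n: "a n \<in> U n" and nmin: "\<And>m. a m \<in> U m \<Longrightarrow> n \<le> m"
    using ex_has_least_nat[of "\<lambda>n. a n \<in> U n" _ "\<lambda>n. n"] by blast
  have "n \<noteq> 0"
  proof
    assume "n = 0"
    then show False using n w(2) by (simp add: U_def a_def)
  qed
  then obtain m where m: "n = Suc m" by (cases n) auto
  show ?thesis
  proof (rule ccontr)
    assume c: "lam (obr x y) \<noteq> 0"
    have xE: "x \<in> End" using x J by blast
    define N where "N = x - oscale (lam x) (\<lambda>v. if v \<in> V then v else 0)"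
    have idE: "(\<lambda>v. if v \<in> V then v else 0) \<in> End" by (auto simp: End_def V_closed)
    have NE: "N \<in> End"
      unfolding N_def using xE idE subspace_End by (intro op.subspace_diff op.subspace_scale)
    have Na: "N (a k) = x (a k) - scale (lam x) (a k)" for k
      using aV by (simp add: N_def oscale_def)
    have Nk: "N (a k) \<in> U k" for k
    proof -
      have "N (a k) - scale (of_nat k * lam (obr x y)) (a (k - 1)) \<in> U (k - 1)"
        using main[of k] x by (simp add: Na)
      moreover have "scale (of_nat k * lam (obr x y)) (a (k - 1)) \<in> U k"
        by (cases k) (simp_all add: Uops aU)
      ultimately show ?thesis
        using Uops(2) Umono[of _ "k - 1" k] by (metis diff_add_cancel diff_le_self)
    qed
    \<comment> \<open>\<open>a n\<close> is a combination of \<open>a 0\<close>, ...,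
      \<open>a m\<close>, and \<open>N = x - lam x\<close> maps each \<open>a i\<close> into
      \<open>U i\<close>, hence into \<open>U m\<close>. On the other hand \<open>N (a n)\<close> is
      \<open>n lam [x, y] a m\<close> modulo \<open>U m\<close>; dividing by the non-zero factor
      puts \<open>a m\<close> into \<open>U m\<close>, against the minimality of
      \<open>n\<close>.\<close>
    have "N (a n) \<in> U m"
      by (rule map_U[OF NE n]) (use Nk Umono m in \<open>auto simp: less_Suc_eq_le\<close>)
    moreover have "N (a n) - scale (of_nat n * lam (obr x y)) (a m) \<in> U m"
      using main[of n] x by (simp add: Na m)
    ultimately have "scale (of_nat n * lam (obr x y)) (a m) \<in> U m"
      using Uops(3) by (metis diff_diff_eq2 add_diff_cancel_left')
    then have "scale (inverse (of_nat n * lam (obr x y))) (scale (of_nat n * lam (obr x y)) (a m)) \<in> U m"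
      by (rule Uops(4))
    moreover have "inverse (of_nat n * lam (obr x y)) * (of_nat n * lam (obr x y)) = 1"
      using c m by (intro left_inverse) (simp del: of_nat_Suc)
    ultimately have "a m \<in> U m" by (simp only: scale_scale scale_one)
    then show False using nmin[of m] m by simp
  qed
qed

text \<open>The joint eigenspace \<open>W\<close> for the eigenvalues of a common eigenvector is
  stable under \<open>Y\<close>, because the eigenvalue of \<open>[x, y]\<close> is 0 by Lie's
  lemma; irreducibility makes it all of \<open>V\<close>. \<open>J\<close> is a mere set closed
  under brackets with \<open>Y\<close>, so that both a span of differences and a pair
  \<open>{0, F 0}\<close> can be inserted.\<close>

lemma abelian_ideal_scalar:
  assumes V0: "V \<noteq> {0}" and Y: "Y \<subseteq> End" and J: "J \<subseteq> End"
    and comm: "\<And>x x'. x \<in> J \<Longrightarrow> x' \<in> J \<Longrightarrow> obr x x' = 0"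
    and JY: "\<And>x y. x \<in> J \<Longrightarrow> y \<in> Y \<Longrightarrow> obr x y \<in> J"
    and irr: "\<And>W. subspace W \<Longrightarrow> W \<subseteq> V \<Longrightarrow> (\<And>y w. y \<in> Y \<Longrightarrow> w \<in> W \<Longrightarrow> y w \<in> W) \<Longrightarrow> W = {0} \<or> W = V"
    and x: "x \<in> J"
  shows "\<exists>c. \<forall>v\<in>V. x v = scale c v"
proof -
  have "x (y v) = y (x v)" if "x \<in> J" "y \<in> J" "v \<in> V" for x y v
    using fun_cong[OF comm[OF that(1,2)], of v] by (simp add: obr_def)
  then obtain w where w: "w \<in> V" "w \<noteq> 0" "\<forall>x\<in>J. \<exists>c. x w = scale c w"
    using common_eigenvector[OF J _ V0] by blast
  then obtain lam where lam: "\<And>x. x \<in> J \<Longrightarrow> x w = scale (lam x) w" by metis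
  define W where "W = {v \<in> V. \<forall>x\<in>J. x v = scale (lam x) v}"
  have "W = {0} \<or> W = V"
  proof (rule irr)
    show "subspace W"
      unfolding subspace_def W_def using J
      by (auto simp: V_closed End_0 End_add End_scale subset_iff scale_right_distrib scale_left_commute)
    show "W \<subseteq> V" by (auto simp: W_def)
    fix y v assume y: "y \<in> Y" and v: "v \<in> W"
    have yE: "y \<in> End" using y Y by blast
    have "x (y v) = scale (lam x) (y v)" if x: "x \<in> J" for x
    proof -
      have "lam (obr x y) = 0"
        by (rule weight_bracket_zero[where lam = lam and x = x and y = y, OF yE J w(1,2)])
          (use lam JY y x in auto)
      moreover have "obr x y v = scale (lam (obr x y)) v" using v JY[OF x y] by (simp add: W_def)
      ultimately have "obr x y v = 0" by simp
      then have "x (y v) = y (x v)" by (simp add: obr_def)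
      also have "x v = scale (lam x) v" using v x by (simp add: W_def)
      finally show ?thesis using v by (simp add: W_def End_scale[OF yE])
    qed
    then show "y v \<in> W" using v yE by (simp add: W_def End_in)
  qed
  moreover have "w \<in> W" using w lam by (simp add: W_def)
  ultimately have "W = V" using w(2) by auto
  then show ?thesis using x by (auto simp: W_def)
qed

end


section \<open>Irreducible finite-dimensional representations\<close>

lemma fdiffs_sum: "fdiffs rs (\<lambda>q. \<Sum>i\<in>I. g i q) = (\<lambda>q. \<Sum>i\<in>I. fdiffs rs (g i) q)"
  by (induction I rule: infinite_finite_induct) (simp_all add: fdiffs_zero fdiffs_add)

text \<open>The setting of a finite-dimensional irreducible module, \<open>X u\<close> being the
  action of \<open>T(u)\<close> cut off outside \<open>V\<close>. \<open>X_zero\<close> reflects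
  \<open>T(0) = 0\<close> and fixes the value that the bracket relation leaves free.\<close>

locale irr_rep = op_space scale V Sp
  for scale :: "complex \<Rightarrow> 'w::ab_group_add \<Rightarrow> 'w" and V Sp :: "'w set" +
  fixes X :: "int ^ 'n::finite \<Rightarrow> 'w \<Rightarrow> 'w" and om :: "int ^ 'n \<Rightarrow> int ^ 'n \<Rightarrow> complex"
  assumes X_End: "\<And>u. X u \<in> End"
    and X_zero: "X 0 = 0"
    and obr_X: "\<And>a b. obr (X a) (X b) = oscale (om a b) (X (a + b) - X a - X b)"
    and om_add_left': "\<And>a b c. om (a + b) c = om a c + om b c"
    and om_anti': "\<And>a b. om a b = - om b a"
    and om_indep': "\<And>s i. s \<notin> range (\<lambda>k. vector_scalar_mult k (axis i 1)) \<Longrightarrow>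
      \<exists>w w'. om w s * om w' (axis i 1) \<noteq> om w (axis i 1) * om w' s"
    and om_nondeg: "\<And>a. a \<noteq> 0 \<Longrightarrow> \<exists>u. om a u \<noteq> 0"
    and card2': "\<exists>i j :: 'n. i \<noteq> j"
    and V_nonzero: "V \<noteq> {0}"
    and irreducible: "\<And>W. subspace W \<Longrightarrow> W \<subseteq> V \<Longrightarrow> (\<And>u w. w \<in> W \<Longrightarrow> X u w \<in> W) \<Longrightarrow> W = {0} \<or> W = V"
begin

definition End_basis :: "('w \<Rightarrow> 'w) set" where
  "End_basis = (SOME Bs. finite Bs \<and> End \<subseteq> op.span Bs)"

lemma End_basis: "finite End_basis" "End \<subseteq> op.span End_basis"
  using someI_ex[OF End_finite_span] by (auto simp: End_basis_def)

sublocale dl: diff_lie oscale End End_basis obr X om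
proof unfold_locales
  show "op.subspace End" by (rule subspace_End)
  show "finite End_basis" "End \<subseteq> op.span End_basis" by (rule End_basis)+
  show "obr x y \<in> End" if "x \<in> End" "y \<in> End" for x y using that by (rule obr_End)
  show "obr (x + y) z = obr x z + obr y z" if "x \<in> End" "y \<in> End" "z \<in> End" for x y z
    using that by (rule obr_add_left)
  show "obr (oscale c x) z = oscale c (obr x z)" if "x \<in> End" "z \<in> End" for c x z
    using that by (rule obr_scale_left)
  show "obr x y = - obr y x" for x y by (rule obr_anti)
  show "X u \<in> End" for u by (rule X_End)
  show "obr (X a) (X b) = oscale (om a b) (X (a + b) - X a - X b)" for a b by (rule obr_X)
  show "om (a + b) c = om a c + om b c" for a b c by (rule om_add_left')
  show "om a b = - om b a" for a b by (rule om_anti')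
  show "\<exists>w w'. om w s * om w' (axis i 1) \<noteq> om w (axis i 1) * om w' s"
    if "s \<notin> range (\<lambda>k. vector_scalar_mult k (axis i 1))" for s i
    using that by (rule om_indep')
  show "\<exists>i j :: 'n. i \<noteq> j" by (rule card2')
qed

lemma obr_zero: "f \<in> End \<Longrightarrow> obr f 0 = 0" "f \<in> End \<Longrightarrow> obr 0 f = 0"
  by (simp_all add: obr_def fun_eq_iff End_0)

lemma replace_perm: "i < length ss \<Longrightarrow> mset (ss[i := a]) = mset (a # take i ss @ drop (Suc i) ss)"
  by (simp add: upd_conv_take_nth_drop)

text \<open>The relation reads \<open>[F a, F b] = om(a, b)(fdiff a F b - F a)\<close>, so every
  term of the Leibniz rule gains the direction \<open>a\<close>; the constant \<open>F a\<close>
  disappears because \<open>k \<ge> 2\<close> leaves at least one difference. The term in which no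
  difference falls on \<open>om\<close> has order \<open>k + 1\<close> and vanishes. Differences of
  order \<open>k\<close> do not depend on the base point, whence the arbitrary
  \<open>q'\<close>.\<close>

lemma obr_top_difference:
  assumes F: "\<And>u. F u \<in> End"
    and rel: "\<And>a b. obr (F a) (F b) = oscale (om a b) (F (a + b) - F a - F b)"
    and pF: "pol UNIV (Suc k) F" and len: "length ss = k" "k \<ge> 2"
  shows "obr (F a) (fdiffs ss F q) = (\<Sum>i<k. oscale (om a (ss ! i)) (fdiffs (ss[i := a]) F q'))"
proof -
  let ?g = "\<lambda>b. F (b + a) - F a - F b"
  have top: "fdiffs rs F p = 0" if "length rs \<ge> Suc k" for rs p
    using pol_mono[OF pF that] by (simp add: pol_def fun_eq_iff)
  have base: "fdiffs rs F p = fdiffs rs F p'" if rs: "length rs = k" for rs p p'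
  proof -
    have "fdiffs ((p - p') # rs) F p' = 0" by (rule top) (simp add: rs)
    then show ?thesis by (simp add: fdiffs_fdiff) (simp add: fdiff_def)
  qed
  have g: "fdiffs rs ?g p = fdiffs (a # rs) F p" if "rs \<noteq> []" for rs p
  proof -
    have "?g = (\<lambda>b. fdiff a F b - F a)" by (simp add: fdiff_def algebra_simps)
    then show ?thesis
      by (simp only: fdiffs_minus fdiffs_const[OF that]) simp
  qed
  have "obr (F a) (fdiffs ss F q) = fdiffs ss (\<lambda>b. obr (F a) (F b)) q"
    by (rule dl.br_fdiffs) (rule F)+
  also have "(\<lambda>b. obr (F a) (F b)) = (\<lambda>b. oscale (om a b) (?g b))"
    by (simp add: rel add.commute)
  also have "fdiffs ss \<dots> q = oscale (om a q) (fdiffs ss ?g q) +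
      (\<Sum>i<length ss. oscale (om a (ss ! i)) (fdiffs (take i ss @ drop (Suc i) ss) ?g (q + ss ! i)))"
    by (rule op.fdiffs_leibniz) (rule dl.om_add_right)
  also have "fdiffs ss ?g q = 0"
    using len by (subst g) (auto intro!: top simp del: fdiffs_simps)
  also have "(\<Sum>i<length ss. oscale (om a (ss ! i)) (fdiffs (take i ss @ drop (Suc i) ss) ?g (q + ss ! i))) =
    (\<Sum>i<k. oscale (om a (ss ! i)) (fdiffs (ss[i := a]) F q'))"
  proof (rule sum.cong)
    fix i assume "i \<in> {..<k}"
    then have i: "i < length ss" using len by simp
    have "length (take i ss @ drop (Suc i) ss) = k - 1" using i len by auto
    then have "take i ss @ drop (Suc i) ss \<noteq> []" using len by auto
    then have "fdiffs (take i ss @ drop (Suc i) ss) ?g (q + ss ! i) =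
        fdiffs (a # take i ss @ drop (Suc i) ss) F (q + ss ! i)" by (rule g)
    also have "\<dots> = fdiffs (ss[i := a]) F (q + ss ! i)"
      using fdiffs_perm[OF replace_perm[OF i, of a]] by metis
    also have "\<dots> = fdiffs (ss[i := a]) F q'" by (rule base) (simp add: len)
    finally show "oscale (om a (ss ! i)) (fdiffs (take i ss @ drop (Suc i) ss) ?g (q + ss ! i)) =
      oscale (om a (ss ! i)) (fdiffs (ss[i := a]) F q')" by simp
  qed (simp add: len)
  finally show ?thesis by (simp add: fun_eq_iff oscale_def)
qed

text \<open>Only symmetry and invariance are exploited: with \<open>om a u\<close> non-zero, other
  entries are traded for copies of \<open>u\<close> until none of them is left. The induction is on
  the number of entries in \<open>S\<close>, which are neither one of the listed copies of
  \<open>u\<close> nor of \<open>a\<close>.\<close>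

lemma symplectic_invariant_zero:
  assumes perm: "\<And>rs ss. mset rs = mset ss \<Longrightarrow> Dm rs = Dm ss"
    and zero: "\<And>rs. 0 \<in> set rs \<Longrightarrow> Dm rs = 0"
    and inv: "\<And>a ss. length ss = k \<Longrightarrow> (\<Sum>i<k. oscale (om a (ss ! i)) (Dm (ss[i := a]))) = 0"
    and rs: "length rs = k" "k > 0"
  shows "Dm rs = (0 :: 'w \<Rightarrow> 'w)"
proof -
  have main: "Dm (replicate p u @ S @ replicate q a) = 0"
    if "om a u \<noteq> 0" "p + length S + q = k" "q > 0" for a u p S q
    using that
  proof (induction "length S" arbitrary: S p rule: less_induct)
    case less
    \<comment> \<open>Invariance is applied to this list. Replacing one of the \<open>p + 1\<close>
      copies of \<open>u\<close> by \<open>a\<close> gives the wanted list each time; replacing an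
      entry of \<open>S\<close> gives a list with shorter \<open>S\<close>; replacing an
      \<open>a\<close> contributes \<open>om a a = 0\<close>. What remains is
      \<open>(p + 1) om(a, u)\<close> times the wanted term.\<close>
    let ?R = "replicate (Suc p) u @ S @ replicate (q - 1) a"
    have len: "length ?R = k" using less.prems by simp
    have "(\<Sum>i<k. oscale (om a (?R ! i)) (Dm (?R[i := a]))) =
      (\<Sum>i<Suc p. oscale (om a u) (Dm (replicate p u @ S @ replicate q a)))"
    proof (rule sum.mono_neutral_cong_right)
      show "{..<Suc p} \<subseteq> {..<k}" using less.prems by auto
      show "\<forall>i\<in>{..<k} - {..<Suc p}. oscale (om a (?R ! i)) (Dm (?R[i := a])) = 0"
      proof
        fix i assume i: "i \<in> {..<k} - {..<Suc p}"
        show "oscale (om a (?R ! i)) (Dm (?R[i := a])) = 0"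
        proof (cases "i < Suc p + length S")
          case True
          define j where "j = i - Suc p"
          have ij: "i = Suc p + j" "j < length S" using i True by (auto simp: j_def)
          let ?S = "take j S @ drop (Suc j) S"
          have "mset (?R[i := a]) = mset (replicate (Suc p) u @ ?S @ replicate q a)"
            using ij less.prems(3)
            by (simp add: list_update_append replace_perm mset_append del: replicate_Suc)
              (cases q, simp_all)
          then have "Dm (?R[i := a]) = Dm (replicate (Suc p) u @ ?S @ replicate q a)" by (rule perm)
          also have "\<dots> = 0"
            using ij less.prems by (intro less.hyps) auto
          finally show ?thesis by simp
        next
          case False
          then have "?R ! i = a"
            using i less.prems by (simp add: nth_append del: replicate_Suc) linarith
          then show ?thesis by (simp add: dl.om_self)
        qed
      qed
      fix i assume "i \<in> {..<Suc p}"
      then have i: "i < Suc p" by simp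
      have "mset (?R[i := a]) = mset (replicate p u @ S @ replicate q a)"
        using i less.prems(3)
        by (simp add: list_update_append mset_update del: replicate_Suc) (cases q, simp_all)
      then have "Dm (?R[i := a]) = Dm (replicate p u @ S @ replicate q a)" by (rule perm)
      moreover have "?R ! i = u" using i by (simp add: nth_append del: replicate_Suc)
      ultimately show "oscale (om a (?R ! i)) (Dm (?R[i := a])) =
        oscale (om a u) (Dm (replicate p u @ S @ replicate q a))" by simp
    qed simp
    then have "oscale (of_nat (Suc p) * om a u) (Dm (replicate p u @ S @ replicate q a)) = 0"
      using inv[OF len, of a] by (simp add: op.sum_constant_scale del: of_nat_Suc)
    then show ?case using less.prems(1) by (simp del: of_nat_Suc)
  qed
  obtain a rs' where rs': "rs = a # rs'" using rs by (cases rs) auto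
  show ?thesis
  proof (cases "a = 0")
    case True
    then show ?thesis using zero rs' by simp
  next
    case False
    then obtain u where "om a u \<noteq> 0" using om_nondeg by blast
    then have "Dm (replicate 0 u @ rs' @ replicate 1 a) = 0"
      using rs rs' by (intro main) auto
    moreover have "mset rs = mset (replicate 0 u @ rs' @ replicate 1 a)" by (simp add: rs')
    ultimately show ?thesis using perm by metis
  qed
qed

theorem pol_3: "pol UNIV 3 X"
proof -
  obtain F K where FX: "\<And>u. u \<noteq> 0 \<Longrightarrow> F u = X u" and F: "\<And>u. F u \<in> End" and polK: "pol UNIV K F"
    and rel: "\<And>a b. obr (F a) (F b) = oscale (om a b) (F (a + b) - F a - F b)"
    using dl.polynomial_extension by blast
  have irrF: "W = {0} \<or> W = V"
    if "subspace W" "W \<subseteq> V" "\<And>y w. y \<in> range F \<Longrightarrow> w \<in> W \<Longrightarrow> y w \<in> W" for W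
  proof (rule irreducible[OF that(1,2)])
    fix u w assume "w \<in> W"
    then show "X u w \<in> W"
      using that(1) that(3)[OF rangeI, of w u] FX[of u] X_zero by (cases "u = 0") (auto simp: subspace_0)
  qed
  have scalar_bracket: "obr x (F a) = 0" if x: "x \<in> End" "\<forall>v\<in>V. x v = scale c v" for x c a
  proof
    fix v
    show "obr x (F a) v = 0 v"
      using x F[of a] by (cases "v \<in> V") (simp_all add: obr_def End_in End_scale End_off End_0)
  qed
  have pol3: "pol UNIV 3 F"
  proof -
    \<comment> \<open>The least bound; if it exceeded 3, differences of order
      \<open>k = K - 1 \<ge> 3\<close> would be constant but not all zero.\<close>
    obtain K where K: "pol UNIV K F" and Kmin: "\<And>l. pol UNIV l F \<Longrightarrow> K \<le> l"
      using ex_has_least_nat[of "\<lambda>K. pol UNIV K F" K "\<lambda>x. x"] polK by blast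
    have "K \<le> 3"
    proof (rule ccontr)
      assume "\<not> K \<le> 3"
      then obtain k where k: "K = Suc k" "k \<ge> 3" by (cases K) auto
      define Dm where "Dm rs = fdiffs rs F 0" for rs
      have Dm_End: "Dm rs \<in> End" for rs unfolding Dm_def by (rule dl.diffs_in) (rule F)
      have top: "fdiffs rs F p = 0" if "length rs \<ge> Suc k" for rs p
        using pol_mono[OF K] that k by (simp add: pol_def fun_eq_iff)
      have base: "fdiffs rs F p = Dm rs" if rs: "length rs = k" for rs p
      proof -
        have "fdiffs (p # rs) F 0 = 0" by (rule top) (simp add: rs)
        then show ?thesis unfolding Dm_def by (simp add: fdiffs_fdiff) (simp add: fdiff_def)
      qed
      have FD: "obr (F a) (Dm ss) = (\<Sum>i<k. oscale (om a (ss ! i)) (Dm (ss[i := a])))"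
        if "length ss = k" for a ss
        unfolding Dm_def using K k that by (intro obr_top_difference F rel) auto
      \<comment> \<open>Top differences are additive in each direction: the direction put in place
        \<open>i\<close> acts as the point of evaluation of the remaining differences, and
        additivity is the vanishing of a difference of order \<open>k + 1\<close>.\<close>
      have Dm_add: "Dm (rs[i := a + b]) = Dm (rs[i := a]) + Dm (rs[i := b])"
        if rs: "length rs = k" and i: "i < k" for rs i a b
      proof -
        let ?R = "take i rs @ drop (Suc i) rs"
        have R: "Dm (rs[i := x]) = fdiffs ?R F x - fdiffs ?R F 0" for x
        proof -
          have "Dm (rs[i := x]) = fdiffs (x # ?R) F 0"
            unfolding Dm_def using fdiffs_perm[OF replace_perm[of i rs x]] rs i by metis
          then show ?thesis by (simp add: fdiffs_fdiff) (simp add: fdiff_def)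
        qed
        have "fdiffs (a # b # ?R) F 0 = 0" by (rule top) (use rs i in auto)
        then have "fdiffs ?R F (a + b) - fdiffs ?R F a - (fdiffs ?R F b - fdiffs ?R F 0) = 0"
          by (simp add: fdiffs_fdiff) (simp add: fdiff_def algebra_simps)
        then show ?thesis unfolding R by (simp add: algebra_simps)
      qed
      \<comment> \<open>The bracket is a difference of order \<open>k\<close>, in the variable
        \<open>a\<close>, of \<open>\<Sum> om(a, ss ! i) Dm(ss[i := a])\<close>. This is quadratic
        in \<open>a\<close>, and \<open>k \<ge> 3\<close>; here the bound 3 is decisive.\<close>
      have DD: "obr (Dm rs) (Dm ss) = 0" if rs: "length rs = k" and ss: "length ss = k" for rs ss
      proof -
        let ?h = "\<lambda>i a. Dm (ss[i := a])"
        have "obr (Dm rs) (Dm ss) = fdiffs rs (\<lambda>a. obr (F a) (Dm ss)) 0"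
          using fun_cong[OF fdiffs_hom_on[of End "\<lambda>x. obr x (Dm ss)" F rs], of 0]
          by (simp add: dl.G_diff dl.br_diff_left F Dm_End Dm_def[of rs])
        also have "\<dots> = fdiffs rs (\<lambda>a. \<Sum>i<k. oscale (om a (ss ! i)) (?h i a)) 0"
          by (simp only: FD[OF ss])
        also have "\<dots> = (\<Sum>i<k. fdiffs rs (\<lambda>a. oscale (om a (ss ! i)) (?h i a)) 0)"
          by (rule fun_cong[OF fdiffs_sum])
        also have "\<dots> = 0"
        proof (intro sum.neutral ballI)
          fix i assume "i \<in> {..<k}"
          then have i: "i < k" by simp
          have h2: "fdiffs xs (?h i) p = 0" if two: "length xs \<ge> 2" for xs p
          proof -
            obtain x y xs' where xs: "xs = x # y # xs'"
              using two by (cases xs; cases "tl xs") auto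
            have "fdiff x (?h i) = (\<lambda>a. ?h i x)"
              by (simp add: fdiff_def Dm_add[OF ss i])
            then show ?thesis by (simp add: xs fdiff_const fdiffs_zero)
          qed
          have "fdiffs rs (\<lambda>a. oscale (om a (ss ! i)) (?h i a)) 0 = oscale (om 0 (ss ! i)) (fdiffs rs (?h i) 0) +
            (\<Sum>j<length rs. oscale (om (rs ! j) (ss ! i)) (fdiffs (take j rs @ drop (Suc j) rs) (?h i) (0 + rs ! j)))"
            by (rule op.fdiffs_leibniz) (rule om_add_left')
          also have "\<dots> = 0"
          proof -
            have "fdiffs (take j rs @ drop (Suc j) rs) (?h i) p = 0" if "j < length rs" for j p
              by (rule h2) (use that rs k in auto)
            then show ?thesis using h2[of rs] rs k by (simp add: sum.neutral)
          qed
          finally show "fdiffs rs (\<lambda>a. oscale (om a (ss ! i)) (?h i a)) 0 = 0" .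
        qed
        finally show ?thesis .
      qed
      define J where "J = op.span (Dm ` {rs. length rs = k})"
      have JE: "J \<subseteq> End"
        unfolding J_def by (rule op.span_minimal) (use Dm_End subspace_End in auto)
      have comm_r: "obr (Dm rs) x = 0" if "length rs = k" "x \<in> J" for rs x
      proof -
        have "op.subspace {x \<in> End. obr (Dm rs) x = 0}"
          unfolding op.subspace_def
          by (auto simp: obr_zero dl.G0 dl.G_add dl.G_scale dl.br_add_right dl.br_scale_right Dm_End)
        moreover have "Dm ` {rs. length rs = k} \<subseteq> {x \<in> End. obr (Dm rs) x = 0}"
          using DD that Dm_End by auto
        ultimately have "J \<subseteq> {x \<in> End. obr (Dm rs) x = 0}"
          unfolding J_def by (intro op.span_minimal)
        then show ?thesis using that by blast
      qed
      have comm: "obr x x' = 0" if "x \<in> J" "x' \<in> J" for x x'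
      proof -
        have x': "x' \<in> End" using that JE by blast
        have "op.subspace {x \<in> End. obr x x' = 0}"
          unfolding op.subspace_def
          by (auto simp: obr_zero dl.G0 dl.G_add dl.G_scale obr_add_left obr_scale_left x')
        moreover have "Dm ` {rs. length rs = k} \<subseteq> {x \<in> End. obr x x' = 0}"
          using comm_r that Dm_End by auto
        ultimately have "J \<subseteq> {x \<in> End. obr x x' = 0}"
          unfolding J_def by (intro op.span_minimal)
        then show ?thesis using that by blast
      qed
      have JF: "obr x y \<in> J" if x: "x \<in> J" and y: "y \<in> range F" for x y
      proof -
        obtain a where a: "y = F a" using y by blast
        have "op.subspace {x \<in> End. obr x y \<in> J}"
          unfolding op.subspace_def J_def
          by (auto simp: obr_zero dl.G0 dl.G_add dl.G_scale obr_add_left obr_scale_left F a op.span_add op.span_scale op.span_zero)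
        moreover have "Dm ` {rs. length rs = k} \<subseteq> {x \<in> End. obr x y \<in> J}"
        proof clarify
          fix rs :: "(int ^ 'n) list" assume rs: "k = length rs"
          have "obr (Dm rs) y = - (\<Sum>i<k. oscale (om a (rs ! i)) (Dm (rs[i := a])))"
            using FD[of rs a] rs obr_anti[of "Dm rs" y] a by simp
          also have "\<dots> \<in> J"
            unfolding J_def
            by (intro op.span_neg op.span_sum op.span_scale op.span_base imageI) (simp add: rs)
          finally show "Dm rs \<in> End \<and> obr (Dm rs) y \<in> J" using Dm_End by simp
        qed
        ultimately have "J \<subseteq> {x \<in> End. obr x y \<in> J}"
          unfolding J_def by (intro op.span_minimal)
        then show ?thesis using x by blast
      qed
      have Dzero: "Dm rs = 0" if rs: "length rs = k" for rs
      proof (rule symplectic_invariant_zero[OF _ _ _ rs])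
        show "mset rs = mset ss \<Longrightarrow> Dm rs = Dm ss" for rs ss
          unfolding Dm_def using fdiffs_perm by metis
        show "Dm rs = 0" if z: "0 \<in> set rs" for rs
        proof -
          obtain xs ys where xs: "rs = xs @ 0 # ys" using z by (meson split_list)
          have "fdiff 0 G = (\<lambda>q. 0)" for G :: "int ^ 'n \<Rightarrow> 'w \<Rightarrow> 'w" by (simp add: fdiff_def)
          then show ?thesis by (simp add: Dm_def xs fdiffs_append fdiffs_zero)
        qed
        show "0 < k" using k by simp
        fix a and ss :: "(int ^ 'n) list" assume ss: "length ss = k"
        have DJ: "Dm ss \<in> J" unfolding J_def by (rule op.span_base) (use ss in auto)
        have "\<exists>c. \<forall>v\<in>V. Dm ss v = scale c v"
        proof (rule abelian_ideal_scalar[where J = J and Y = "range F", OF V_nonzero _ JE])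
          show "range F \<subseteq> End" using F by blast
          show "obr x x' = 0" if "x \<in> J" "x' \<in> J" for x x' using that by (rule comm)
          show "obr x y \<in> J" if "x \<in> J" "y \<in> range F" for x y using that by (rule JF)
          show "W = {0} \<or> W = V"
            if "subspace W" "W \<subseteq> V" "\<And>y w. y \<in> range F \<Longrightarrow> w \<in> W \<Longrightarrow> y w \<in> W" for W
            using that by (rule irrF)
        qed (rule DJ)
        then obtain c where "\<forall>v\<in>V. Dm ss v = scale c v" by blast
        then have "obr (Dm ss) (F a) = 0" using scalar_bracket Dm_End by blast
        then show "(\<Sum>i<k. oscale (om a (ss ! i)) (Dm (ss[i := a]))) = 0"
          using FD[OF ss, of a] obr_anti[of "Dm ss" "F a"] by simp
      qed
      have "pol UNIV k F"
        unfolding pol_def using base Dzero by (simp add: fun_eq_iff)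
      then show False using Kmin[of k] k by simp
    qed
    then show ?thesis using K pol_mono by blast
  qed
  \<comment> \<open>\<open>F 0\<close> commutes with every \<open>F a\<close> because
    \<open>om 0 a = 0\<close>, so it acts by a scalar \<open>c\<close>. It is then exhibited as a
    non-zero multiple of a commutator with an \<open>F s\<close>, which is impossible in finite
    dimension unless \<open>c = 0\<close>.\<close>
  have "F 0 = 0"
  proof -
    let ?z = "F 0"
    have zc: "obr ?z (F a) = 0" "obr (F a) ?z = 0" for a by (simp_all add: rel dl.om_0)
    have "\<exists>c. \<forall>v\<in>V. ?z v = scale c v"
    proof (rule abelian_ideal_scalar[where J = "{0, ?z}" and Y = "range F", OF V_nonzero])
      show "obr x y \<in> {0, ?z}" if "x \<in> {0, ?z}" "y \<in> range F" for x y
        using that zc F by (auto simp: obr_zero)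
      show "obr x y = 0" if "x \<in> {0, ?z}" "y \<in> {0, ?z}" for x y
        using that zc F by (auto simp: obr_zero dl.G0)
      show "W = {0} \<or> W = V" if "subspace W" "W \<subseteq> V" "\<And>y w. y \<in> range F \<Longrightarrow> w \<in> W \<Longrightarrow> y w \<in> W" for W
        using that by (rule irrF)
    qed (use F dl.G0 in auto)
    then obtain c where c: "\<And>v. v \<in> V \<Longrightarrow> ?z v = scale c v" by blast
    obtain i :: 'n where True by simp
    have "axis i 1 \<noteq> (0 :: int ^ 'n)" by simp
    then obtain s where s: "om (axis i 1) s \<noteq> 0" using om_nondeg by blast
    let ?r = "axis i 1 :: int ^ 'n"
    let ?x = "F ?r - F (- ?r)"
    have xE: "?x \<in> End" using F by (simp add: dl.G_diff)
    have "om (- ?r) s = - om ?r s" using dl.om_diff_left[of 0 ?r s] by (simp add: dl.om_0)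
    then have "obr ?x (F s) = oscale (om ?r s) ((F (?r + s) - F ?r - F s) + (F (- ?r + s) - F (- ?r) - F s))"
      by (simp add: dl.br_diff_left F rel op.scale_right_distrib)
    also have "(F (?r + s) - F ?r - F s) + (F (- ?r + s) - F (- ?r) - F s) = - ?z - ?z"
    proof -
      \<comment> \<open>This third difference is centred so that \<open>F 0\<close> occurs with
        coefficient 2, and all other terms are those of the bracket.\<close>
      have "fdiffs [?r, ?r, s] F (- ?r) = 0"
        using pol3 by (simp add: pol_def fun_eq_iff del: fdiffs_simps)
      then show ?thesis by (simp add: fdiff_def algebra_simps)
    qed
    finally have xs: "obr ?x (F s) = oscale (om ?r s) (- ?z - ?z)" .
    obtain w a where w: "w \<in> V" "w \<noteq> 0" "?x w = scale a w"
      using eigenvector[OF xE subV _ V_nonzero] End_in[OF xE] by blast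
    \<comment> \<open>Chosen to be stable under bracketing with \<open>F s\<close> and to contain
      \<open>?x\<close>: the bracket of a member is a multiple of \<open>F 0\<close>, which is
      scalar on \<open>w\<close> and commutes with \<open>F s\<close>. Lie's lemma then says that
      the eigenvalue of \<open>[?x, F s]\<close> on \<open>w\<close> is 0.\<close>
    define J where "J = {x \<in> End. (\<exists>b. x w = scale b w) \<and> (\<exists>b. obr x (F s) = oscale b ?z)}"
    define lam where "lam x = (SOME b. x w = scale b w)" for x :: "'w \<Rightarrow> 'w"
    have lam: "x w = scale (lam x) w" if "x \<in> J" for x
      unfolding lam_def by (rule someI_ex) (use that in \<open>simp add: J_def\<close>)
    have zJ: "oscale b ?z \<in> J" for b
    proof -
      have "oscale b ?z w = scale (b * c) w" by (simp add: oscale_def c w(1))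
      moreover have "obr (oscale b ?z) (F s) = oscale 0 ?z"
        by (simp add: obr_scale_left F zc)
      ultimately show ?thesis
        unfolding J_def using dl.G_scale[OF F] by blast
    qed
    have "oscale (om ?r s) (- ?z - ?z) = oscale (- 2 * om ?r s) ?z"
    proof
      fix v
      have "scale (- 2 * om ?r s) (?z v) = scale (- om ?r s + - om ?r s) (?z v)" by simp
      then show "oscale (om ?r s) (- ?z - ?z) v = oscale (- 2 * om ?r s) ?z v"
        by (simp only: scale_left_distrib) (simp add: oscale_def scale_right_diff_distrib)
    qed
    then have xs': "obr ?x (F s) = oscale (- 2 * om ?r s) ?z" using xs by simp
    have "lam (obr ?x (F s)) = 0"
    proof (rule weight_bracket_zero[where lam = lam and x = ?x and y = "F s", OF F _ w(1,2)])
      show "J \<subseteq> End" by (auto simp: J_def)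
      show "obr x (F s) \<in> J" if "x \<in> J" for x using that zJ by (auto simp: J_def)
      show "?x \<in> J" unfolding J_def using xE w(3) xs' by blast
    qed (rule lam)
    moreover have "oscale (- 2 * om ?r s) ?z \<in> J" by (rule zJ)
    ultimately have "scale (- 2 * om ?r s) (?z w) = 0"
      using lam[of "obr ?x (F s)"] xs' by (simp add: oscale_def)
    then have "c = 0" using s c w by simp
    then have "?z v = 0" for v using c F[of 0] by (cases "v \<in> V") (simp_all add: End_off)
    then show ?thesis by (simp add: fun_eq_iff)
  qed
  then have "F = X" using FX X_zero by (metis ext)
  then show ?thesis using pol3 by simp
qed

end


section \<open>Laurent polynomials and vector fields\<close>

text \<open>The common pattern behind \<open>partial_deriv\<close>, \<open>bt\<close>,
  \<open>Tm0\<close>, \<open>psi0\<close> and others: a function of index and coefficient, zero at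
  coefficient zero, summed over the support. The sum may then be taken over any larger finite
  set.\<close>

lemma lext_mono:
  assumes "finite K" "Poly_Mapping.keys c \<subseteq> K" "\<And>k. f k 0 = 0"
  shows "(\<Sum>k\<in>Poly_Mapping.keys c. f k (Poly_Mapping.lookup c k)) = (\<Sum>k\<in>K. f k (Poly_Mapping.lookup c k))"
  by (rule sum.mono_neutral_left) (use assms in \<open>auto simp: in_keys_iff\<close>)

lemma lext_add:
  assumes "\<And>k. f k 0 = 0" "\<And>k a b. f k (a + b) = f k a + f k b"
  shows "(\<Sum>k\<in>Poly_Mapping.keys (c + c'). f k (Poly_Mapping.lookup (c + c') k)) =
    (\<Sum>k\<in>Poly_Mapping.keys c. f k (Poly_Mapping.lookup c k)) + (\<Sum>k\<in>Poly_Mapping.keys c'. f k (Poly_Mapping.lookup c' k))"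
proof -
  let ?K = "Poly_Mapping.keys c \<union> Poly_Mapping.keys c'"
  have "Poly_Mapping.keys (c + c') \<subseteq> ?K" by (rule keys_add)
  then have "(\<Sum>k\<in>Poly_Mapping.keys (c + c'). f k (Poly_Mapping.lookup (c + c') k)) =
    (\<Sum>k\<in>?K. f k (Poly_Mapping.lookup (c + c') k))"
    by (intro lext_mono assms) auto
  also have "\<dots> = (\<Sum>k\<in>?K. f k (Poly_Mapping.lookup c k)) + (\<Sum>k\<in>?K. f k (Poly_Mapping.lookup c' k))"
    by (simp add: lookup_add assms sum.distrib)
  also have "\<dots> = (\<Sum>k\<in>Poly_Mapping.keys c. f k (Poly_Mapping.lookup c k)) + (\<Sum>k\<in>Poly_Mapping.keys c'. f k (Poly_Mapping.lookup c' k))"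
    using assms(1) by (subst (1 2) lext_mono[of ?K]) auto
  finally show ?thesis .
qed

lemma keys_lscale: "Poly_Mapping.keys (lscale a c) \<subseteq> Poly_Mapping.keys c"
  by (auto simp: in_keys_iff lookup_lscale)

lemma lscale_eq: "lscale a c = Poly_Mapping.single 0 a * c"
  unfolding lscale_def by (rule mult_map_scale_conv_mult)

lemma lscale_mult_left: "lscale a (c * c') = lscale a c * c'"
  and lscale_mult_right: "lscale a (c * c') = c * lscale a c'"
  by (simp_all add: lscale_eq mult.assoc mult.left_commute)

lemma vector_space_lscale: "vector_space (lscale :: complex \<Rightarrow> 'n::finite laurent \<Rightarrow> _)"
  by unfold_locales (simp_all add: poly_mapping_eq_iff fun_eq_iff lookup_lscale lookup_add algebra_simps)

interpretation lau: vector_space "lscale :: complex \<Rightarrow> 'n::finite laurent \<Rightarrow> _"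
  by (rule vector_space_lscale)

lemma lscale_tmon: "lscale a (tmon r) = Poly_Mapping.single r a"
  by (simp add: lscale_eq tmon_def mult_single)

lemma tmon_mult: "tmon r * tmon q = tmon (r + q)"
  by (simp add: tmon_def mult_single)

lemma tmon_0: "tmon 0 = 1"
  by (simp add: tmon_def)

lemma laurent_expand: "c = (\<Sum>k\<in>Poly_Mapping.keys c. lscale (Poly_Mapping.lookup c k) (tmon k))"
  by (rule poly_mapping_eqI)
    (simp add: lookup_sum lscale_tmon lookup_single when_def sum.delta in_keys_iff cong: if_cong)

lemma laurent_induct:
  assumes "\<And>k. P (tmon k)" "\<And>c c'. P c \<Longrightarrow> P c' \<Longrightarrow> P (c + c')" "\<And>a c. P c \<Longrightarrow> P (lscale a c)"
  shows "P c"
proof -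
  have "P (\<Sum>k\<in>K. lscale (f k) (tmon k))" if "finite K" for K f
    using that
  proof (induction K rule: finite_induct)
    case empty
    have "P (lscale 0 (tmon 0))" by (intro assms)
    then show ?case by simp
  next
    case (insert k K)
    then show ?case by (simp add: assms)
  qed
  then show ?thesis using laurent_expand[of c] by (metis finite_keys)
qed

definition laurent_linear :: "('n::finite laurent \<Rightarrow> 'n laurent) \<Rightarrow> bool" where
  "laurent_linear f \<longleftrightarrow> (\<forall>c c'. f (c + c') = f c + f c') \<and> (\<forall>a c. f (lscale a c) = lscale a (f c))"

lemma laurent_linear_eqI:
  assumes "laurent_linear f" "laurent_linear g" "\<And>k. f (tmon k) = g (tmon k)"
  shows "f c = g c"
  by (induction c rule: laurent_induct) (use assms in \<open>auto simp: laurent_linear_def\<close>)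

lemma partial_deriv_add: "partial_deriv i (f + g) = partial_deriv i f + partial_deriv i g"
  unfolding partial_deriv_def
  by (rule lext_add[where f = "\<lambda>k a. Poly_Mapping.single (k - axis i 1) (of_int (k $ i) * a)"])
    (simp_all add: distrib_left single_add)

lemma partial_deriv_lscale: "partial_deriv i (lscale a f) = lscale a (partial_deriv i f)"
proof -
  have "partial_deriv i (lscale a f) = (\<Sum>k\<in>Poly_Mapping.keys f.
        Poly_Mapping.single (k - axis i 1) (of_int (k $ i) * Poly_Mapping.lookup (lscale a f) k))"
    unfolding partial_deriv_def
    by (rule lext_mono[where f = "\<lambda>k a. Poly_Mapping.single (k - axis i 1) (of_int (k $ i) * a)"])
      (simp_all add: keys_lscale)
  also have "\<dots> = lscale a (partial_deriv i f)"
    by (simp add: partial_deriv_def lau.scale_sum_right lookup_lscale lscale_tmon[symmetric] mult.left_commute)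
  finally show ?thesis .
qed

lemma partial_deriv_tmon: "partial_deriv i (tmon k) = lscale (of_int (k $ i)) (tmon (k - axis i 1))"
  by (simp add: partial_deriv_def tmon_def lscale_tmon[unfolded tmon_def])

lemma D_linear: "laurent_linear (D u r)"
  unfolding laurent_linear_def
  by (simp add: D_def euler_d_def partial_deriv_add partial_deriv_lscale distrib_left lscale_mult_right[symmetric]
      lau.scale_right_distrib sum.distrib lau.scale_sum_right mult.commute)

lemma D_add: "D u r (c + c') = D u r c + D u r c'" and D_lscale: "D u r (lscale a c) = lscale a (D u r c)"
  using D_linear[of u r] by (auto simp: laurent_linear_def)

lemma D_tmon: "D u r (tmon k) = lscale (bform u (cvec k)) (tmon (k + r))"
proof -
  have "euler_d i (tmon k) = lscale (of_int (k $ i)) (tmon k)" for i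
    by (simp add: euler_d_def partial_deriv_tmon lscale_mult_right[symmetric] tmon_mult)
  then show ?thesis
    by (simp add: D_def bform_def cvec_def lscale_mult_right[symmetric] tmon_mult lau.scale_sum_left add.commute)
qed

lemma bform_simps: "bform (u + u') v = bform u v + bform u' v" "bform (u - u') v = bform u v - bform u' v"
  "bform u (v + v') = bform u v + bform u v'" "bform u (v - v') = bform u v - bform u v'"
  "bform (- u) v = - bform u v" "bform u (- v) = - bform u v"
  "bform (c *s u) v = c * bform u v" "bform u (c *s v) = c * bform u v" "bform 0 v = 0" "bform u 0 = 0"
  by (simp_all add: bform_def distrib_right distrib_left sum.distrib left_diff_distrib right_diff_distrib
      sum_subtractf sum_negf sum_distrib_left mult.assoc mult.left_commute)

lemma bform_commute: "bform u v = bform v u"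
  by (simp add: bform_def mult.commute)

lemma bform_transpose: "bform (A *v u) v = bform u (transpose A *v v)"
proof -
  have "bform (A *v u) v = (\<Sum>i\<in>UNIV. \<Sum>j\<in>UNIV. A $ i $ j * u $ j * v $ i)"
    by (simp add: bform_def matrix_vector_mult_def sum_distrib_right)
  also have "\<dots> = (\<Sum>j\<in>UNIV. \<Sum>i\<in>UNIV. A $ i $ j * u $ j * v $ i)" by (rule sum.swap)
  also have "\<dots> = bform u (transpose A *v v)"
    by (simp add: bform_def matrix_vector_mult_def transpose_def sum_distrib_left mult.assoc mult.left_commute)
  finally show ?thesis .
qed

lemma bform_axis: "bform (axis i 1) v = v $ i" "bform v (axis i 1) = v $ i"
  by (simp_all add: bform_def axis_def if_distrib[of "\<lambda>x. x * _"] if_distrib[of "\<lambda>x. _ * x"] cong: if_cong)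

lemma cvec_simps: "cvec (r + q) = cvec r + cvec q" "cvec (r - q) = cvec r - cvec q" "cvec (- r) = - cvec r"
  "cvec 0 = 0" "cvec (axis i 1) = axis i 1" "cvec (k *s r) = of_int k *s cvec r"
  by (simp_all add: cvec_def vec_eq_iff axis_def)

lemma cvec_inj: "cvec r = cvec q \<longleftrightarrow> r = q"
  by (simp add: cvec_def vec_eq_iff)

lemma D_add_left: "D (u + u') r f = D u r f + D u' r f"
  by (rule laurent_linear_eqI[where f = "D (u + u') r" and g = "\<lambda>f. D u r f + D u' r f"])
    (auto simp: laurent_linear_def D_add D_lscale D_tmon bform_simps lau.scale_left_distrib lau.scale_right_distrib)

lemma D_scale_left: "D (c *s u) r f = lscale c (D u r f)"
  by (rule laurent_linear_eqI[where f = "D (c *s u) r" and g = "\<lambda>f. lscale c (D u r f)"])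
    (auto simp: laurent_linear_def D_add D_lscale D_tmon bform_simps lau.scale_right_distrib mult.commute)

lemma D_zero: "D 0 r = (\<lambda>f. 0)"
  using D_scale_left[of 0 0 r] by (simp add: fun_eq_iff)

lemma D_leibniz: "D u r (f * g) = D u r f * g + f * D u r g"
proof -
  have mono: "D u r (f * tmon k) = D u r f * tmon k + f * D u r (tmon k)" for k
    by (rule laurent_linear_eqI[where f = "\<lambda>f. D u r (f * tmon k)" and g = "\<lambda>f. D u r f * tmon k + f * D u r (tmon k)"])
      (auto simp: laurent_linear_def distrib_right D_add D_lscale lau.scale_right_distrib lscale_mult_left[symmetric]
        D_tmon tmon_mult cvec_simps bform_simps lau.scale_left_distrib lscale_mult_right[symmetric] add_ac)
  show ?thesis
    by (rule laurent_linear_eqI[where f = "\<lambda>g. D u r (f * g)" and g = "\<lambda>g. D u r f * g + f * D u r g"])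
      (auto simp: mono laurent_linear_def distrib_left D_add D_lscale lau.scale_right_distrib lscale_mult_right[symmetric])
qed

lemma D_der: "D u r \<in> lcarrier der_alg"
  using D_linear[of u r] D_leibniz[of u r] by (simp add: der_alg_def laurent_linear_def)

lemma D_bracket: "lbr der_alg (D u r) (D v q) =
  ladd der_alg (lsmult der_alg (bform u (cvec q)) (D v (r + q))) (lsmult der_alg (- bform v (cvec r)) (D u (r + q)))"
proof
  fix f
  let ?r = "\<lambda>f. lscale (bform u (cvec q)) (D v (r + q) f) + lscale (- bform v (cvec r)) (D u (r + q) f)"
  have "D u r (D v q f) - D v q (D u r f) = ?r f"
  proof (rule laurent_linear_eqI[where f = "\<lambda>f. D u r (D v q f) - D v q (D u r f)" and g = ?r])
    show "laurent_linear (\<lambda>f. D u r (D v q f) - D v q (D u r f))"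
      by (simp add: laurent_linear_def D_add D_lscale lau.scale_right_diff_distrib)
    show "laurent_linear ?r"
      by (simp add: laurent_linear_def D_add D_lscale lau.scale_right_distrib lau.scale_right_diff_distrib lau.scale_left_commute mult.commute)
    show "D u r (D v q (tmon k)) - D v q (D u r (tmon k)) = ?r (tmon k)" for k
      by (rule poly_mapping_eqI)
        (simp add: D_tmon D_lscale cvec_simps bform_simps lookup_minus lookup_add lookup_lscale algebra_simps)
  qed
  then show "lbr der_alg (D u r) (D v q) f = ladd der_alg (lsmult der_alg (bform u (cvec q)) (D v (r + q)))
    (lsmult der_alg (- bform v (cvec r)) (D u (r + q))) f"
    by (simp add: der_alg_def)
qed

section \<open>The form (Br|q) and the brackets of the generators of \<open>ham B\<close>\<close>

abbreviation om :: "complex ^ 'n ^ 'n::finite \<Rightarrow> int ^ 'n \<Rightarrow> int ^ 'n \<Rightarrow> complex" where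
  "om B r q \<equiv> bform (B *v cvec r) (cvec q)"

lemma uminus_mult_vec: "(- A) *v x = - (A *v x)" and mult_uminus_vec: "A *v (- x) = - (A *v x)"
  for A :: "complex ^ 'n ^ 'm"
  by (simp_all add: vec_eq_iff matrix_vector_mult_def sum_negf)

lemma om_skew: "transpose B = - B \<Longrightarrow> om B r q = - om B q r"
  by (simp add: bform_transpose bform_commute[of "cvec r"] uminus_mult_vec bform_simps)

lemma om_simps: "om B (a + b) c = om B a c + om B b c" "om B c (a + b) = om B c a + om B c b"
  "om B (- a) c = - om B a c" "om B c (- a) = - om B c a" "om B 0 a = 0" "om B a 0 = 0"
  "om B (a - b) c = om B a c - om B b c" "om B c (a - b) = om B c a - om B c b"
  by (simp_all add: cvec_simps matrix_vector_right_distrib bform_simps matrix_vector_mult_diff_distrib mult_uminus_vec)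

lemma DB_tmon: "DB B r (tmon k) = lscale (om B r k) (tmon (k + r))"
  by (simp add: DB_def D_tmon)

lemma der_ops [simp]: "lzero der_alg = (\<lambda>f. 0)" "ladd der_alg = (\<lambda>X Y f. X f + Y f)"
  "lsmult der_alg = (\<lambda>c X f. lscale c (X f))" "lbr der_alg = (\<lambda>X Y f. X (Y f) - Y (X f))"
  by (simp_all add: der_alg_def)

lemma ham_ops [simp]: "lzero (ham B) = (\<lambda>f. 0)" "ladd (ham B) = (\<lambda>X Y f. X f + Y f)"
  "lsmult (ham B) = (\<lambda>c X f. lscale c (X f))" "lbr (ham B) = (\<lambda>X Y f. X (Y f) - Y (X f))"
  by (simp_all add: ham_def lie_restrict_def)

lemma lcarrier_ham: "lcarrier (ham B) = lspan der_alg ({DB B r | r. r \<noteq> 0} \<union> {D u 0 | u. True})"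
  by (simp add: ham_def lie_restrict_def)

lemma ham_zero: "(\<lambda>f. 0) \<in> lcarrier (ham B)"
  using lspan.zero[of der_alg] by (simp add: lcarrier_ham)

lemma ham_D0: "D u 0 \<in> lcarrier (ham B)"
  unfolding lcarrier_ham by (rule lspan.base) blast

text \<open>The excluded index 0 is harmless, since \<open>D(B0, 0)\<close> is the zero field; this
  avoids case distinctions on \<open>r + q = 0\<close>.\<close>

lemma ham_DB: "DB B r \<in> lcarrier (ham B)"
proof (cases "r = 0")
  case True
  then have "DB B r = (\<lambda>f. 0)" by (simp add: DB_def cvec_simps D_zero)
  then show ?thesis using ham_zero by metis
next
  case False
  then show ?thesis unfolding lcarrier_ham by (intro lspan.base) blast
qed

lemma ham_add: "X \<in> lcarrier (ham B) \<Longrightarrow> Y \<in> lcarrier (ham B) \<Longrightarrow> (\<lambda>f. X f + Y f) \<in> lcarrier (ham B)"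
  using lspan.add[of X der_alg _ Y] by (simp add: lcarrier_ham)

lemma ham_scale: "X \<in> lcarrier (ham B) \<Longrightarrow> (\<lambda>f. lscale c (X f)) \<in> lcarrier (ham B)"
  using lspan.smult[of X der_alg _ c] by (simp add: lcarrier_ham)

lemma ham_induct [consumes 1, case_names zero DB D0 add scale]:
  assumes "X \<in> lcarrier (ham B)" "P (\<lambda>f. 0)" "\<And>r. P (DB B r)" "\<And>u. P (D u 0)"
    and "\<And>X Y. X \<in> lcarrier (ham B) \<Longrightarrow> P X \<Longrightarrow> Y \<in> lcarrier (ham B) \<Longrightarrow> P Y \<Longrightarrow> P (\<lambda>f. X f + Y f)"
    and "\<And>c X. X \<in> lcarrier (ham B) \<Longrightarrow> P X \<Longrightarrow> P (\<lambda>f. lscale c (X f))"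
  shows "P X"
  using assms(1) unfolding lcarrier_ham
proof (induction rule: lspan.induct)
  case zero
  then show ?case using assms(2) by simp
next
  case (base x)
  then show ?case using assms(3,4) by auto
next
  case (add x y)
  then show ?case using assms(5)[of x y] by (simp add: lcarrier_ham)
next
  case (smult x c)
  then show ?case using assms(6)[of x c] by (simp add: lcarrier_ham)
qed

lemma ham_der: "X \<in> lcarrier (ham B) \<Longrightarrow> X \<in> lcarrier der_alg"
proof (induction rule: ham_induct)
  case (DB r)
  then show ?case by (simp add: DB_def D_der)
next
  case (D0 u)
  then show ?case by (rule D_der)
qed (auto simp: der_alg_def lau.scale_right_distrib algebra_simps lscale_mult_left[symmetric] lscale_mult_right[symmetric])

lemma ham_linear:
  assumes "X \<in> lcarrier (ham B)"
  shows "X (f + g) = X f + X g" "X (lscale c f) = lscale c (X f)" "X (f * g) = X f * g + f * X g"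
    "X (f - g) = X f - X g" "X 0 = 0"
proof -
  show a: "X (f + g) = X f + X g" and "X (lscale c f) = lscale c (X f)" "X (f * g) = X f * g + f * X g" for f g
    using ham_der[OF assms] by (auto simp: der_alg_def)
  show "X (f - g) = X f - X g" using a[of "f - g" g] by simp
  show "X 0 = 0" using a[of 0 0] by simp
qed

lemma DB_bracket:
  assumes "transpose B = - B"
  shows "(\<lambda>f. DB B r (DB B q f) - DB B q (DB B r f)) = (\<lambda>f. lscale (om B r q) (DB B (r + q) f))"
  using D_bracket[of "B *v cvec r" r "B *v cvec q" q] om_skew[OF assms, of q r]
  by (simp add: DB_def fun_eq_iff cvec_simps matrix_vector_right_distrib D_add_left lau.scale_right_distrib add.commute)

lemma D0_DB_bracket: "(\<lambda>f. D u 0 (DB B q f) - DB B q (D u 0 f)) = (\<lambda>f. lscale (bform u (cvec q)) (DB B q f))"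
  using D_bracket[of u 0 "B *v cvec q" q] by (simp add: DB_def fun_eq_iff cvec_simps bform_simps)

lemma D0_bracket: "(\<lambda>f. D u 0 (D v 0 f) - D v 0 (D u 0 f)) = (\<lambda>f. 0)"
  using D_bracket[of u 0 v 0] by (simp add: fun_eq_iff cvec_simps bform_simps)

text \<open>Brackets of generators are multiples of generators; bilinearity is used first in the
  second argument, with \<open>X\<close> a generator, and then in the first.\<close>

lemma ham_bracket:
  assumes B: "transpose B = - B" and X: "X \<in> lcarrier (ham B)" and Y: "Y \<in> lcarrier (ham B)"
  shows "(\<lambda>f. X (Y f) - Y (X f)) \<in> lcarrier (ham B)"
proof -
  have neg: "(\<lambda>f. Y (Z f) - Z (Y f)) \<in> lcarrier (ham B)"
    if "(\<lambda>f. Z (Y f) - Y (Z f)) \<in> lcarrier (ham B)" for Z Y :: "'a vfield"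
    using ham_scale[OF that, of "-1"] by simp
  have sum: "(\<lambda>f. (X f + X' f) - (Y f + Y' f)) \<in> lcarrier (ham B)"
    if "(\<lambda>f. X f - Y f) \<in> lcarrier (ham B)" "(\<lambda>f. X' f - Y' f) \<in> lcarrier (ham B)" for X X' Y Y' :: "'a vfield"
    using ham_add[OF that] by (simp add: algebra_simps)
  have gen: "(\<lambda>f. Z (Y f) - Y (Z f)) \<in> lcarrier (ham B)"
    if Z: "Z \<in> lcarrier (ham B)" and zg: "\<And>r. (\<lambda>f. Z (DB B r f) - DB B r (Z f)) \<in> lcarrier (ham B)"
      "\<And>u. (\<lambda>f. Z (D u 0 f) - D u 0 (Z f)) \<in> lcarrier (ham B)" for Z
    using Y
  proof (induction rule: ham_induct)
    case zero
    then show ?case using Z by (simp add: ham_linear ham_zero)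
  next
    case (add X Y)
    then show ?case using sum[OF add.IH] by (simp add: ham_linear(1)[OF Z])
  next
    case (scale c X)
    then show ?case using ham_scale[OF scale.IH, of c] by (simp add: ham_linear(2)[OF Z] lau.scale_right_diff_distrib)
  qed (use zg in auto)
  show ?thesis
    using X
  proof (induction rule: ham_induct)
    case zero
    then show ?case using Y by (simp add: ham_linear ham_zero)
  next
    case (DB r)
    show ?case
    proof (rule gen[OF ham_DB])
      show "(\<lambda>f. DB B r (DB B q f) - DB B q (DB B r f)) \<in> lcarrier (ham B)" for q
        unfolding DB_bracket[OF B] by (intro ham_scale ham_DB)
      show "(\<lambda>f. DB B r (D u 0 f) - D u 0 (DB B r f)) \<in> lcarrier (ham B)" for u
        by (rule neg, unfold D0_DB_bracket) (intro ham_scale ham_DB)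
    qed
  next
    case (D0 u)
    show ?case
    proof (rule gen[OF ham_D0])
      show "(\<lambda>f. D u 0 (DB B q f) - DB B q (D u 0 f)) \<in> lcarrier (ham B)" for q
        unfolding D0_DB_bracket by (intro ham_scale ham_DB)
      show "(\<lambda>f. D u 0 (D v 0 f) - D v 0 (D u 0 f)) \<in> lcarrier (ham B)" for v
        unfolding D0_bracket by (rule ham_zero)
    qed
  next
    case (add X Z)
    then show ?case using sum[OF add.IH] by (simp add: ham_linear(1)[OF Y])
  next
    case (scale c X)
    then show ?case using ham_scale[OF scale.IH, of c] by (simp add: ham_linear(2)[OF Y] lau.scale_right_diff_distrib)
  qed
qed


section \<open>Relations in the jet algebra\<close>

lemma free_alg_simps [simp]: "mult (free_alg X) = (*)" "one (free_alg X) = 1" "zero (free_alg X) = 0"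
  "add (free_alg X) = (+)"
  by (simp_all add: free_alg_def)

lemma free_alg_carrier: "p \<in> carrier (free_alg X) \<longleftrightarrow> (\<forall>w\<in>Poly_Mapping.keys p. set (letters w) \<subseteq> X)"
  by (simp add: free_alg_def)

lemma free_alg_add: "p \<in> carrier (free_alg X) \<Longrightarrow> q \<in> carrier (free_alg X) \<Longrightarrow> p + q \<in> carrier (free_alg X)"
  using keys_add[of p q] by (auto simp: free_alg_carrier)

lemma free_alg_mult: "p \<in> carrier (free_alg X) \<Longrightarrow> q \<in> carrier (free_alg X) \<Longrightarrow> p * q \<in> carrier (free_alg X)"
  using keys_mult[of p q] by (fastforce simp: free_alg_carrier plus_fmon_def)

lemma free_alg_uminus: "p \<in> carrier (free_alg X) \<Longrightarrow> - p \<in> carrier (free_alg X)"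
  by (auto simp: free_alg_carrier in_keys_iff)

lemma free_alg_minus: "p \<in> carrier (free_alg X) \<Longrightarrow> q \<in> carrier (free_alg X) \<Longrightarrow> p - q \<in> carrier (free_alg X)"
  using free_alg_add[OF _ free_alg_uminus, of p X q] by simp

lemma free_alg_fconst: "fconst c \<in> carrier (free_alg X)"
  by (auto simp: free_alg_carrier fconst_def zero_fmon_def split: if_splits)

lemma free_alg_0: "0 \<in> carrier (free_alg X)" and free_alg_1: "1 \<in> carrier (free_alg X)"
  using free_alg_fconst[of 0 X] free_alg_fconst[of 1 X] by (simp_all add: fconst_def)

lemma free_alg_gen: "x \<in> X \<Longrightarrow> gen x \<in> carrier (free_alg X)"
  by (auto simp: free_alg_carrier gen_def)

lemmas free_alg_closed = free_alg_add free_alg_mult free_alg_uminus free_alg_minus free_alg_fconst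
  free_alg_0 free_alg_1 free_alg_gen

lemma free_alg_sum: "(\<And>i. i \<in> I \<Longrightarrow> f i \<in> carrier (free_alg X)) \<Longrightarrow> sum f I \<in> carrier (free_alg X)"
  by (induction I rule: infinite_finite_induct) (auto simp: free_alg_closed)

lemma ring_free_alg: "ring (free_alg X)"
proof (rule ringI)
  show "abelian_group (free_alg X)"
    by (rule abelian_groupI)
      (auto simp: free_alg_closed add_ac intro: bexI[of _ "- _"] free_alg_uminus)
  show "Group.monoid (free_alg X)"
    by (rule monoidI) (auto simp: free_alg_closed mult.assoc)
qed (auto simp: distrib_left distrib_right)

lemma free_alg_a_minus:
  assumes "p \<in> carrier (free_alg X)" "q \<in> carrier (free_alg X)"
  shows "p \<ominus>\<^bsub>free_alg X\<^esub> q = p - q"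
proof -
  interpret ring "free_alg X" by (rule ring_free_alg)
  have "\<ominus>\<^bsub>free_alg X\<^esub> q = - q"
    by (rule minus_equality) (use assms in \<open>auto simp: free_alg_closed\<close>)
  then show ?thesis by (simp add: a_minus_def)
qed

lemma free_alg_expand: "p = (\<Sum>w\<in>Poly_Mapping.keys p. Poly_Mapping.single w (Poly_Mapping.lookup p w))"
  by (rule poly_mapping_eqI) (simp add: lookup_sum lookup_single when_def sum.delta in_keys_iff cong: if_cong)

lemma fconst_commute: "fconst c * p = p * fconst (c::complex)"
proof -
  have "fconst c * p = (\<Sum>w\<in>Poly_Mapping.keys p. fconst c * Poly_Mapping.single w (Poly_Mapping.lookup p w))"
    by (subst free_alg_expand[of p]) (simp add: sum_distrib_left)
  also have "\<dots> = (\<Sum>w\<in>Poly_Mapping.keys p. Poly_Mapping.single w (Poly_Mapping.lookup p w) * fconst c)"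
    by (simp add: fconst_def mult_single mult.commute)
  also have "\<dots> = p * fconst c"
    by (subst (3) free_alg_expand[of p]) (simp add: sum_distrib_right)
  finally show ?thesis .
qed

lemma fconst_left: "p * (fconst c * q) = fconst (c::complex) * (p * q)"
  by (metis fconst_commute mult.assoc)

lemma fconst_simps: "fconst (a + b) = fconst a + fconst b" "fconst (a * b) = fconst a * fconst b"
  "fconst (- a) = - fconst a" "fconst 0 = 0" "fconst 1 = 1"
  by (simp_all add: fconst_def single_add mult_single single_uminus)

lemma quotient_hom:
  assumes "ring R" "ideal I R"
  shows "(+>\<^bsub>R\<^esub>) I \<in> ring_hom R (R Quot I)" "carrier (R Quot I) = (\<lambda>x. I +>\<^bsub>R\<^esub> x) ` carrier R"
    "ring (R Quot I)"
proof -
  interpret ideal I R by fact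
  show "(+>\<^bsub>R\<^esub>) I \<in> ring_hom R (R Quot I)" by (rule rcos_ring_hom)
  show "carrier (R Quot I) = (\<lambda>x. I +>\<^bsub>R\<^esub> x) ` carrier R"
    by (auto simp: FactRing_def A_RCOSETS_def')
  show "ring (R Quot I)" by (rule quotient_is_ring)
qed

lemma ham_semi_simps: "lcarrier (ham_semi B) = lcarrier (ham B) \<times> UNIV" "lzero (ham_semi B) = (\<lambda>f. 0, 0)"
  "ladd (ham_semi B) (X, f) (Y, g) = (\<lambda>h. X h + Y h, f + g)"
  "lsmult (ham_semi B) c (X, f) = (\<lambda>h. lscale c (X h), lscale c f)"
  "lbr (ham_semi B) (X, f) (Y, g) = (\<lambda>h. X (Y h) - Y (X h), X g - Y f)"
  by (simp_all add: ham_semi_def)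

locale skew_form =
  fixes B :: "complex ^ 'n ^ 'n::finite"
  assumes skew: "transpose B = - B"
begin

abbreviation "Ls \<equiv> lcarrier (ham_semi B)"
abbreviation "FA \<equiv> carrier (free_alg Ls)"
abbreviation "ev \<equiv> jet_class B"

definition uea_gens where
  "uea_gens = {gen (ladd (ham_semi B) x y) - (gen x + gen y) | x y. x \<in> Ls \<and> y \<in> Ls} \<union>
      {gen (lsmult (ham_semi B) c x) - fconst c * gen x | c x. x \<in> Ls} \<union>
      {gen x * gen y - gen y * gen x - gen (lbr (ham_semi B) x y) | x y. x \<in> Ls \<and> y \<in> Ls}"

text \<open>Lifts of the second set of relators from the enveloping algebra to the free algebra.
  With them the iterated quotient becomes a single evaluation \<open>ev\<close> of the free
  algebra.\<close>

definition jet_gens where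
  "jet_gens = {gen (lzero der_alg, tmon r) * gen (lzero der_alg, tmon q) - gen (lzero der_alg, tmon (r + q)) | r q. True} \<union>
    {gen (lzero der_alg, tmon 0) - 1}"

lemma Ls_ops: "x \<in> Ls \<Longrightarrow> y \<in> Ls \<Longrightarrow> ladd (ham_semi B) x y \<in> Ls" "x \<in> Ls \<Longrightarrow> lsmult (ham_semi B) c x \<in> Ls"
  "x \<in> Ls \<Longrightarrow> y \<in> Ls \<Longrightarrow> lbr (ham_semi B) x y \<in> Ls"
  by (cases x; cases y; simp add: ham_semi_simps ham_add ham_scale ham_bracket[OF skew])+

lemma uea_gens_FA: "uea_gens \<subseteq> FA"
  by (auto simp: uea_gens_def simp del: split_paired_All intro!: free_alg_closed Ls_ops)

lemma fun_Ls: "((\<lambda>f. 0), f) \<in> Ls" "(lzero der_alg, f) \<in> Ls" and vf_Ls: "X \<in> lcarrier (ham B) \<Longrightarrow> (X, f) \<in> Ls"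
  by (simp_all add: ham_semi_simps ham_zero)

lemma jet_gens_FA: "jet_gens \<subseteq> FA"
  by (auto simp: jet_gens_def intro!: free_alg_closed fun_Ls)

lemma uea_ideal_eq: "uea_ideal (ham_semi B) = Idl\<^bsub>free_alg Ls\<^esub> uea_gens"
  by (simp add: uea_ideal_def uea_gens_def)

lemma ideal_uea: "ideal (uea_ideal (ham_semi B)) (free_alg Ls)"
  unfolding uea_ideal_eq by (rule ring.genideal_ideal[OF ring_free_alg uea_gens_FA])

lemma uea_class_hom: "uea_class (ham_semi B) \<in> ring_hom (free_alg Ls) (uea (ham_semi B))"
  and uea_carrier: "carrier (uea (ham_semi B)) = uea_class (ham_semi B) ` FA"
  and ring_uea: "ring (uea (ham_semi B))"
  using quotient_hom[OF ring_free_alg ideal_uea]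
  by (simp_all add: uea_def uea_class_def[abs_def])

lemma hom_minus:
  assumes "ring R" "ring Q" "h \<in> ring_hom R Q" "x \<in> carrier R" "y \<in> carrier R"
  shows "h (x \<ominus>\<^bsub>R\<^esub> y) = h x \<ominus>\<^bsub>Q\<^esub> h y" "h \<zero>\<^bsub>R\<^esub> = \<zero>\<^bsub>Q\<^esub>"
proof -
  interpret ring_hom_ring R Q h
    by (rule ring_hom_ringI2) (use assms in auto)
  show "h (x \<ominus>\<^bsub>R\<^esub> y) = h x \<ominus>\<^bsub>Q\<^esub> h y" "h \<zero>\<^bsub>R\<^esub> = \<zero>\<^bsub>Q\<^esub>"
    using assms by (simp_all add: a_minus_def)
qed

lemma jet_ideal_eq: "jet_ideal B = Idl\<^bsub>uea (ham_semi B)\<^esub> (uea_class (ham_semi B) ` jet_gens)"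
proof -
  let ?u = "uea_class (ham_semi B)" and ?U = "uea (ham_semi B)"
  have minus: "?u p \<ominus>\<^bsub>?U\<^esub> ?u q = ?u (p - q)" if "p \<in> FA" "q \<in> FA" for p q
    using hom_minus(1)[OF ring_free_alg ring_uea uea_class_hom that] that by (simp add: free_alg_a_minus)
  have mult: "?u p \<otimes>\<^bsub>?U\<^esub> ?u q = ?u (p * q)" if "p \<in> FA" "q \<in> FA" for p q
    using ring_hom_mult[OF uea_class_hom that] by simp
  have one: "\<one>\<^bsub>?U\<^esub> = ?u 1" using ring_hom_one[OF uea_class_hom] by simp
  have g: "gen (lzero der_alg, f) \<in> FA" for f by (intro free_alg_closed fun_Ls)
  show ?thesis
    unfolding jet_ideal_def jet_gens_def
    by (simp only: one minus mult g free_alg_closed image_Un image_insert image_empty)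
      (rule arg_cong[where f = "\<lambda>S. Idl\<^bsub>?U\<^esub> S"], auto)
qed

lemma ideal_jet: "ideal (jet_ideal B) (uea (ham_semi B))"
  unfolding jet_ideal_eq
  by (rule ring.genideal_ideal[OF ring_uea]) (use jet_gens_FA uea_carrier in auto)

lemma jet_quot_hom: "(+>\<^bsub>uea (ham_semi B)\<^esub>) (jet_ideal B) \<in> ring_hom (uea (ham_semi B)) (jet_alg B)"
  and jet_quot_carrier: "carrier (jet_alg B) = (\<lambda>x. jet_ideal B +>\<^bsub>uea (ham_semi B)\<^esub> x) ` carrier (uea (ham_semi B))"
  and ring_jet: "ring (jet_alg B)"
  using quotient_hom[OF ring_uea ideal_jet] by (simp_all add: jet_alg_def)

lemma ev_hom: "ev \<in> ring_hom (free_alg Ls) (jet_alg B)"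
proof -
  have "(\<lambda>x. jet_ideal B +>\<^bsub>uea (ham_semi B)\<^esub> x) \<circ> uea_class (ham_semi B) \<in> ring_hom (free_alg Ls) (jet_alg B)"
    by (rule ring_hom_trans[OF uea_class_hom jet_quot_hom])
  then show ?thesis by (simp add: jet_class_def[abs_def] comp_def)
qed

lemma jet_carrier: "carrier (jet_alg B) = ev ` FA"
  by (auto simp: jet_quot_carrier uea_carrier jet_class_def)

lemma ev_add: "p \<in> FA \<Longrightarrow> q \<in> FA \<Longrightarrow> ev (p + q) = ev p \<oplus>\<^bsub>jet_alg B\<^esub> ev q"
  and ev_mult: "p \<in> FA \<Longrightarrow> q \<in> FA \<Longrightarrow> ev (p * q) = ev p \<otimes>\<^bsub>jet_alg B\<^esub> ev q"
  using ring_hom_add[OF ev_hom] ring_hom_mult[OF ev_hom] by simp_all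

lemma ev_minus: "p \<in> FA \<Longrightarrow> q \<in> FA \<Longrightarrow> ev (p - q) = ev p \<ominus>\<^bsub>jet_alg B\<^esub> ev q"
  using hom_minus(1)[OF ring_free_alg ring_jet ev_hom] by (simp add: free_alg_a_minus)

lemma ev_zero: "ev 0 = \<zero>\<^bsub>jet_alg B\<^esub>"
  using hom_minus(2)[OF ring_free_alg ring_jet ev_hom free_alg_0 free_alg_0] by simp

lemma ev_eq_iff: "p \<in> FA \<Longrightarrow> q \<in> FA \<Longrightarrow> ev p = ev q \<longleftrightarrow> ev (p - q) = ev 0"
proof -
  assume pq: "p \<in> FA" "q \<in> FA"
  interpret ring "jet_alg B" by (rule ring_jet)
  have "ev p \<in> carrier (jet_alg B)" "ev q \<in> carrier (jet_alg B)" using pq by (auto simp: jet_carrier)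
  then have "ev p = ev q" if "ev p \<ominus>\<^bsub>jet_alg B\<^esub> ev q = \<zero>\<^bsub>jet_alg B\<^esub>"
    using that minus_equality[of "ev p" "\<ominus>\<^bsub>jet_alg B\<^esub> ev q"] by (simp add: a_minus_def)
  then show ?thesis
    using pq by (auto simp: ev_minus ev_zero a_minus_def r_neg jet_carrier)
qed

text \<open>Congruence modulo all relators. Calculations stay in the free algebra, whose elements
  obey the ring laws of a type, instead of in a quotient with an explicit carrier; membership is
  part of the relation, as \<open>ev\<close> is a homomorphism only there.\<close>

definition eqv (infix "\<doteq>" 50) where
  "p \<doteq> q \<longleftrightarrow> p \<in> FA \<and> q \<in> FA \<and> ev p = ev q"

lemma eqv_refl: "p \<in> FA \<Longrightarrow> p \<doteq> p"
  by (simp add: eqv_def)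

lemma eqv_trans [trans]: "p \<doteq> q \<Longrightarrow> q \<doteq> r \<Longrightarrow> p \<doteq> r"
  by (simp add: eqv_def)

lemma eqv_sym: "p \<doteq> q \<Longrightarrow> q \<doteq> p"
  by (simp add: eqv_def)

lemma eqv_add: "p \<doteq> q \<Longrightarrow> p' \<doteq> q' \<Longrightarrow> p + p' \<doteq> q + q'"
  and eqv_minus: "p \<doteq> q \<Longrightarrow> p' \<doteq> q' \<Longrightarrow> p - p' \<doteq> q - q'"
  and eqv_mult: "p \<doteq> q \<Longrightarrow> p' \<doteq> q' \<Longrightarrow> p * p' \<doteq> q * q'"
  by (simp_all add: eqv_def free_alg_closed ev_add ev_mult ev_minus)

lemma eqv_0: "p \<doteq> q \<longleftrightarrow> p \<in> FA \<and> q \<in> FA \<and> p - q \<doteq> 0"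
  by (auto simp: eqv_def ev_eq_iff[symmetric] free_alg_closed)
    (metis ev_eq_iff)+

lemma eqv_uea_gen:
  assumes "p \<in> uea_gens"
  shows "p \<doteq> 0"
proof -
  let ?u = "uea_class (ham_semi B)"
  have p: "p \<in> FA" using assms uea_gens_FA by blast
  have "p \<in> uea_ideal (ham_semi B)"
    unfolding uea_ideal_eq using ring.genideal_self[OF ring_free_alg uea_gens_FA] assms by blast
  then have "p \<ominus>\<^bsub>free_alg Ls\<^esub> 0 \<in> uea_ideal (ham_semi B)"
    using p by (simp add: free_alg_a_minus free_alg_closed)
  then have "?u p = ?u 0"
    unfolding uea_class_def
    using ring.quotient_eq_iff_same_a_r_cos[OF ring_free_alg ideal_uea p free_alg_0] by simp
  then show ?thesis using p by (simp add: eqv_def free_alg_closed jet_class_def)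
qed

lemma eqv_jet_gen:
  assumes "p \<in> jet_gens"
  shows "p \<doteq> 0"
proof -
  let ?u = "uea_class (ham_semi B)"
  interpret U: ring "uea (ham_semi B)" by (rule ring_uea)
  have p: "p \<in> FA" using assms jet_gens_FA by blast
  have u: "?u p \<in> carrier (uea (ham_semi B))" "?u 0 \<in> carrier (uea (ham_semi B))"
    using p free_alg_0 by (auto simp: uea_carrier)
  have "?u ` jet_gens \<subseteq> jet_ideal B"
    unfolding jet_ideal_eq by (rule U.genideal_self) (use jet_gens_FA uea_carrier in auto)
  then have "?u p \<in> jet_ideal B" using assms by blast
  moreover have "?u 0 = \<zero>\<^bsub>uea (ham_semi B)\<^esub>"
    using hom_minus(2)[OF ring_free_alg ring_uea uea_class_hom free_alg_0 free_alg_0] by simp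
  ultimately have "?u p \<ominus>\<^bsub>uea (ham_semi B)\<^esub> ?u 0 \<in> jet_ideal B"
    using u by (simp add: a_minus_def)
  then have "ev p = ev 0"
    unfolding jet_class_def using U.quotient_eq_iff_same_a_r_cos[OF ideal_jet u] by simp
  then show ?thesis using p by (simp add: eqv_def free_alg_closed)
qed

section \<open>Commutation relations leading to the bracket of T(r) and T(q)\<close>

abbreviation "t r \<equiv> gen (lzero der_alg, tmon r)"
abbreviation "vf X \<equiv> gen (X, 0 :: 'n laurent)"
abbreviation "dB r \<equiv> vf (DB B r)"
abbreviation "hB r \<equiv> vf (D (B *v cvec r) 0)"
abbreviation "Tt r \<equiv> t (- r) * dB r"
abbreviation "Tel r \<equiv> Tt r - hB r"

lemma in_FA: "t r \<in> FA" "gen (lzero der_alg, f) \<in> FA" "X \<in> lcarrier (ham B) \<Longrightarrow> vf X \<in> FA" "dB r \<in> FA" "vf (D u 0) \<in> FA"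
  by (intro free_alg_closed fun_Ls vf_Ls ham_DB ham_D0; assumption?)+

lemmas FA_closed = free_alg_add free_alg_mult free_alg_uminus free_alg_minus free_alg_fconst free_alg_0 free_alg_1 in_FA

lemma T_eq: "T B r = ev (Tel r)"
  by (simp add: T_def fun_elt_def vf_elt_def ev_minus ev_mult FA_closed del: der_ops)

lemma t_mult: "t r * t q \<doteq> t (r + q)"
proof -
  have "t r * t q - t (r + q) \<doteq> 0" by (rule eqv_jet_gen) (auto simp: jet_gens_def)
  then show ?thesis by (subst eqv_0) (simp add: FA_closed del: der_ops)
qed

lemma gen_bracket:
  assumes "x \<in> Ls" "y \<in> Ls"
  shows "gen x * gen y \<doteq> gen y * gen x + gen (lbr (ham_semi B) x y)"
proof -
  have "gen x * gen y - gen y * gen x - gen (lbr (ham_semi B) x y) \<doteq> 0"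
    by (rule eqv_uea_gen) (unfold uea_gens_def, use assms in blast)
  then show ?thesis by (subst eqv_0) (simp add: FA_closed free_alg_gen Ls_ops assms diff_diff_eq)
qed

lemma gen_scale:
  assumes "x \<in> Ls"
  shows "gen (lsmult (ham_semi B) c x) \<doteq> fconst c * gen x"
proof -
  have "gen (lsmult (ham_semi B) c x) - fconst c * gen x \<doteq> 0"
    by (rule eqv_uea_gen) (unfold uea_gens_def, use assms in blast)
  then show ?thesis by (subst eqv_0) (simp add: FA_closed free_alg_gen Ls_ops assms)
qed

lemma gen_add:
  assumes "x \<in> Ls" "y \<in> Ls"
  shows "gen (ladd (ham_semi B) x y) \<doteq> gen x + gen y"
proof -
  have "gen (ladd (ham_semi B) x y) - (gen x + gen y) \<doteq> 0"
    by (rule eqv_uea_gen) (unfold uea_gens_def, use assms in blast)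
  then show ?thesis by (subst eqv_0) (simp add: FA_closed free_alg_gen Ls_ops assms)
qed

lemma vf_t:
  assumes X: "X \<in> lcarrier (ham B)" and eq: "X (tmon r) = lscale c (tmon q)"
  shows "vf X * t r \<doteq> t r * vf X + fconst c * t q"
proof -
  have "vf X * t r \<doteq> t r * vf X + gen (lbr (ham_semi B) (X, 0) (lzero der_alg, tmon r))"
    by (rule gen_bracket) (simp_all add: vf_Ls X fun_Ls del: der_ops)
  also have "lbr (ham_semi B) (X, 0) (lzero der_alg, tmon r) = lsmult (ham_semi B) c (lzero der_alg, tmon q)"
    by (simp add: ham_semi_simps eq ham_linear[OF X])
  also have "t r * vf X + gen (lsmult (ham_semi B) c (lzero der_alg, tmon q)) \<doteq> t r * vf X + fconst c * t q"
    by (intro eqv_add eqv_refl gen_scale) (simp_all add: FA_closed X fun_Ls del: der_ops)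
  finally show ?thesis .
qed

lemma vf_vf:
  assumes X: "X \<in> lcarrier (ham B)" and Y: "Y \<in> lcarrier (ham B)" and Z: "Z \<in> lcarrier (ham B)"
    and eq: "(\<lambda>f. X (Y f) - Y (X f)) = (\<lambda>f. lscale c (Z f))"
  shows "vf X * vf Y \<doteq> vf Y * vf X + fconst c * vf Z"
proof -
  have "vf X * vf Y \<doteq> vf Y * vf X + gen (lbr (ham_semi B) (X, 0) (Y, 0))"
    by (rule gen_bracket) (simp_all add: vf_Ls X Y)
  also have "lbr (ham_semi B) (X, 0) (Y, 0) = lsmult (ham_semi B) c (Z, 0)"
    using eq by (simp add: ham_semi_simps ham_linear[OF X] ham_linear[OF Y])
  also have "vf Y * vf X + gen (lsmult (ham_semi B) c (Z, 0)) \<doteq> vf Y * vf X + fconst c * vf Z"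
    by (intro eqv_add eqv_refl gen_scale) (simp_all add: FA_closed X Y Z vf_Ls)
  finally show ?thesis .
qed

text \<open>Moving \<open>dB r\<close> past \<open>t (- q)\<close> costs the derivative of
  \<open>t (- q)\<close>, which is the term \<open>- om(r, q) Tt q\<close>. What is left has all
  vector fields on the right, and antisymmetrising it only needs their bracket.\<close>

lemma Tt_Tt: "Tt r * Tt q \<doteq> t (- (r + q)) * (dB r * dB q) - fconst (om B r q) * Tt q"
proof -
  note [simp del] = der_ops
  let ?c = "fconst (om B r (- q))"
  have 1: "dB r * t (- q) \<doteq> t (- q) * dB r + ?c * t (- q + r)"
    by (rule vf_t) (simp_all add: ham_DB DB_tmon)
  have "Tt r * Tt q = t (- r) * ((dB r * t (- q)) * dB q)"
    by (simp add: mult.assoc)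
  also have "\<dots> \<doteq> t (- r) * ((t (- q) * dB r + ?c * t (- q + r)) * dB q)"
    by (intro eqv_mult eqv_refl 1 FA_closed)
  also have "\<dots> = (t (- r) * t (- q)) * (dB r * dB q) + ?c * ((t (- r) * t (- q + r)) * dB q)"
    by (simp add: distrib_left distrib_right mult.assoc fconst_left)
  also have "\<dots> \<doteq> t (- r + - q) * (dB r * dB q) + ?c * (t (- r + (- q + r)) * dB q)"
    by (intro eqv_add eqv_mult eqv_refl t_mult FA_closed)
  also have "\<dots> = t (- (r + q)) * (dB r * dB q) - fconst (om B r q) * Tt q"
    by (simp add: om_simps fconst_simps)
  finally show ?thesis .
qed

text \<open>\<open>t^(-q) D(Bq, q)\<close> has weight 0: the eigenvalues of \<open>D(Br, 0)\<close>
  on its two factors are opposite.\<close>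

lemma hB_Tt: "hB r * Tt q \<doteq> Tt q * hB r"
proof -
  note [simp del] = der_ops
  let ?c = "fconst (om B r q)"
  have 1: "hB r * t (- q) \<doteq> t (- q) * hB r + fconst (om B r (- q)) * t (- q)"
    by (rule vf_t) (simp_all add: ham_D0 D_tmon)
  have 2: "hB r * dB q \<doteq> dB q * hB r + ?c * dB q"
    by (rule vf_vf) (simp_all add: ham_D0 ham_DB D0_DB_bracket)
  have "hB r * Tt q = (hB r * t (- q)) * dB q"
    by (simp add: mult.assoc)
  also have "\<dots> \<doteq> (t (- q) * hB r + fconst (om B r (- q)) * t (- q)) * dB q"
    by (intro eqv_mult eqv_refl 1 FA_closed)
  also have "\<dots> = t (- q) * (hB r * dB q) - ?c * Tt q"
    by (simp add: left_diff_distrib mult.assoc om_simps fconst_simps)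
  also have "\<dots> \<doteq> t (- q) * (dB q * hB r + ?c * dB q) - ?c * Tt q"
    by (intro eqv_minus eqv_mult eqv_refl 2 FA_closed)
  also have "\<dots> = Tt q * hB r"
    by (simp add: distrib_left mult.assoc fconst_left)
  finally show ?thesis .
qed

lemma hB_hB: "hB r * hB q \<doteq> hB q * hB r"
proof -
  have "hB r * hB q \<doteq> hB q * hB r + fconst 0 * hB r"
    by (rule vf_vf) (simp_all add: ham_D0 D0_bracket)
  then show ?thesis by (simp add: fconst_simps)
qed

lemma hB_add: "hB (r + q) \<doteq> hB r + hB q"
proof -
  have "gen (ladd (ham_semi B) (D (B *v cvec r) 0, 0) (D (B *v cvec q) 0, 0)) \<doteq> hB r + hB q"
    by (rule gen_add) (simp_all add: vf_Ls ham_D0)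
  then show ?thesis
    by (simp add: ham_semi_simps cvec_simps matrix_vector_right_distrib D_add_left[abs_def])
qed

lemma Tt_bracket: "Tt r * Tt q - Tt q * Tt r \<doteq> fconst (om B r q) * (Tt (r + q) - Tt r - Tt q)"
proof -
  note [simp del] = der_ops
  let ?c = "fconst (om B r q)" and ?t = "t (- (r + q))"
  have dd: "dB r * dB q \<doteq> dB q * dB r + ?c * dB (r + q)"
    by (rule vf_vf) (simp_all add: ham_DB DB_bracket[OF skew])
  have om: "om B q r = - om B r q" by (rule om_skew[OF skew])
  have "Tt r * Tt q - Tt q * Tt r \<doteq> (?t * (dB r * dB q) - ?c * Tt q) - (t (- (q + r)) * (dB q * dB r) - fconst (om B q r) * Tt r)"
    by (rule eqv_minus[OF Tt_Tt Tt_Tt])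
  also have "\<dots> = ?t * (dB r * dB q) - (?t * (dB q * dB r) + ?c * Tt q + ?c * Tt r)"
    by (simp add: om fconst_simps add.commute)
  also have "\<dots> \<doteq> ?t * (dB q * dB r + ?c * dB (r + q)) - (?t * (dB q * dB r) + ?c * Tt q + ?c * Tt r)"
    by (rule eqv_minus[OF eqv_mult[OF eqv_refl dd] eqv_refl]) (intro FA_closed)+
  also have "\<dots> = ?c * (Tt (r + q) - Tt r - Tt q)"
    by (simp add: distrib_left right_diff_distrib mult.assoc fconst_left)
  finally show ?thesis .
qed

text \<open>Subtracting the \<open>hB\<close> part changes neither side: \<open>hB\<close> commutes
  with \<open>Tt\<close> and with itself, and it is additive in the index, so it drops out of
  \<open>Tel (r + q) - Tel r - Tel q\<close>.\<close>

lemma Tel_bracket: "Tel r * Tel q - Tel q * Tel r \<doteq> fconst (om B r q) * (Tel (r + q) - Tel r - Tel q)"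
proof -
  note [simp del] = der_ops
  let ?c = "fconst (om B r q)"
  define A where "A = Tt r * Tt q - Tt q * Tt r"
  define A' where "A' = Tt (r + q) - Tt r - Tt q"
  define H where "H = hB (r + q) - (hB r + hB q)"
  have mem: "Tt r \<in> FA" "Tt q \<in> FA" "hB r \<in> FA" "hB q \<in> FA" "Tt (r + q) \<in> FA" "hB (r + q) \<in> FA" "A \<in> FA" "A' \<in> FA" "H \<in> FA"
    unfolding A_def A'_def H_def by (intro FA_closed)+
  have zero: "p - q \<doteq> 0" if "p \<doteq> q" for p q
    using that eqv_0 by blast
  have 1: "Tt r * hB q - hB q * Tt r \<doteq> 0" "hB r * Tt q - Tt q * hB r \<doteq> 0" "hB r * hB q - hB q * hB r \<doteq> 0"
    "H \<doteq> 0"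
    unfolding H_def by (rule zero eqv_sym[OF hB_Tt] hB_Tt hB_hB hB_add)+
  have "Tel r * Tel q - Tel q * Tel r =
    A - (Tt r * hB q - hB q * Tt r) - (hB r * Tt q - Tt q * hB r) + (hB r * hB q - hB q * hB r)"
    by (simp add: A_def algebra_simps)
  also have "\<dots> \<doteq> ?c * A' - 0 - 0 + 0"
    by (rule eqv_add[OF eqv_minus[OF eqv_minus[OF _ 1(1)] 1(2)] 1(3)])
      (unfold A_def A'_def, rule Tt_bracket)
  also have "\<dots> = ?c * (A' - 0)" by simp
  also have "\<dots> \<doteq> ?c * (A' - H)"
    by (rule eqv_mult[OF eqv_refl eqv_minus[OF eqv_refl eqv_sym[OF 1(4)]]]) (intro FA_closed mem)+
  also have "\<dots> = ?c * (Tel (r + q) - Tel r - Tel q)"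
    by (simp add: A'_def H_def algebra_simps)
  finally show ?thesis .
qed

end


section \<open>The Lie algebra \<open>\<T>\<^sub>B\<close> and its action on jet modules\<close>

text \<open>The bracket of \<open>\<T>\<^sub>B\<close> on formal combinations of symbols
  \<open>T(k)\<close>. Laurent polynomials serve as the free vector space on the lattice here, with
  \<open>tmon k\<close> in the role of \<open>T(k)\<close>; their product is not involved.\<close>

definition bt :: "complex ^ 'n ^ 'n \<Rightarrow> 'n::finite laurent \<Rightarrow> 'n laurent \<Rightarrow> 'n laurent" where
  "bt B c c' = (\<Sum>k\<in>Poly_Mapping.keys c. \<Sum>l\<in>Poly_Mapping.keys c'.
     lscale (Poly_Mapping.lookup c k * (Poly_Mapping.lookup c' l * om B k l)) (tmon (k + l) - tmon k - tmon l))"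

lemma bt_add_left: "bt B (c + d) e = bt B c e + bt B d e"
  unfolding bt_def
  by (rule lext_add[where f = "\<lambda>k a. \<Sum>l\<in>Poly_Mapping.keys e.
     lscale (a * (Poly_Mapping.lookup e l * om B k l)) (tmon (k + l) - tmon k - tmon l)"])
    (simp_all add: distrib_right lau.scale_left_distrib sum.distrib)

lemma bt_add_right: "bt B e (c + d) = bt B e c + bt B e d"
  unfolding bt_def sum.distrib[symmetric]
  by (rule sum.cong[OF refl], rule lext_add[where f = "\<lambda>l a.
     lscale (Poly_Mapping.lookup e k * (a * om B k l)) (tmon (k + l) - tmon k - tmon l)" for k])
    (simp_all add: distrib_right distrib_left lau.scale_left_distrib)

lemma bt_scale_left: "bt B (lscale a c) e = lscale a (bt B c e)"
proof -
  have "bt B (lscale a c) e = (\<Sum>k\<in>Poly_Mapping.keys c. \<Sum>l\<in>Poly_Mapping.keys e.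
     lscale (Poly_Mapping.lookup (lscale a c) k * (Poly_Mapping.lookup e l * om B k l)) (tmon (k + l) - tmon k - tmon l))"
    unfolding bt_def
    by (rule lext_mono[where f = "\<lambda>k a. \<Sum>l\<in>Poly_Mapping.keys e.
     lscale (a * (Poly_Mapping.lookup e l * om B k l)) (tmon (k + l) - tmon k - tmon l)"]) (simp_all add: keys_lscale)
  then show ?thesis by (simp add: bt_def lau.scale_sum_right lookup_lscale mult.assoc)
qed

lemma bt_scale_right: "bt B e (lscale a c) = lscale a (bt B e c)"
proof -
  have "(\<Sum>l\<in>Poly_Mapping.keys (lscale a c).
     lscale (x * (Poly_Mapping.lookup (lscale a c) l * om B k l)) (tmon (k + l) - tmon k - tmon l)) =
    (\<Sum>l\<in>Poly_Mapping.keys c.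
     lscale (x * (Poly_Mapping.lookup (lscale a c) l * om B k l)) (tmon (k + l) - tmon k - tmon l))" for x k
    by (rule lext_mono[where f = "\<lambda>l a. lscale (x * (a * om B k l)) (tmon (k + l) - tmon k - tmon l)"])
      (simp_all add: keys_lscale)
  note inner = this
  show ?thesis
    unfolding bt_def inner by (simp add: lau.scale_sum_right lookup_lscale mult.left_commute mult.assoc)
qed

lemma bt_tmon: "bt B (tmon r) (tmon q) = lscale (om B r q) (tmon (r + q) - tmon r - tmon q)"
  by (simp add: bt_def tmon_def)

lemma bt_minus: "bt B (c - d) e = bt B c e - bt B d e" "bt B e (c - d) = bt B e c - bt B e d"
  using bt_add_left[of B "c - d" d e] bt_add_right[of B e "c - d" d] by simp_all

context skew_form
begin

text \<open>The formal combination \<open>c\<close> of symbols \<open>T(k)\<close>, evaluated with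
  the lifts \<open>Tel k\<close>. Its image \<open>Tm c\<close> in the jet algebra runs through all
  of \<open>\<T>\<^sub>B\<close>, but \<open>c\<close> need not be determined by
  \<open>Tm c\<close>.\<close>

definition Tm0 :: "'n laurent \<Rightarrow> _" where
  "Tm0 c = (\<Sum>k\<in>Poly_Mapping.keys c. fconst (Poly_Mapping.lookup c k) * Tel k)"

definition Tm where "Tm c = ev (Tm0 c)"

lemma Tel_FA: "Tel k \<in> FA"
  by (intro FA_closed)

lemma Tm0_FA: "Tm0 c \<in> FA"
  unfolding Tm0_def by (intro free_alg_sum FA_closed Tel_FA)

lemma Tm0_add: "Tm0 (c + d) = Tm0 c + Tm0 d"
  unfolding Tm0_def
  by (rule lext_add[where f = "\<lambda>k a. fconst a * Tel k"]) (simp_all add: fconst_simps distrib_right)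

lemma Tm0_scale: "Tm0 (lscale a c) = fconst a * Tm0 c"
proof -
  have "Tm0 (lscale a c) = (\<Sum>k\<in>Poly_Mapping.keys c. fconst (Poly_Mapping.lookup (lscale a c) k) * Tel k)"
    unfolding Tm0_def
    by (rule lext_mono[where f = "\<lambda>k a. fconst a * Tel k"]) (simp_all add: fconst_simps keys_lscale)
  then show ?thesis by (simp add: Tm0_def sum_distrib_left lookup_lscale fconst_simps mult.assoc)
qed

lemma Tm0_minus: "Tm0 (c - d) = Tm0 c - Tm0 d"
  using Tm0_add[of "c - d" d] by simp

lemma Tm0_tmon: "Tm0 (tmon r) = Tel r"
  by (simp add: Tm0_def tmon_def fconst_simps)

lemma Tm_tmon: "Tm (tmon r) = T B r"
  by (simp add: Tm_def Tm0_tmon T_eq)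

lemma jet_lie_ops: "lzero (jet_lie B) = Tm 0" "ladd (jet_lie B) (Tm c) (Tm d) = Tm (c + d)"
  "lsmult (jet_lie B) a (Tm c) = Tm (lscale a c)"
  by (simp_all add: jet_lie_def Tm_def Tm0_add Tm0_scale ev_add ev_mult Tm0_FA FA_closed)
    (simp add: Tm0_def ev_zero)

lemma TB_carrier: "lcarrier (TB B) = range Tm"
proof -
  have "x \<in> range Tm" if "x \<in> lspan (jet_lie B) {T B r | r. True}" for x
    using that
  proof (induction rule: lspan.induct)
    case (base x)
    then show ?case by (auto simp: Tm_tmon[symmetric])
  qed (auto simp: jet_lie_ops)
  moreover have "Tm c \<in> lspan (jet_lie B) {T B r | r. True}" for c
  proof (induction c rule: laurent_induct)
    case (1 k)
    then show ?case unfolding Tm_tmon by (intro lspan.base) blast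
  next
    case (2 c d)
    then show ?case using lspan.add[OF 2] by (simp add: jet_lie_ops)
  next
    case (3 a c)
    then show ?case using lspan.smult[OF 3, of a] by (simp add: jet_lie_ops)
  qed
  ultimately show ?thesis by (auto simp: TB_def lie_restrict_def)
qed

lemma TB_ops: "lzero (TB B) = Tm 0" "ladd (TB B) (Tm c) (Tm d) = Tm (c + d)"
  "lsmult (TB B) a (Tm c) = Tm (lscale a c)"
  "lbr (TB B) = lbr (jet_lie B)" "ladd (TB B) = ladd (jet_lie B)" "lsmult (TB B) = lsmult (jet_lie B)"
  by (simp_all add: TB_def lie_restrict_def jet_lie_ops)

lemma Tm0_bracket: "Tm0 c * Tm0 d - Tm0 d * Tm0 c \<doteq> Tm0 (bt B c d)"
proof -
  have mono: "Tm0 (tmon r) * Tm0 d - Tm0 d * Tm0 (tmon r) \<doteq> Tm0 (bt B (tmon r) d)" for r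
  proof (induction d rule: laurent_induct)
    case (1 k)
    then show ?case
      using Tel_bracket[of r k] by (simp add: Tm0_tmon bt_tmon Tm0_scale Tm0_minus del: der_ops)
  next
    case (2 c d)
    have "Tm0 (tmon r) * Tm0 (c + d) - Tm0 (c + d) * Tm0 (tmon r) =
      (Tm0 (tmon r) * Tm0 c - Tm0 c * Tm0 (tmon r)) + (Tm0 (tmon r) * Tm0 d - Tm0 d * Tm0 (tmon r))"
      by (simp add: Tm0_add algebra_simps)
    also have "\<dots> \<doteq> Tm0 (bt B (tmon r) c) + Tm0 (bt B (tmon r) d)" by (rule eqv_add[OF 2])
    finally show ?case by (simp add: bt_add_right Tm0_add)
  next
    case (3 a c)
    have "Tm0 (tmon r) * Tm0 (lscale a c) - Tm0 (lscale a c) * Tm0 (tmon r) =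
      fconst a * (Tm0 (tmon r) * Tm0 c - Tm0 c * Tm0 (tmon r))"
      by (simp add: Tm0_scale right_diff_distrib fconst_left mult.assoc)
    also have "\<dots> \<doteq> fconst a * Tm0 (bt B (tmon r) c)" by (rule eqv_mult[OF eqv_refl 3]) (rule FA_closed)
    finally show ?case by (simp add: bt_scale_right Tm0_scale)
  qed
  show ?thesis
  proof (induction c rule: laurent_induct)
    case (1 k)
    then show ?case by (rule mono)
  next
    case (2 c c')
    have "Tm0 (c + c') * Tm0 d - Tm0 d * Tm0 (c + c') =
      (Tm0 c * Tm0 d - Tm0 d * Tm0 c) + (Tm0 c' * Tm0 d - Tm0 d * Tm0 c')"
      by (simp add: Tm0_add algebra_simps)
    also have "\<dots> \<doteq> Tm0 (bt B c d) + Tm0 (bt B c' d)" by (rule eqv_add[OF 2])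
    finally show ?case by (simp add: bt_add_left Tm0_add)
  next
    case (3 a c)
    have "Tm0 (lscale a c) * Tm0 d - Tm0 d * Tm0 (lscale a c) =
      fconst a * (Tm0 c * Tm0 d - Tm0 d * Tm0 c)"
      by (simp add: Tm0_scale right_diff_distrib fconst_left mult.assoc)
    also have "\<dots> \<doteq> fconst a * Tm0 (bt B c d)" by (rule eqv_mult[OF eqv_refl 3]) (rule FA_closed)
    finally show ?case by (simp add: bt_scale_left Tm0_scale)
  qed
qed

lemma TB_bracket: "lbr (TB B) (Tm c) (Tm d) = Tm (bt B c d)"
  using Tm0_bracket[of c d]
  by (simp add: TB_ops jet_lie_def Tm_def ev_mult[symmetric] ev_minus[symmetric] Tm0_FA FA_closed eqv_def)

lemma T_zero: "T B 0 = Tm 0"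
proof -
  note [simp del] = der_ops
  have Z: "DB B 0 = (\<lambda>f. 0)" "D (B *v cvec 0) 0 = (\<lambda>f. 0)" by (simp_all add: DB_def cvec_simps D_zero)
  have "gen (lsmult (ham_semi B) 0 ((\<lambda>f. 0), 0)) \<doteq> fconst 0 * gen ((\<lambda>f. 0), 0 :: 'n laurent)"
    by (rule gen_scale) (rule fun_Ls)
  then have z: "gen ((\<lambda>f. 0), 0 :: 'n laurent) \<doteq> 0" by (simp add: ham_semi_simps fconst_simps)
  have "Tel 0 \<doteq> t (- 0) * 0 - 0"
    unfolding Z by (rule eqv_minus[OF eqv_mult[OF eqv_refl z] z]) (rule FA_closed)
  then show ?thesis by (simp add: T_eq eqv_def Tm_def Tm0_def)
qed

lemma Tm_zero: "Tm 0 = \<zero>\<^bsub>jet_alg B\<^esub>"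
  by (simp add: Tm_def Tm0_def ev_zero)

end

section \<open>The action of the jet algebra on a jet module\<close>

definition ring_acts :: "('r, 'q) ring_scheme \<Rightarrow> 'v::ab_group_add set \<Rightarrow> ('r \<Rightarrow> 'v \<Rightarrow> 'v) \<Rightarrow> bool" where
  "ring_acts R V f \<longleftrightarrow> (\<forall>x\<in>carrier R. \<forall>v\<in>V. f x v \<in> V) \<and>
     (\<forall>x\<in>carrier R. \<forall>v\<in>V. \<forall>w\<in>V. f x (v + w) = f x v + f x w) \<and>
     (\<forall>x\<in>carrier R. \<forall>y\<in>carrier R. \<forall>v\<in>V. f (x \<oplus>\<^bsub>R\<^esub> y) v = f x v + f y v) \<and>
     (\<forall>x\<in>carrier R. \<forall>y\<in>carrier R. \<forall>v\<in>V. f (x \<otimes>\<^bsub>R\<^esub> y) v = f x (f y v))"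

lemma ring_acts_minus:
  assumes "ring R" "ring_acts R V f" "x \<in> carrier R" "y \<in> carrier R" "v \<in> V"
  shows "f (x \<ominus>\<^bsub>R\<^esub> y) v = f x v - f y v" "f \<zero>\<^bsub>R\<^esub> v = 0"
proof -
  interpret ring R by fact
  have "f (x \<ominus>\<^bsub>R\<^esub> y \<oplus>\<^bsub>R\<^esub> y) v = f (x \<ominus>\<^bsub>R\<^esub> y) v + f y v"
    using assms by (simp add: ring_acts_def)
  moreover have "x \<ominus>\<^bsub>R\<^esub> y \<oplus>\<^bsub>R\<^esub> y = x"
    using assms by (simp add: a_minus_def a_assoc l_neg)
  ultimately show "f (x \<ominus>\<^bsub>R\<^esub> y) v = f x v - f y v" by simp
  have "f (\<zero>\<^bsub>R\<^esub> \<oplus>\<^bsub>R\<^esub> \<zero>\<^bsub>R\<^esub>) v = f \<zero>\<^bsub>R\<^esub> v + f \<zero>\<^bsub>R\<^esub> v"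
    using assms zero_closed unfolding ring_acts_def by blast
  then show "f \<zero>\<^bsub>R\<^esub> v = 0" by simp
qed

text \<open>The elements that act by zero form a two-sided ideal; containing \<open>S\<close>, it
  contains the generated ideal, and the action depends on cosets only.\<close>

lemma ring_acts_quotient:
  assumes R: "ring R" and f: "ring_acts R V f" and S: "S \<subseteq> carrier R" and V0: "0 \<in> V"
    and Vadd: "\<And>v w. v \<in> V \<Longrightarrow> w \<in> V \<Longrightarrow> v + w \<in> V"
    and kill: "\<And>x v. x \<in> S \<Longrightarrow> v \<in> V \<Longrightarrow> f x v = 0"
  shows "\<exists>g. ring_acts (R Quot Idl\<^bsub>R\<^esub> S) V g \<and> (\<forall>x\<in>carrier R. \<forall>v\<in>V. g (Idl\<^bsub>R\<^esub> S +>\<^bsub>R\<^esub> x) v = f x v)"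
proof -
  interpret ring R by fact
  let ?I = "Idl\<^bsub>R\<^esub> S"
  let ?A = "{x \<in> carrier R. \<forall>v\<in>V. f x v = 0}"
  have closed: "\<And>x v. x \<in> carrier R \<Longrightarrow> v \<in> V \<Longrightarrow> f x v \<in> V"
    and fadd: "\<And>x y v. x \<in> carrier R \<Longrightarrow> y \<in> carrier R \<Longrightarrow> v \<in> V \<Longrightarrow> f (x \<oplus>\<^bsub>R\<^esub> y) v = f x v + f y v"
    and fmult: "\<And>x y v. x \<in> carrier R \<Longrightarrow> y \<in> carrier R \<Longrightarrow> v \<in> V \<Longrightarrow> f (x \<otimes>\<^bsub>R\<^esub> y) v = f x (f y v)"
    and vadd: "\<And>x v w. x \<in> carrier R \<Longrightarrow> v \<in> V \<Longrightarrow> w \<in> V \<Longrightarrow> f x (v + w) = f x v + f x w"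
    using f by (auto simp: ring_acts_def)
  have f0: "f x 0 = 0" if "x \<in> carrier R" for x using vadd[OF that V0 V0] by simp
  have fneg: "f (\<ominus>\<^bsub>R\<^esub> x) v = - f x v" if "x \<in> carrier R" "v \<in> V" for x v
    using ring_acts_minus[OF R f zero_closed that] ring_acts_minus(2)[OF R f that(1) that(1) that(2)] that
    by (simp add: a_minus_def)
  have A: "ideal ?A R"
  proof (rule idealI[OF R])
    show "subgroup ?A (add_monoid R)"
    proof (rule add.subgroupI)
      show "?A \<noteq> {}" using ring_acts_minus(2)[OF R f zero_closed zero_closed] by blast
    qed (auto simp: fadd fneg)
  qed (auto simp: fmult closed f0)
  have I: "ideal ?I R" by (rule genideal_ideal[OF S])
  have IA: "?I \<subseteq> ?A" by (rule genideal_minimal[OF A]) (use S kill in auto)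
  have wd: "f x v = f y v" if "?I +>\<^bsub>R\<^esub> x = ?I +>\<^bsub>R\<^esub> y" "x \<in> carrier R" "y \<in> carrier R" "v \<in> V" for x y v
  proof -
    have "x \<ominus>\<^bsub>R\<^esub> y \<in> ?I" using quotient_eq_iff_same_a_r_cos[OF I] that by blast
    then show ?thesis using IA ring_acts_minus(1)[OF R f that(2-4)] that(4) by auto
  qed
  define g where "g X = f (SOME x. x \<in> carrier R \<and> X = ?I +>\<^bsub>R\<^esub> x)" for X
  have g: "g (?I +>\<^bsub>R\<^esub> x) v = f x v" if "x \<in> carrier R" "v \<in> V" for x v
  proof -
    let ?y = "SOME y. y \<in> carrier R \<and> ?I +>\<^bsub>R\<^esub> x = ?I +>\<^bsub>R\<^esub> y"
    have "?y \<in> carrier R \<and> ?I +>\<^bsub>R\<^esub> x = ?I +>\<^bsub>R\<^esub> ?y"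
      by (rule someI[where x = x]) (use that in simp)
    then have "f ?y v = f x v" using wd[of ?y x v] that by simp
    then show ?thesis by (simp only: g_def)
  qed
  note hom = quotient_hom[OF R I]
  have "ring_acts (R Quot ?I) V g"
    unfolding ring_acts_def hom(2)
    by (auto simp: g Vadd closed vadd fadd fmult ring_hom_add[OF hom(1), symmetric] ring_hom_mult[OF hom(1), symmetric])
  then show ?thesis using g by blast
qed

locale skew_jet = skew_form B + jet_module B s V \<rho> \<alpha>
  for B :: "complex ^ 'n ^ 'n::finite" and s :: "complex \<Rightarrow> 'v::ab_group_add \<Rightarrow> 'v" and V \<rho> \<alpha>
begin

sublocale vs: vector_space s by (rule vs)

lemma V_closed: "0 \<in> V" "v \<in> V \<Longrightarrow> w \<in> V \<Longrightarrow> v + w \<in> V" "v \<in> V \<Longrightarrow> w \<in> V \<Longrightarrow> v - w \<in> V" "v \<in> V \<Longrightarrow> s c v \<in> V"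
  using subsp by (auto intro: vs.subspace_0 vs.subspace_add vs.subspace_diff vs.subspace_scale)

lemma V_sum: "(\<And>i. i \<in> I \<Longrightarrow> f i \<in> V) \<Longrightarrow> sum f I \<in> V"
  using subsp by (rule vs.subspace_sum)

definition la :: "('n vfield \<times> 'n laurent) \<Rightarrow> 'v \<Rightarrow> 'v" where
  "la x v = \<rho> (fst x) v + \<alpha> (snd x) v"

lemma la_V: "x \<in> Ls \<Longrightarrow> v \<in> V \<Longrightarrow> la x v \<in> V"
  by (cases x) (simp add: la_def ham_semi_simps act_closed alg_closed V_closed)

lemma la_add: "x \<in> Ls \<Longrightarrow> v \<in> V \<Longrightarrow> w \<in> V \<Longrightarrow> la x (v + w) = la x v + la x w"
  by (cases x) (simp add: la_def ham_semi_simps act_add alg_add)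

lemma la_scale: "x \<in> Ls \<Longrightarrow> v \<in> V \<Longrightarrow> la x (s c v) = s c (la x v)"
  by (cases x) (simp add: la_def ham_semi_simps act_scale alg_scale vs.scale_right_distrib)

definition wa :: "('n vfield \<times> 'n laurent) fmon \<Rightarrow> 'v \<Rightarrow> 'v" where
  "wa w v = foldr la (letters w) v"

lemma wa_V: "set (letters w) \<subseteq> Ls \<Longrightarrow> v \<in> V \<Longrightarrow> wa w v \<in> V"
proof -
  have "set xs \<subseteq> Ls \<Longrightarrow> v \<in> V \<Longrightarrow> foldr la xs v \<in> V" for xs v
    by (induction xs) (auto simp: la_V)
  then show "set (letters w) \<subseteq> Ls \<Longrightarrow> v \<in> V \<Longrightarrow> wa w v \<in> V" by (simp add: wa_def)
qed

lemma foldr_la: "set xs \<subseteq> Ls \<Longrightarrow> v \<in> V \<Longrightarrow> w \<in> V \<Longrightarrow> foldr la xs v \<in> V \<and>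
   foldr la xs (v + w) = foldr la xs v + foldr la xs w \<and> foldr la xs (s c v) = s c (foldr la xs v)"
proof (induction xs)
  case (Cons x xs)
  have "foldr la xs v \<in> V" "foldr la xs w \<in> V"
    using Cons.prems wa_V[of "FMon xs"] by (auto simp: wa_def)
  then show ?case using Cons by (simp add: la_V la_add la_scale)
qed simp

lemma wa_add: "set (letters u) \<subseteq> Ls \<Longrightarrow> v \<in> V \<Longrightarrow> w \<in> V \<Longrightarrow> wa u (v + w) = wa u v + wa u w"
  and wa_scale: "set (letters u) \<subseteq> Ls \<Longrightarrow> v \<in> V \<Longrightarrow> wa u (s c v) = s c (wa u v)"
  using foldr_la by (auto simp: wa_def)

lemma wa_sum:
  assumes "set (letters u) \<subseteq> Ls" "\<And>i. i \<in> I \<Longrightarrow> f i \<in> V" "finite I"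
  shows "wa u (sum f I) = (\<Sum>i\<in>I. wa u (f i))"
  using assms(3,2)
proof (induction I rule: finite_induct)
  case empty
  have "wa u (0 + 0) = wa u 0 + wa u 0" using assms(1) V_closed(1) by (intro wa_add)
  then show ?case by simp
next
  case (insert i I)
  then show ?case using wa_add[OF assms(1), of "f i" "sum f I"] V_sum[of I f] by simp
qed

definition fa :: "_ \<Rightarrow> 'v \<Rightarrow> 'v" where
  "fa p v = (\<Sum>w\<in>Poly_Mapping.keys p. s (Poly_Mapping.lookup p w) (wa w v))"

lemma fa_add: "fa (p + q) v = fa p v + fa q v"
  unfolding fa_def
  by (rule lext_add[where f = "\<lambda>w a. s a (wa w v)"]) (simp_all add: vs.scale_left_distrib)

lemma fa_minus: "fa (p - q) v = fa p v - fa q v"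
  using fa_add[of "p - q" q v] by simp

lemma fa_sum: "fa (sum f I) v = (\<Sum>i\<in>I. fa (f i) v)"
  by (induction I rule: infinite_finite_induct) (simp_all add: fa_add, simp_all add: fa_def)

lemma fa_single: "fa (Poly_Mapping.single w a) v = s a (wa w v)"
  by (simp add: fa_def)

lemma fa_fconst: "fa (fconst c) v = s c v"
  by (simp add: fconst_def fa_single wa_def zero_fmon_def)

lemma fa_gen: "fa (gen x) v = la x v"
  by (simp add: gen_def fa_single wa_def)

lemma fa_V: "p \<in> FA \<Longrightarrow> v \<in> V \<Longrightarrow> fa p v \<in> V"
  unfolding fa_def by (intro V_sum V_closed wa_V) (auto simp: free_alg_carrier)

lemma fa_vadd: "p \<in> FA \<Longrightarrow> v \<in> V \<Longrightarrow> w \<in> V \<Longrightarrow> fa p (v + w) = fa p v + fa p w"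
  by (simp add: fa_def free_alg_carrier wa_add vs.scale_right_distrib sum.distrib)

lemma fa_vscale: "p \<in> FA \<Longrightarrow> v \<in> V \<Longrightarrow> fa p (s c v) = s c (fa p v)"
  by (simp add: fa_def free_alg_carrier wa_scale vs.scale_sum_right mult.commute)

lemma fa_mult:
  assumes p: "p \<in> FA" and q: "q \<in> FA" and v: "v \<in> V"
  shows "fa (p * q) v = fa p (fa q v)"
proof -
  let ?lp = "Poly_Mapping.lookup p" and ?lq = "Poly_Mapping.lookup q"
  have "p * q = (\<Sum>w\<in>Poly_Mapping.keys p. \<Sum>w'\<in>Poly_Mapping.keys q.
      Poly_Mapping.single (w + w') (?lp w * ?lq w'))"
    by (subst free_alg_expand[of p], subst free_alg_expand[of q]) (simp add: sum_product mult_single)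
  then have "fa (p * q) v = (\<Sum>w\<in>Poly_Mapping.keys p. \<Sum>w'\<in>Poly_Mapping.keys q.
      s (?lp w * ?lq w') (wa (w + w') v))"
    by (simp add: fa_sum fa_single)
  also have "\<dots> = (\<Sum>w\<in>Poly_Mapping.keys p. s (?lp w) (wa w (fa q v)))"
  proof (rule sum.cong)
    fix w assume "w \<in> Poly_Mapping.keys p"
    then have w: "set (letters w) \<subseteq> Ls" using p by (auto simp: free_alg_carrier)
    have qV: "wa w' v \<in> V" if "w' \<in> Poly_Mapping.keys q" for w'
      using that q v by (intro wa_V) (auto simp: free_alg_carrier)
    have "wa w (fa q v) = (\<Sum>w'\<in>Poly_Mapping.keys q. wa w (s (?lq w') (wa w' v)))"
      unfolding fa_def by (rule wa_sum[OF w]) (simp_all add: V_closed qV)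
    also have "\<dots> = (\<Sum>w'\<in>Poly_Mapping.keys q. s (?lq w') (wa (w + w') v))"
      by (rule sum.cong) (simp_all add: wa_scale[OF w] qV, simp add: wa_def plus_fmon_def)
    finally show "(\<Sum>w'\<in>Poly_Mapping.keys q. s (?lp w * ?lq w') (wa (w + w') v)) = s (?lp w) (wa w (fa q v))"
      by (simp add: vs.scale_sum_right)
  qed simp
  finally show ?thesis by (simp add: fa_def)
qed

lemma alpha_minus: "v \<in> V \<Longrightarrow> \<alpha> (f - g) v = \<alpha> f v - \<alpha> g v"
  using add_alg[of v "f - g" g] by simp

lemma rho_zero: "v \<in> V \<Longrightarrow> \<rho> (\<lambda>f. 0) v = 0"
  using lsmult_act[of "\<lambda>f. 0" v 0] by (simp add: ham_zero)

lemma alpha_zero: "v \<in> V \<Longrightarrow> \<alpha> 0 v = 0"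
  using alpha_minus[of v 0 0] by simp

text \<open>The linear relators vanish by linearity of the action. For the bracket relators the
  mixed terms are the compatibility \<open>X(fv) = X(f) v + f(X v)\<close>, and functions commute
  with each other.\<close>

lemma fa_uea_gens:
  assumes "p \<in> uea_gens" "v \<in> V"
  shows "fa p v = 0"
proof -
  have add: "la (ladd (ham_semi B) x y) v = la x v + la y v" if "x \<in> Ls" "y \<in> Ls" for x y
    using that ladd_act[of "fst x" "fst y" v] assms(2)
    by (cases x; cases y) (simp add: la_def ham_semi_simps add_alg)
  have sc: "la (lsmult (ham_semi B) c x) v = s c (la x v)" if "x \<in> Ls" for x c
    using that lsmult_act[of "fst x" v c] assms(2)
    by (cases x) (simp add: la_def ham_semi_simps scale_alg vs.scale_right_distrib)
  have br: "la (lbr (ham_semi B) x y) v = la x (la y v) - la y (la x v)" if "x \<in> Ls" "y \<in> Ls" for x y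
  proof -
    obtain X f Y g where xy: "x = (X, f)" "y = (Y, g)" by (cases x; cases y)
    have X: "X \<in> lcarrier (ham B)" and Y: "Y \<in> lcarrier (ham B)" using that xy by (auto simp: ham_semi_simps)
    have "\<rho> (\<lambda>h. X (Y h) - Y (X h)) v = \<rho> X (\<rho> Y v) - \<rho> Y (\<rho> X v)"
      using lbr_act[OF X Y assms(2)] by simp
    moreover have "\<alpha> f (\<alpha> g v) = \<alpha> g (\<alpha> f v)"
      using mult_alg[OF assms(2)] by (metis mult.commute)
    ultimately show ?thesis
      using X Y assms(2)
      by (simp add: xy la_def ham_semi_simps alpha_minus act_add alg_add act_closed alg_closed compat)
  qed
  note fs = fa_minus fa_add fa_gen fa_mult free_alg_gen free_alg_fconst fa_fconst assms(2) la_V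
  consider x y where "p = gen (ladd (ham_semi B) x y) - (gen x + gen y)" "x \<in> Ls" "y \<in> Ls"
    | c x where "p = gen (lsmult (ham_semi B) c x) - fconst c * gen x" "x \<in> Ls"
    | x y where "p = gen x * gen y - gen y * gen x - gen (lbr (ham_semi B) x y)" "x \<in> Ls" "y \<in> Ls"
    using assms(1) unfolding uea_gens_def by blast
  then show ?thesis
  proof cases
    case 1
    then show ?thesis by (simp add: fs add)
  next
    case 2
    then show ?thesis by (simp add: fs sc)
  next
    case 3
    then show ?thesis by (simp add: fs br)
  qed
qed

lemma fa_jet_gens:
  assumes "p \<in> jet_gens" "v \<in> V"
  shows "fa p v = 0"
proof -
  have la0: "la (\<lambda>f. 0, f) w = \<alpha> f w" if "w \<in> V" for f w
    using that by (simp add: la_def rho_zero)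
  have "fa 1 v = v" using fa_fconst[of 1 v] by (simp add: fconst_simps)
  then show ?thesis
    using assms unfolding jet_gens_def
    by (auto simp: fa_minus fa_gen fa_mult free_alg_gen fun_Ls la0 alg_closed mult_alg[symmetric] tmon_mult tmon_0 one_alg)
qed

lemma jet_action:
  "\<exists>act. ring_acts (jet_alg B) V act \<and> (\<forall>p\<in>FA. \<forall>v\<in>V. act (ev p) v = fa p v)"
proof -
  let ?u = "uea_class (ham_semi B)" and ?U = "uea (ham_semi B)"
  have "ring_acts (free_alg Ls) V fa"
    by (simp add: ring_acts_def fa_V fa_vadd fa_add fa_mult)
  then obtain g where g: "ring_acts ?U V g" "\<forall>p\<in>FA. \<forall>v\<in>V. g (?u p) v = fa p v"
    using ring_acts_quotient[where f = fa, OF ring_free_alg _ uea_gens_FA V_closed(1,2) fa_uea_gens]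
    unfolding uea_def uea_class_def uea_ideal_eq by blast
  have sub: "?u ` jet_gens \<subseteq> carrier ?U" using jet_gens_FA uea_carrier by auto
  have kill: "g x v = 0" if "x \<in> ?u ` jet_gens" "v \<in> V" for x v
  proof -
    obtain p where "x = ?u p" "p \<in> jet_gens" using \<open>x \<in> ?u ` jet_gens\<close> by blast
    then show ?thesis using g(2) fa_jet_gens[of p v] jet_gens_FA \<open>v \<in> V\<close> by auto
  qed
  obtain h where h: "ring_acts (jet_alg B) V h"
    "\<forall>x\<in>carrier ?U. \<forall>v\<in>V. h (jet_ideal B +>\<^bsub>?U\<^esub> x) v = g x v"
    using ring_acts_quotient[where f = g, OF ring_uea g(1) sub V_closed(1,2) kill]
    unfolding jet_alg_def jet_ideal_eq by blast
  have "h (ev p) v = fa p v" if "p \<in> FA" "v \<in> V" for p v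
    using h(2) g(2) that uea_carrier unfolding jet_class_def by auto
  then show ?thesis using h(1) by blast
qed

text \<open>Every jet module is a module over the jet algebra, hence over the Lie algebra of its
  commutators, and \<open>\<T>\<^sub>B\<close> is a part of that. The formula is the definition of
  \<open>T(r)\<close> applied to a vector.\<close>

lemma TB_module:
  "\<exists>\<tau>. lie_module (TB B) s V \<tau> \<and>
     (\<forall>r. \<forall>v\<in>V. \<tau> (T B r) v = \<alpha> (tmon (- r)) (\<rho> (DB B r) v) - \<rho> (D (B *v cvec r) 0) v)"
proof -
  obtain act where act: "ring_acts (jet_alg B) V act" "\<forall>p\<in>FA. \<forall>v\<in>V. act (ev p) v = fa p v"
    using jet_action by blast
  have act_Tm: "act (Tm c) v = fa (Tm0 c) v" if "v \<in> V" for c v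
    using act(2) Tm0_FA that by (simp add: Tm_def)
  have "lie_module (TB B) s V act"
  proof (unfold_locales; (unfold TB_carrier)?)
    show "x \<in> range Tm \<Longrightarrow> v \<in> V \<Longrightarrow> act x v \<in> V" for x v
      by (auto simp: act_Tm fa_V Tm0_FA)
    show "x \<in> range Tm \<Longrightarrow> v \<in> V \<Longrightarrow> w \<in> V \<Longrightarrow> act x (v + w) = act x v + act x w" for x v w
      by (auto simp: act_Tm fa_vadd Tm0_FA V_closed)
    show "x \<in> range Tm \<Longrightarrow> v \<in> V \<Longrightarrow> act x (s c v) = s c (act x v)" for x v c
      by (auto simp: act_Tm fa_vscale Tm0_FA V_closed)
    show "x \<in> range Tm \<Longrightarrow> y \<in> range Tm \<Longrightarrow> v \<in> V \<Longrightarrow> act (ladd (TB B) x y) v = act x v + act y v" for x y v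
      by (auto simp: act_Tm Tm0_add fa_add TB_ops(2) simp del: TB_ops(5))
    show "x \<in> range Tm \<Longrightarrow> v \<in> V \<Longrightarrow> act (lsmult (TB B) c x) v = s c (act x v)" for x v c
      by (auto simp: act_Tm Tm0_scale fa_mult Tm0_FA FA_closed fa_fconst TB_ops(3) simp del: TB_ops(6))
    fix x y v assume xy: "x \<in> range Tm" "y \<in> range Tm" and v: "v \<in> V"
    then obtain c d where cd: "x = Tm c" "y = Tm d" by blast
    have "lbr (TB B) x y = ev (Tm0 c * Tm0 d - Tm0 d * Tm0 c)"
      using Tm0_bracket[of c d] unfolding cd TB_bracket by (simp add: Tm_def eqv_def)
    then show "act (lbr (TB B) x y) v = act x (act y v) - act y (act x v)"
      using act(2) v by (simp add: cd act_Tm fa_minus fa_mult Tm0_FA FA_closed fa_V)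
  qed (use vs subsp in auto)
  moreover have "act (T B r) v = \<alpha> (tmon (- r)) (\<rho> (DB B r) v) - \<rho> (D (B *v cvec r) 0) v" if v: "v \<in> V" for r v
  proof -
    have "act (T B r) v = fa (Tel r) v" unfolding T_eq using act(2) Tel_FA v by blast
    also have "\<dots> = la (lzero der_alg, tmon (- r)) (la (DB B r, 0) v) - la (D (B *v cvec r) 0, 0) v"
      using v by (simp add: fa_minus fa_mult FA_closed fa_gen del: der_ops)
    also have "\<dots> = \<alpha> (tmon (- r)) (\<rho> (DB B r) v) - \<rho> (D (B *v cvec r) 0) v"
      using v by (simp add: la_def rho_zero alpha_zero act_closed ham_DB)
    finally show ?thesis .
  qed
  ultimately show ?thesis by blast
qed

end


section \<open>The homomorphism to the symplectic Lie algebra\<close>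

abbreviation mscale :: "complex \<Rightarrow> complex ^ 'n ^ 'n \<Rightarrow> complex ^ 'n ^ 'n" where
  "mscale c X \<equiv> \<chi> i j. c * X $ i $ j"

definition rank1 :: "complex ^ 'n ^ 'n \<Rightarrow> int ^ 'n::finite \<Rightarrow> complex ^ 'n ^ 'n" where
  "rank1 B r = (\<chi> i j. cvec r $ i * (B *v cvec r) $ j)"

definition psi0 :: "complex ^ 'n ^ 'n \<Rightarrow> 'n::finite laurent \<Rightarrow> complex ^ 'n ^ 'n" where
  "psi0 B c = (\<chi> i j. \<Sum>k\<in>Poly_Mapping.keys c. Poly_Mapping.lookup c k * rank1 B k $ i $ j)"

lemma psi0_add: "psi0 B (c + d) = psi0 B c + psi0 B d"
  unfolding psi0_def vec_eq_iff
  using lext_add[of "\<lambda>k a. a * rank1 B k $ i $ j" c d for i j] by (simp add: distrib_right)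

lemma psi0_scale: "psi0 B (lscale a c) = mscale a (psi0 B c)"
proof -
  have "(\<Sum>k\<in>Poly_Mapping.keys (lscale a c). Poly_Mapping.lookup (lscale a c) k * rank1 B k $ i $ j) =
    (\<Sum>k\<in>Poly_Mapping.keys c. Poly_Mapping.lookup (lscale a c) k * rank1 B k $ i $ j)" for i j
    by (rule lext_mono[where f = "\<lambda>k a. a * rank1 B k $ i $ j"]) (simp_all add: keys_lscale)
  then show ?thesis by (simp add: psi0_def vec_eq_iff lookup_lscale sum_distrib_left mult.assoc)
qed

lemma psi0_minus: "psi0 B (c - d) = psi0 B c - psi0 B d"
  using psi0_add[of B "c - d" d] by (simp add: algebra_simps)

lemma psi0_tmon: "psi0 B (tmon r) = rank1 B r"
  by (simp add: psi0_def tmon_def vec_eq_iff)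

lemma psi0_0: "psi0 B 0 = 0"
  by (simp add: psi0_def vec_eq_iff)

lemma mscale_mult: "mscale a X ** Y = mscale a (X ** Y)" "X ** mscale a Y = mscale a (X ** Y)"
  by (simp_all add: vec_eq_iff matrix_matrix_mult_def sum_distrib_left mult.assoc mult.left_commute)

lemma mscale_vec: "mscale a X *v u = a *s (X *v u)"
  by (simp add: vec_eq_iff matrix_vector_mult_def sum_distrib_left mult.assoc)

lemma mscale_simps: "mscale a (X + Y) = mscale a X + mscale a Y" "mscale a (X - Y) = mscale a X - mscale a Y"
  "mscale a (mscale b X) = mscale (a * b) X" "mscale (a + b) X = mscale a X + mscale b X"
  "mscale a (- X) = - mscale a X" "transpose (mscale a X) = mscale a (transpose X)"
  by (simp_all add: vec_eq_iff algebra_simps transpose_def)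

lemma mat_distribs: "(A + A') ** C = A ** C + A' ** C" "C ** (A + A') = C ** A + C ** A'"
  "(A - A') ** C = A ** C - A' ** C" "C ** (A - A') = C ** A - C ** A'"
  "(- A) ** C = - (A ** C)" "C ** (- A) = - (C ** A)"
  "transpose (A + A') = transpose A + transpose A'" "transpose (- A) = - transpose A"
  for A A' C :: "complex ^ 'n ^ 'n::finite"
  by (simp_all add: vec_eq_iff matrix_matrix_mult_def transpose_def algebra_simps sum.distrib sum_subtractf sum_negf)

lemma rank1_mult: "rank1 B r ** rank1 B q = (\<chi> i j. om B r q * (cvec r $ i * (B *v cvec q) $ j))"
  by (simp add: vec_eq_iff rank1_def matrix_matrix_mult_def bform_def sum_distrib_left sum_distrib_right mult.assoc mult.left_commute)

lemma rank1_add: "rank1 B (r + q) - rank1 B r - rank1 B q =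
  (\<chi> i j. cvec r $ i * (B *v cvec q) $ j + cvec q $ i * (B *v cvec r) $ j)"
  by (simp add: vec_eq_iff rank1_def cvec_simps matrix_vector_right_distrib algebra_simps)

context skew_form
begin

text \<open>For symbols, \<open>r (Br)^T q (Bq)^T = om(r, q) r (Bq)^T\<close>, so the commutator is
  \<open>om(r, q)\<close> times \<open>r (Bq)^T + q (Br)^T\<close>, the polarisation of the
  quadratic map \<open>r (Br)^T\<close>; this is the bracket relation of the
  \<open>T(r)\<close>.\<close>

lemma psi0_bracket: "psi0 B (bt B c d) = psi0 B c ** psi0 B d - psi0 B d ** psi0 B c"
proof -
  have mono: "psi0 B (bt B (tmon r) d) = rank1 B r ** psi0 B d - psi0 B d ** rank1 B r" for r
  proof (induction d rule: laurent_induct)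
    case (1 k)
    have "psi0 B (bt B (tmon r) (tmon k)) = mscale (om B r k) (rank1 B (r + k) - rank1 B r - rank1 B k)"
      by (simp add: bt_tmon psi0_scale psi0_minus psi0_tmon)
    also have "\<dots> = rank1 B r ** rank1 B k - rank1 B k ** rank1 B r"
      unfolding rank1_mult rank1_add om_skew[OF skew, of k r] by (simp add: vec_eq_iff algebra_simps)
    finally show ?case by (simp add: psi0_tmon)
  next
    case (2 c d)
    then show ?case by (simp add: bt_add_right psi0_add mat_distribs)
  next
    case (3 a c)
    then show ?case by (simp add: bt_scale_right psi0_scale mscale_mult mscale_simps(2)[symmetric])
  qed
  show ?thesis
  proof (induction c rule: laurent_induct)
    case (1 k)
    then show ?case using mono by (simp add: psi0_tmon)
  next
    case (2 c c')
    then show ?case by (simp add: bt_add_left psi0_add mat_distribs)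
  next
    case (3 a c)
    then show ?case by (simp add: bt_scale_left psi0_scale mscale_mult mscale_simps(2)[symmetric])
  qed
qed

text \<open>For a symbol, \<open>B r (Br)^T\<close> is the symmetric matrix
  \<open>(Br)(Br)^T\<close>; skewness of \<open>B\<close> turns \<open>r^T B\<close> into
  \<open>- (Br)^T\<close>, so the other product is its negative.\<close>

lemma psi0_sp: "B ** psi0 B c = - (transpose (psi0 B c) ** B)"
proof (induction c rule: laurent_induct)
  case (1 k)
  have b: "(\<Sum>l\<in>UNIV. cvec k $ l * B $ l $ j) = - (B *v cvec k) $ j" for j
  proof -
    have "(\<Sum>l\<in>UNIV. cvec k $ l * B $ l $ j) = (transpose B *v cvec k) $ j"
      by (simp add: matrix_vector_mult_def transpose_def mult.commute)
    then show ?thesis by (simp add: skew uminus_mult_vec)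
  qed
  have "(B ** rank1 B k) $ i $ j = (B *v cvec k) $ i * (B *v cvec k) $ j" for i j
    by (simp add: rank1_def matrix_matrix_mult_def matrix_vector_mult_def[of B "cvec k"] sum_distrib_right mult.assoc)
  moreover have "(transpose (rank1 B k) ** B) $ i $ j = (B *v cvec k) $ i * (\<Sum>l\<in>UNIV. cvec k $ l * B $ l $ j)" for i j
    by (simp add: rank1_def matrix_matrix_mult_def transpose_def sum_distrib_left mult.assoc mult.left_commute)
  ultimately show ?case by (simp add: psi0_tmon vec_eq_iff b)
next
  case (2 c d)
  then show ?case by (simp add: psi0_add mat_distribs)
next
  case (3 a c)
  then show ?case by (simp add: psi0_scale mscale_mult mscale_simps(6)) (simp add: vec_eq_iff)
qed

text \<open>The derivation module: \<open>T(r)\<close> maps \<open>D(u, 0)\<close> to \<open>- (u|r) D(Br, 0)\<close>, which is the dual of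
  the action of the matrix \<open>r (Br)\<^sup>T\<close> on \<open>\<complex>\<^sup>N\<close>.\<close>

lemma psi0_well_defined:
  assumes "Tm c = Tm d"
  shows "psi0 B c = psi0 B d"
proof -
  \<comment> \<open>All linear endomorphisms of the Laurent polynomials form a jet module: vector
    fields act by commutators and functions by left multiplication. It contains the fields
    \<open>D(u, 0)\<close>, on which \<open>\<T>\<^sub>B\<close> acts through the matrices to be
    recovered.\<close>
  let ?V = "Collect laurent_linear :: ('n laurent \<Rightarrow> 'n laurent) set"
  let ?s = "\<lambda>c (\<xi> :: 'n laurent \<Rightarrow> 'n laurent) f. lscale c (\<xi> f)"
  let ?\<rho> = "\<lambda>\<eta> (\<xi> :: 'n laurent \<Rightarrow> 'n laurent) f. \<eta> (\<xi> f) - \<xi> (\<eta> f)"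
  let ?\<alpha> = "\<lambda>g (\<xi> :: 'n laurent \<Rightarrow> 'n laurent) f. g * \<xi> f"
  have vs: "vector_space ?s"
    by unfold_locales (simp_all add: fun_eq_iff lau.scale_right_distrib lau.scale_left_distrib)
  interpret vs: vector_space ?s by (rule vs)
  have jm: "jet_module B ?s ?V ?\<rho> ?\<alpha>"
  proof (rule jet_module.intro, rule lie_module.intro)
    show "vector_space ?s" by (rule vs)
    show "module.subspace ?s ?V"
      unfolding vs.subspace_def
      by (simp add: laurent_linear_def lau.scale_right_distrib lau.scale_left_commute mult.commute)
    fix x v w c assume x: "x \<in> lcarrier (ham B)" and v: "v \<in> ?V"
    show "?\<rho> x v \<in> ?V"
      using v by (simp add: laurent_linear_def ham_linear(1,2)[OF x] lau.scale_right_diff_distrib)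
    show "?\<rho> x (v + w) = ?\<rho> x v + ?\<rho> x w"
      by (simp add: fun_eq_iff ham_linear(1)[OF x])
    show "?\<rho> x (?s c v) = ?s c (?\<rho> x v)"
      by (simp add: fun_eq_iff ham_linear(2)[OF x] lau.scale_right_diff_distrib)
    have v_simps: "v (a + b) = v a + v b" "v (lscale c a) = lscale c (v a)" "v (a - b) = v a - v b" for a b c
    proof -
      show *: "v (a + b) = v a + v b" for a b using v by (simp add: laurent_linear_def)
      show "v (a - b) = v a - v b" using *[of "a - b" b] by simp
      show "v (lscale c a) = lscale c (v a)" using v by (simp add: laurent_linear_def)
    qed
    show "?\<rho> (lsmult (ham B) c x) v = ?s c (?\<rho> x v)"
      by (simp add: fun_eq_iff v_simps lau.scale_right_diff_distrib)
    fix y assume y: "y \<in> lcarrier (ham B)"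
    show "?\<rho> (ladd (ham B) x y) v = ?\<rho> x v + ?\<rho> y v"
      by (simp add: fun_eq_iff v_simps)
    show "?\<rho> (lbr (ham B) x y) v = ?\<rho> x (?\<rho> y v) - ?\<rho> y (?\<rho> x v)"
      by (simp add: fun_eq_iff v_simps ham_linear(4)[OF x] ham_linear(4)[OF y])
  next
    show "jet_module_axioms B ?s ?V ?\<rho> ?\<alpha>"
    proof (rule jet_module_axioms.intro)
      show "?\<rho> \<eta> (?\<alpha> f v) = ?\<alpha> (\<eta> f) v + ?\<alpha> f (?\<rho> \<eta> v)" if "\<eta> \<in> lcarrier (ham B)" for \<eta> v f
        by (simp add: fun_eq_iff ham_linear(3)[OF that] right_diff_distrib)
    qed (simp_all add: laurent_linear_def fun_eq_iff distrib_left distrib_right mult.assoc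
        lscale_mult_right[symmetric] lscale_mult_left[symmetric])
  qed
  interpret skew_jet B ?s ?V ?\<rho> ?\<alpha>
    by (rule skew_jet.intro[OF skew_form_axioms jm])
  obtain \<tau> where \<tau>: "lie_module (TB B) ?s ?V \<tau>"
    and \<tau>T: "\<And>r v. v \<in> ?V \<Longrightarrow> \<tau> (T B r) v = ?\<alpha> (tmon (- r)) (?\<rho> (DB B r) v) - ?\<rho> (D (B *v cvec r) 0) v"
    using TB_module by blast
  interpret t: lie_module "TB B" ?s ?V \<tau> by (rule \<tau>)
  have DV: "D u 0 \<in> ?V" for u :: "complex ^ 'n" by (simp add: D_linear)
  have act: "\<tau> (Tm c) (D u 0) = D (- (transpose (psi0 B c) *v u)) 0" for u c
  proof (induction c rule: laurent_induct)
    case (1 k)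
    have "\<tau> (Tm (tmon k)) (D u 0) = (\<lambda>f. tmon (- k) * (DB B k (D u 0 f) - D u 0 (DB B k f)) -
        (D (B *v cvec k) 0 (D u 0 f) - D u 0 (D (B *v cvec k) 0 f)))"
      unfolding Tm_tmon by (subst \<tau>T[OF DV]) (simp add: fun_eq_iff)
    also have "\<dots> = (\<lambda>f. lscale (- bform u (cvec k)) (D (B *v cvec k) 0 f))"
    proof
      fix f
      have "D (B *v cvec k) 0 (D u 0 f) - D u 0 (D (B *v cvec k) 0 f) = 0"
        using fun_cong[OF D0_bracket] .
      moreover have "DB B k (D u 0 f) - D u 0 (DB B k f) = lscale (- bform u (cvec k)) (DB B k f)"
        using fun_cong[OF D0_DB_bracket[of u B k], of f] by (simp add: algebra_simps)
      moreover have "tmon (- k) * DB B k f = D (B *v cvec k) 0 f"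
        by (rule laurent_linear_eqI[where f = "\<lambda>f. tmon (- k) * DB B k f"])
          (simp_all add: D_linear DB_tmon D_tmon laurent_linear_def DB_def D_add D_lscale distrib_left
            lscale_mult_right[symmetric] tmon_mult)
      ultimately show "tmon (- k) * (DB B k (D u 0 f) - D u 0 (DB B k f)) -
        (D (B *v cvec k) 0 (D u 0 f) - D u 0 (D (B *v cvec k) 0 f)) = lscale (- bform u (cvec k)) (D (B *v cvec k) 0 f)"
        by (simp add: lscale_mult_right[symmetric])
    qed
    also have "\<dots> = D ((- bform u (cvec k)) *s (B *v cvec k)) 0"
      by (rule ext) (rule D_scale_left[symmetric])
    also have "(- bform u (cvec k)) *s (B *v cvec k) = - (transpose (psi0 B (tmon k)) *v u)"
    proof -
      have "(- bform u a) *s b = - (transpose (\<chi> i j. a $ i * b $ j) *v u)" for a b :: "complex ^ 'n"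
        by (simp add: vec_eq_iff matrix_vector_mult_def transpose_def bform_def sum_distrib_left mult_ac)
      then show ?thesis by (simp add: psi0_tmon rank1_def)
    qed
    finally show ?case .
  next
    case (2 c d)
    have "\<tau> (Tm (c + d)) (D u 0) = \<tau> (Tm c) (D u 0) + \<tau> (Tm d) (D u 0)"
      using t.ladd_act[of "Tm c" "Tm d", OF _ _ DV] by (simp add: TB_carrier TB_ops(2) del: TB_ops(5))
    also have "\<dots> = D (- (transpose (psi0 B (c + d)) *v u)) 0"
      unfolding 2 by (rule ext)
        (simp add: D_add_left[symmetric] psi0_add mat_distribs matrix_vector_mult_add_rdistrib)
    finally show ?case .
  next
    case (3 a c)
    have "\<tau> (Tm (lscale a c)) (D u 0) = ?s a (\<tau> (Tm c) (D u 0))"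
      using t.lsmult_act[of "Tm c" _ a, OF _ DV] by (simp add: TB_carrier TB_ops(3) del: TB_ops(6))
    also have "\<dots> = D (- (transpose (psi0 B (lscale a c)) *v u)) 0"
    proof -
      have "- (transpose (psi0 B (lscale a c)) *v u) = a *s (- (transpose (psi0 B c) *v u))"
        unfolding psi0_scale mscale_simps(6) mscale_vec by (simp add: vec_eq_iff)
      then show ?thesis unfolding 3 by (simp only: D_scale_left[abs_def])
    qed
    finally show ?case .
  qed
  have "transpose (psi0 B c) *v u = transpose (psi0 B d) *v u" for u
  proof -
    have "D (- (transpose (psi0 B c) *v u)) 0 = D (- (transpose (psi0 B d) *v u)) 0"
      using act[of c u] act[of d u] assms by simp
    \<comment> \<open>A field \<open>D(v, 0)\<close> maps the monomial \<open>t_i\<close> to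
      \<open>v_i t_i\<close>, so its values there determine \<open>v\<close>.\<close>
    then have "D (- (transpose (psi0 B c) *v u)) 0 (tmon (axis i 1)) = D (- (transpose (psi0 B d) *v u)) 0 (tmon (axis i 1))" for i
      by simp
    then have eq: "lscale (- (transpose (psi0 B c) *v u) $ i) (tmon (axis i 1)) = lscale (- (transpose (psi0 B d) *v u) $ i) (tmon (axis i 1))" for i
      by (simp add: D_tmon cvec_simps bform_axis)
    have "(transpose (psi0 B c) *v u) $ i = (transpose (psi0 B d) *v u) $ i" for i
      using arg_cong[where f = "\<lambda>p. Poly_Mapping.lookup p (axis i 1)", OF eq[of i]]
      by (simp add: lookup_lscale tmon_def)
    then show ?thesis by (simp add: vec_eq_iff)
  qed
  then have "transpose (psi0 B c) = transpose (psi0 B d)" by (simp add: matrix_eq)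
  then show ?thesis by (metis transpose_transpose)
qed

definition psi where "psi x = psi0 B (SOME c. x = Tm c)"

lemma psi_Tm: "psi (Tm c) = psi0 B c"
  unfolding psi_def by (rule psi0_well_defined[symmetric], rule someI[of _ c]) simp

lemma sp_ops: "lcarrier (sp_alg B) = {X. B ** X = - (transpose X ** B)}" "lzero (sp_alg B) = 0"
  "ladd (sp_alg B) = (+)" "lsmult (sp_alg B) = mscale" "lbr (sp_alg B) = (\<lambda>X Y. X ** Y - Y ** X)"
  by (simp_all add: sp_alg_def)

lemma is_psi: "is_psi B psi"
proof -
  have "lie_hom (TB B) (sp_alg B) psi"
    unfolding lie_hom_def TB_carrier
    by (auto simp: psi_Tm TB_bracket sp_ops psi0_sp psi0_add psi0_scale psi0_bracket TB_ops(2,3) simp del: TB_ops(4-6))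
  moreover have "psi (T B r) = (\<chi> i j. cvec r $ i * (B *v cvec r) $ j)" for r
    by (simp add: Tm_tmon[symmetric] psi_Tm psi0_tmon rank1_def)
  ultimately show ?thesis by (simp add: is_psi_def)
qed

end


section \<open>The quotient by third differences\<close>

lemma sum_Pow_insert:
  assumes "finite A" "x \<notin> A"
  shows "sum f (Pow (insert x A)) = (\<Sum>S\<in>Pow A. f S + f (insert x S))"
proof -
  have "sum f (Pow (insert x A)) = sum f (Pow A) + sum f (insert x ` Pow A)"
    unfolding Pow_insert by (rule sum.union_disjoint) (use assms in auto)
  also have "sum f (insert x ` Pow A) = (\<Sum>S\<in>Pow A. f (insert x S))"
    by (subst sum.reindex) (use assms in \<open>auto simp: inj_on_def\<close>)
  finally show ?thesis by (simp add: sum.distrib)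
qed

text \<open>In a third difference the term of \<open>S\<close> carries the sign
  \<open>(-1)^(3 - card S)\<close>, which is opposite to \<open>(-1)^card S\<close>.\<close>

lemma alternating_sum_eq_fdiffs:
  "(\<Sum>S\<in>Pow {1, 2, 3 :: nat}. lscale ((- 1) ^ card S) (F (q + (\<Sum>i\<in>S. r i)))) = - fdiffs [r 1, r 2, r 3] F q"
  by (simp add: sum_Pow_insert fdiff_def algebra_simps)

text \<open>The second difference of the symbols at base point 0, up to the term
  \<open>tmon 0\<close>. It is the formal counterpart of a symmetric bilinear form, and
  \<open>[T(a), T(b)]\<close> is \<open>om(a, b)\<close> times it.\<close>

definition beta :: "int ^ 'n::finite \<Rightarrow> int ^ 'n \<Rightarrow> 'n laurent" where
  "beta a b = tmon (a + b) - tmon a - tmon b"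

text \<open>Formal counterpart of the ideal of third differences. The symbol \<open>tmon 0\<close>
  is added because \<open>T(0) = 0\<close>; without it \<open>beta\<close> would be additive only up
  to multiples of \<open>tmon 0\<close>.\<close>

definition M3 :: "'n::finite laurent set" where
  "M3 = lau.span (insert (tmon 0) {fdiffs [a, b, c] tmon q | a b c q. True})"

lemma M3_ops: "0 \<in> M3" "x \<in> M3 \<Longrightarrow> y \<in> M3 \<Longrightarrow> x + y \<in> M3" "x \<in> M3 \<Longrightarrow> y \<in> M3 \<Longrightarrow> x - y \<in> M3"
  "x \<in> M3 \<Longrightarrow> lscale a x \<in> M3" "x \<in> M3 \<Longrightarrow> - x \<in> M3" "tmon 0 \<in> M3"
  by (auto simp: M3_def lau.span_zero intro: lau.span_add lau.span_diff lau.span_scale lau.span_neg lau.span_base)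

lemma M3_sum: "(\<And>i. i \<in> I \<Longrightarrow> f i \<in> M3) \<Longrightarrow> sum f I \<in> M3"
  unfolding M3_def by (rule lau.span_sum)

lemma M3_third: "fdiffs [a, b, c] tmon q \<in> M3"
  unfolding M3_def by (intro lau.span_base) blast

lemma M3_fdiffs:
  assumes "length rs \<ge> 3"
  shows "fdiffs rs tmon q \<in> M3"
proof -
  obtain a b c rs' where rs: "rs = [a, b, c] @ rs'"
    using assms by (cases rs; cases "tl rs"; cases "tl (tl rs)") auto
  show ?thesis
    unfolding rs fdiffs_append
    by (rule fdiffs_closed) (auto intro: M3_ops M3_third simp del: fdiffs_simps)
qed

lemma M3_induct [consumes 1, case_names zero third add scale]:
  assumes "m \<in> M3" "P (tmon 0)" "\<And>a b c q. P (fdiffs [a, b, c] tmon q)"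
    and "\<And>x y. x \<in> M3 \<Longrightarrow> y \<in> M3 \<Longrightarrow> P x \<Longrightarrow> P y \<Longrightarrow> P (x + y)" "\<And>a x. x \<in> M3 \<Longrightarrow> P x \<Longrightarrow> P (lscale a x)"
  shows "P m"
proof -
  have "m \<in> M3 \<and> P m"
    using assms(1) unfolding M3_def
  proof (induction rule: lau.span_induct_alt)
    case base
    have "P (lscale 0 (tmon 0))" by (intro assms M3_ops)
    then show ?case using M3_ops by (simp add: M3_def)
  next
    case (step c x y)
    then have x: "x \<in> M3" "P x"
      using assms(2,3) M3_ops(6) M3_third by auto
    have y: "y \<in> M3" "P y" using step by (auto simp: M3_def)
    have "lscale c x + y \<in> M3" "P (lscale c x + y)"
      using x y by (auto intro!: M3_ops assms(4,5))
    then show ?case by (simp add: M3_def)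
  qed
  then show ?thesis by simp
qed

lemma psi0_M3: "m \<in> M3 \<Longrightarrow> psi0 B m = 0"
proof (induction rule: M3_induct)
  case zero
  then show ?case by (simp add: psi0_tmon rank1_def cvec_simps vec_eq_iff)
next
  case (third a b c q)
  have "psi0 B (fdiffs [a, b, c] tmon q) = fdiffs [a, b, c] (rank1 B) q"
    by (simp add: fdiff_def psi0_minus psi0_tmon)
  also have "\<dots> = 0"
    by (simp add: fdiff_def vec_eq_iff rank1_def cvec_simps matrix_vector_right_distrib algebra_simps)
  finally show ?case .
next
  case (add x y)
  then show ?case by (simp add: psi0_add)
next
  case (scale a x)
  then show ?case by (simp add: psi0_scale vec_eq_iff)
qed

text \<open>The defect of additivity is a third difference at base point 0, apart from one copy of
  \<open>tmon 0\<close>.\<close>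

lemma beta_add_left: "beta (a + a') b - beta a b - beta a' b \<in> M3"
proof -
  have "beta (a + a') b - beta a b - beta a' b = fdiffs [a, a', b] tmon 0 + tmon 0"
    by (simp add: beta_def fdiff_def algebra_simps)
  then show ?thesis by (metis M3_third M3_ops(2,6))
qed

lemma beta_commute: "beta a b = beta b a"
  by (simp add: beta_def add.commute algebra_simps)

text \<open>Subtracting the linear expression leaves a map that is additive modulo \<open>M3\<close>
  and zero on the axis vectors; these generate the lattice.\<close>

lemma additive_mod_M3:
  fixes f :: "int ^ 'n::finite \<Rightarrow> 'n laurent"
  assumes "\<And>a b. f (a + b) - f a - f b \<in> M3"
  shows "f r - (\<Sum>i\<in>UNIV. lscale (of_int (r $ i)) (f (axis i 1))) \<in> M3"
proof -
  let ?h = "\<lambda>r. \<Sum>i\<in>UNIV. lscale (of_int (r $ i)) (f (axis i 1))"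
  let ?g = "\<lambda>r. f r - ?h r"
  have h: "?h (a + b) = ?h a + ?h b" for a b
    by (simp add: lau.scale_left_distrib sum.distrib)
  have g: "?g (a + b) - ?g a - ?g b \<in> M3" for a b
    using assms[of a b] h[of a b] by (simp add: algebra_simps)
  have "r \<in> add_closure (range (\<lambda>i. axis i 1))" by (simp add: add_closure_axis)
  then show ?thesis
  proof induction
    case zero
    then show ?case using M3_ops(5)[OF g[of 0 0]] by simp
  next
    case (base x)
    then obtain i where x: "x = axis i 1" by blast
    have "?h x = f x"
      by (simp add: x axis_def if_distrib[of of_int] if_distrib[of "\<lambda>c. lscale c _"] cong: if_cong)
    then show ?case by (simp add: M3_ops)
  next
    case (minus x y)
    have "?g x - ?g y - (?g ((x - y) + y) - ?g (x - y) - ?g y) \<in> M3"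
      by (rule M3_ops(3)[OF M3_ops(3)[OF minus.IH] g])
    then show ?case by simp
  qed
qed

lemma beta_uminus: "beta (- a) b + beta a b \<in> M3"
proof -
  have "- (beta (- a + a) b - beta (- a) b - beta a b) + beta 0 b \<in> M3"
    by (rule M3_ops(2)[OF M3_ops(5)[OF beta_add_left]]) (simp add: beta_def M3_ops)
  then show ?thesis by (simp add: add.commute)
qed

lemma beta_self: "beta r r - (\<Sum>i\<in>UNIV. \<Sum>j\<in>UNIV. lscale (of_int (r $ i) * of_int (r $ j)) (beta (axis i 1) (axis j 1))) \<in> M3"
proof -
  have 1: "beta r r - (\<Sum>i\<in>UNIV. lscale (of_int (r $ i)) (beta (axis i 1) r)) \<in> M3"
    by (rule additive_mod_M3) (rule beta_add_left)
  have 2: "beta a r - (\<Sum>j\<in>UNIV. lscale (of_int (r $ j)) (beta a (axis j 1))) \<in> M3" for a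
  proof (rule additive_mod_M3)
    show "beta a (x + y) - beta a x - beta a y \<in> M3" for x y
      using beta_add_left[of x y a] by (simp add: beta_commute[of a])
  qed
  have "(\<Sum>i\<in>UNIV. lscale (of_int (r $ i)) (beta (axis i 1) r - (\<Sum>j\<in>UNIV. lscale (of_int (r $ j)) (beta (axis i 1) (axis j 1))))) \<in> M3"
    by (rule M3_sum) (rule M3_ops(4)[OF 2])
  from M3_ops(2)[OF 1 this] show ?thesis
    by (simp add: lau.scale_right_diff_distrib sum_subtractf lau.scale_sum_right)
qed

context skew_form
begin

lemma bt_anti: "bt B c d = - bt B d c"
proof -
  have 1: "bt B (tmon r) d = - bt B d (tmon r)" for r
  proof (induction d rule: laurent_induct)
    case (1 k)
    then show ?case
      using om_skew[OF skew, of r k] by (simp add: bt_tmon add.commute algebra_simps)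
  qed (simp_all add: bt_add_right bt_add_left bt_scale_left bt_scale_right)
  show ?thesis
    by (induction c rule: laurent_induct) (simp_all add: 1 bt_add_right bt_add_left bt_scale_left bt_scale_right)
qed

text \<open>\<open>[T(p), T(s)] = om(p, s) g(p)\<close>, where \<open>g\<close> is a first
  difference in direction \<open>s\<close> minus a constant. By the Leibniz rule a third difference
  in \<open>p\<close> leaves at least two differences on \<open>g\<close>, and these are differences
  of order at least three of the symbols.\<close>

lemma bt_M3: "m \<in> M3 \<Longrightarrow> bt B m d \<in> M3"
proof -
  have bt_third: "bt B (fdiffs rs tmon q) (tmon s) \<in> M3" if rs: "length rs = 3" for rs q s
  proof -
    let ?g = "\<lambda>p. tmon (p + s) - tmon p - tmon s"
    have g: "fdiffs xs ?g p \<in> M3" if "length xs \<ge> 2" for xs p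
    proof -
      have "?g = (\<lambda>p. fdiff s tmon p - tmon s)" by (simp add: fdiff_def)
      moreover have "xs \<noteq> []" using that by auto
      ultimately have "fdiffs xs ?g p = fdiffs (s # xs) tmon p"
        by (simp add: fdiffs_minus fdiffs_const)
      then show ?thesis using M3_fdiffs[of "s # xs" p] that by simp
    qed
    have "bt B (fdiffs rs tmon q) (tmon s) = fdiffs rs (\<lambda>p. bt B (tmon p) (tmon s)) q"
      using fun_cong[OF fdiffs_hom_on[of UNIV "\<lambda>x. bt B x (tmon s)" tmon rs], of q] by (simp add: bt_minus)
    also have "\<dots> = lscale (om B q s) (fdiffs rs ?g q) +
        (\<Sum>i<length rs. lscale (om B (rs ! i) s) (fdiffs (take i rs @ drop (Suc i) rs) ?g (q + rs ! i)))"
      unfolding bt_tmon by (rule lau.fdiffs_leibniz) (rule om_simps)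
    also have "\<dots> \<in> M3"
      using rs by (intro M3_ops M3_sum g) auto
    finally show ?thesis .
  qed
  show "m \<in> M3 \<Longrightarrow> bt B m d \<in> M3"
  proof (induction d rule: laurent_induct)
    case (1 k)
    then show ?case
    proof (induction rule: M3_induct)
      case zero
      then show ?case by (simp add: bt_tmon om_simps M3_ops)
    next
      case (third a b c q)
      show ?case by (rule bt_third) simp
    qed (simp_all add: bt_add_left bt_scale_left M3_ops)
  qed (simp_all add: bt_add_right bt_scale_right M3_ops)
qed

lemma bt_M3_right: "m \<in> M3 \<Longrightarrow> bt B d m \<in> M3"
  using bt_anti[of d m] bt_M3[of m d] by (simp add: M3_ops)

lemma Tm_cong_add: "Tm a = Tm b \<Longrightarrow> Tm (a + c) = Tm (b + c)"
  using jet_lie_ops(2) by metis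

lemma finsum_Tm: "finite A \<Longrightarrow> finsum (jet_alg B) (\<lambda>x. Tm (f x)) A = Tm (sum f A)"
proof (induction A rule: finite_induct)
  interpret R: ring "jet_alg B" by (rule ring_jet)
  case empty
  then show ?case by (simp add: Tm_zero)
next
  interpret R: ring "jet_alg B" by (rule ring_jet)
  case (insert x A)
  have "Tm c \<in> carrier (jet_alg B)" for c by (simp add: Tm_def jet_carrier Tm0_FA)
  then show ?case using insert jet_lie_ops(2) by (simp add: jet_lie_def)
qed

lemma third_diff_eq: "third_diff B q r = Tm (- fdiffs [r 1, r 2, r 3] tmon q)"
proof -
  have "third_diff B q r = Tm (\<Sum>S\<in>Pow {1, 2, 3 :: nat}. lscale ((- 1) ^ card S) (tmon (q + (\<Sum>i\<in>S. r i))))"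
    unfolding third_diff_def Tm_tmon[symmetric] jet_lie_ops(3) by (rule finsum_Tm) simp
  then show ?thesis by (simp only: alternating_sum_eq_fdiffs)
qed

lemma I3_eq: "I3 B = Tm ` M3"
proof
  show "I3 B \<subseteq> Tm ` M3"
  proof
    fix x assume "x \<in> I3 B"
    then show "x \<in> Tm ` M3"
      unfolding I3_def
    proof (induction rule: lspan.induct)
      case zero
      then show ?case by (auto simp: TB_ops(1) M3_ops)
    next
      case (base x)
      then show ?case by (auto simp: third_diff_eq intro!: imageI M3_ops M3_third simp del: fdiffs_simps)
    next
      case (add x y)
      then show ?case by (auto simp: TB_ops(2) M3_ops simp del: TB_ops(5))
    next
      case (smult x c)
      then show ?case by (auto simp: TB_ops(3) M3_ops simp del: TB_ops(6))
    qed
  qed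
  show "Tm ` M3 \<subseteq> I3 B"
  proof clarify
    fix m :: "'n laurent" assume "m \<in> M3"
    then show "Tm m \<in> I3 B"
    proof (induction rule: M3_induct)
      case zero
      then show ?case using lspan.zero[of "TB B"] by (simp add: I3_def Tm_tmon T_zero TB_ops(1))
    next
      case (third a b c q)
      define r where "r i = (if i = 1 then a else if i = 2 then b else c)" for i :: nat
      have "third_diff B q r \<in> I3 B" unfolding I3_def by (rule lspan.base) blast
      then have "lsmult (TB B) (-1) (Tm (- fdiffs [a, b, c] tmon q)) \<in> I3 B"
        unfolding I3_def third_diff_eq by (intro lspan.smult) (simp add: r_def)
      then show ?case unfolding TB_ops(3) by simp
    next
      case (add x y)
      then show ?case unfolding TB_ops(2)[symmetric] I3_def by (intro lspan.add)
    next
      case (scale a x)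
      then show ?case unfolding TB_ops(3)[symmetric] I3_def by (intro lspan.smult)
    qed
  qed
qed

text \<open>The kernel of the map from formal combinations to
  \<open>\<T>\<^sub>B / I\<^sub>3\<close>. It consists of \<open>M3\<close> together with whatever
  relations hold among the \<open>T(r)\<close>; equality of cosets is decided by it.\<close>

definition N3 :: "'n laurent set" where
  "N3 = {c. Tm c \<in> Tm ` M3}"

lemma N3_ops: "0 \<in> N3" "x \<in> N3 \<Longrightarrow> y \<in> N3 \<Longrightarrow> x + y \<in> N3" "x \<in> N3 \<Longrightarrow> lscale a x \<in> N3"
proof -
  show "0 \<in> N3" using M3_ops(1) by (auto simp: N3_def)
  show "x + y \<in> N3" if xy: "x \<in> N3" "y \<in> N3"
  proof -
    obtain m m' where m: "m \<in> M3" "m' \<in> M3" "Tm x = Tm m" "Tm y = Tm m'" using xy by (auto simp: N3_def)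
    have "Tm (x + y) = Tm (m + m')" by (simp only: jet_lie_ops(2)[symmetric] m(3,4))
    then show ?thesis using M3_ops(2)[OF m(1,2)] by (auto simp: N3_def)
  qed
  show "lscale a x \<in> N3" if x: "x \<in> N3"
  proof -
    obtain m where m: "m \<in> M3" "Tm x = Tm m" using x by (auto simp: N3_def)
    have "Tm (lscale a x) = Tm (lscale a m)" by (simp only: jet_lie_ops(3)[symmetric] m(2))
    then show ?thesis using M3_ops(4)[OF m(1)] by (auto simp: N3_def)
  qed
qed

lemma N3_minus: "x \<in> N3 \<Longrightarrow> y \<in> N3 \<Longrightarrow> x - y \<in> N3"
  using N3_ops(2)[of x "lscale (-1) y"] N3_ops(3)[of y "-1"] by simp

lemma M3_N3: "m \<in> M3 \<Longrightarrow> m \<in> N3"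
  by (auto simp: N3_def)

lemma psi0_N3: "c \<in> N3 \<Longrightarrow> psi0 B c = 0"
proof -
  assume "c \<in> N3"
  then obtain m where "m \<in> M3" "Tm c = Tm m" by (auto simp: N3_def)
  then show ?thesis using psi0_well_defined[of c m] psi0_M3[of m B] by simp
qed

definition Q :: "'n laurent \<Rightarrow> _ set" where
  "Q c = lie_coset (TB B) (I3 B) (Tm c)"

lemma Q_eq: "Q c = (\<lambda>m. Tm (c + m)) ` M3"
proof -
  have "Q c = (\<lambda>m. ladd (TB B) (Tm c) (Tm m)) ` M3"
    unfolding Q_def lie_coset_def I3_eq by blast
  then show ?thesis by (simp only: TB_ops(2))
qed

lemma Q_cong: "Q c = Q d \<longleftrightarrow> c - d \<in> N3"
proof
  assume "Q c = Q d"
  moreover have "Tm (c + 0) \<in> Q c" unfolding Q_eq using M3_ops(1) by blast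
  ultimately obtain m where "m \<in> M3" "Tm c = Tm (d + m)" unfolding Q_eq[of d] by auto
  then show "c - d \<in> N3" using Tm_cong_add[of c "d + m" "- d"] by (auto simp: N3_def)
next
  have sub: "Q c \<subseteq> Q d" if cd: "c - d \<in> N3" for c d
  proof -
    obtain m where m: "m \<in> M3" "Tm (c - d) = Tm m" using cd by (auto simp: N3_def)
    have "Tm (c + m') = Tm (d + (m + m'))" for m'
      using Tm_cong_add[OF m(2), of "d + m'"] by (simp add: algebra_simps)
    then have "Tm (c + m') \<in> Q d" if "m' \<in> M3" for m'
      unfolding Q_eq using M3_ops(2)[OF m(1) that] by (metis imageI)
    then show ?thesis unfolding Q_eq[of c] by blast
  qed
  assume "c - d \<in> N3"
  then have "c - d \<in> N3" "d - c \<in> N3" using N3_minus[OF N3_ops(1), of "c - d"] by auto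
  then show "Q c = Q d" using sub by blast
qed

abbreviation "QL \<equiv> lie_quot (TB B) (I3 B)"

lemma Q_UN:
  assumes "\<And>m m'. m \<in> M3 \<Longrightarrow> m' \<in> M3 \<Longrightarrow> F (Tm (c + m)) (Tm (d + m')) = E"
  shows "(\<Union>x\<in>Q c. \<Union>y\<in>Q d. F x y) = E"
  using assms M3_ops(1) by (auto simp: Q_eq)

lemma QL_ops: "lcarrier QL = range Q" "lzero QL = Q 0" "ladd QL (Q c) (Q d) = Q (c + d)"
  "lsmult QL a (Q c) = Q (lscale a c)" "lbr QL (Q c) (Q d) = Q (bt B c d)"
proof -
  show "lcarrier QL = range Q" by (auto simp: lie_quot_def TB_carrier Q_def)
  show "lzero QL = Q 0" by (simp add: lie_quot_def Q_eq I3_eq)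
  have "(\<Union>x\<in>Q c. \<Union>y\<in>Q d. lie_coset (TB B) (I3 B) (ladd (TB B) x y)) = Q (c + d)"
  proof (rule Q_UN)
    fix m m' :: "'n laurent" assume "m \<in> M3" "m' \<in> M3"
    then have "(c + m + (d + m')) - (c + d) \<in> N3" by (auto intro!: M3_N3 M3_ops)
    then show "lie_coset (TB B) (I3 B) (ladd (TB B) (Tm (c + m)) (Tm (d + m'))) = Q (c + d)"
      unfolding TB_ops(2) Q_cong[symmetric] Q_def .
  qed
  then show "ladd QL (Q c) (Q d) = Q (c + d)" by (simp add: lie_quot_def)
  have "(\<Union>x\<in>Q c. \<Union>y\<in>Q d. lie_coset (TB B) (I3 B) (lbr (TB B) x y)) = Q (bt B c d)"
  proof (rule Q_UN)
    fix m m' :: "'n laurent" assume m: "m \<in> M3" "m' \<in> M3"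
    have "bt B (c + m) (d + m') - bt B c d = bt B c m' + bt B m (d + m')"
      by (simp add: bt_add_left bt_add_right)
    also have "\<dots> \<in> M3" using m by (intro M3_ops bt_M3 bt_M3_right)
    finally have "bt B (c + m) (d + m') - bt B c d \<in> N3" by (rule M3_N3)
    then show "lie_coset (TB B) (I3 B) (lbr (TB B) (Tm (c + m)) (Tm (d + m'))) = Q (bt B c d)"
      unfolding TB_bracket Q_cong[symmetric] Q_def .
  qed
  then show "lbr QL (Q c) (Q d) = Q (bt B c d)" by (simp add: lie_quot_def)
  \<comment> \<open>The scalar multiple of a coset is a union over one coset only; the second union
    is a dummy over a non-empty set, added to match \<open>Q_UN\<close>.\<close>
  have "(\<Union>x\<in>Q c. \<Union>y\<in>Q 0. lie_coset (TB B) (I3 B) (lsmult (TB B) a x)) = Q (lscale a c)"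
  proof (rule Q_UN)
    fix m m' :: "'n laurent" assume "m \<in> M3" "m' \<in> M3"
    then have "lscale a (c + m) - lscale a c \<in> N3" by (auto simp: lau.scale_right_distrib intro!: M3_N3 M3_ops)
    then show "lie_coset (TB B) (I3 B) (lsmult (TB B) a (Tm (c + m))) = Q (lscale a c)"
      unfolding TB_ops(3) Q_cong[symmetric] Q_def .
  qed
  moreover have "Q 0 \<noteq> {}" using M3_ops(1) by (auto simp: Q_eq)
  ultimately show "lsmult QL a (Q c) = Q (lscale a c)" by (simp add: lie_quot_def)
qed

abbreviation "RL \<equiv> R_alg B psi"

lemma RL_ops: "lcarrier RL = Q ` {c. psi0 B c = 0}" "lzero RL = Q 0" "ladd RL (Q c) (Q d) = Q (c + d)"
  "lsmult RL a (Q c) = Q (lscale a c)" "lbr RL (Q c) (Q d) = Q (bt B c d)"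
proof -
  have co: "lie_coset (lie_restrict (TB B) S) I x = lie_coset (TB B) I x" for S I x
    by (simp add: lie_coset_def lie_restrict_def)
  have eq: "lzero RL = lzero QL" "ladd RL = ladd QL" "lsmult RL = lsmult QL" "lbr RL = lbr QL"
    unfolding R_alg_def lie_quot_def co by (simp_all add: lie_restrict_def)
  show "lcarrier RL = Q ` {c. psi0 B c = 0}"
    unfolding R_alg_def lie_quot_def co
    by (auto simp: lie_restrict_def lie_ker_def TB_carrier psi_Tm sp_ops Q_def)
  show "lzero RL = Q 0" "ladd RL (Q c) (Q d) = Q (c + d)"
    "lsmult RL a (Q c) = Q (lscale a c)" "lbr RL (Q c) (Q d) = Q (bt B c d)"
    unfolding eq by (rule QL_ops)+
qed

end


section \<open>Splitting the quotient\<close>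

lemma matrix_axis: "(A *v axis j 1) $ l = (A :: complex ^ 'n ^ 'm) $ l $ j"
  by (simp add: matrix_vector_mult_def axis_def if_distrib[of "\<lambda>x. _ * x"] cong: if_cong)

locale symplectic_form = skew_form B for B :: "complex ^ 'n ^ 'n::finite" +
  assumes nondeg: "det B \<noteq> 0"
begin

lemma row_sum: "(\<Sum>l\<in>UNIV. x $ l * B $ l $ j) = - (B *v x) $ j"
proof -
  have "(\<Sum>l\<in>UNIV. x $ l * B $ l $ j) = (transpose B *v x) $ j"
    by (simp add: matrix_vector_mult_def transpose_def mult.commute)
  then show ?thesis by (simp add: skew uminus_mult_vec)
qed

lemma B_inv: "B ** matrix_inv B = mat 1" "matrix_inv B ** B = mat 1"
proof -
  have "\<exists>A. B ** A = mat 1 \<and> A ** B = mat 1"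
    using nondeg by (simp add: invertible_det_nz[symmetric] invertible_def)
  then have "B ** matrix_inv B = mat 1 \<and> matrix_inv B ** B = mat 1"
    unfolding matrix_inv_def by (rule someI_ex)
  then show "B ** matrix_inv B = mat 1" "matrix_inv B ** B = mat 1" by auto
qed

lemma B_cancel_left: "B ** X = B ** Y \<Longrightarrow> X = Y" for X Y :: "complex ^ 'n ^ 'n"
proof -
  assume "B ** X = B ** Y"
  then have "matrix_inv B ** (B ** X) = matrix_inv B ** (B ** Y)" by simp
  then show ?thesis by (simp add: matrix_mul_assoc B_inv)
qed

lemma B_cancel_right: "X ** B = Y ** B \<Longrightarrow> X = Y" for X Y :: "complex ^ 'n ^ 'n"
proof -
  assume "X ** B = Y ** B"
  then have "X ** B ** matrix_inv B = Y ** B ** matrix_inv B" by simp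
  then show ?thesis by (simp add: matrix_mul_assoc[symmetric] B_inv)
qed

text \<open>A linear section of \<open>\<psi>\<close>: an element of \<open>sp\<close> has the form \<open>X = - S B\<close> with \<open>S\<close> symmetric, and
  \<open>r (Br)\<^sup>T = - (r r\<^sup>T) B\<close>.\<close>

definition sig :: "complex ^ 'n ^ 'n \<Rightarrow> 'n laurent" where
  "sig X = (\<Sum>i\<in>UNIV. \<Sum>j\<in>UNIV. lscale (- (X ** matrix_inv B) $ i $ j / 2) (beta (axis i 1) (axis j 1)))"

lemma sig_add: "sig (X + Y) = sig X + sig Y"
proof -
  have "- ((X + Y) ** matrix_inv B) $ i $ j / 2 = - (X ** matrix_inv B) $ i $ j / 2 + - (Y ** matrix_inv B) $ i $ j / 2" for i j
    by (simp add: mat_distribs diff_divide_distrib)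
  then show ?thesis unfolding sig_def by (simp only: lau.scale_left_distrib sum.distrib)
qed

lemma sig_scale: "sig (mscale a X) = lscale a (sig X)"
  by (simp add: sig_def mscale_mult lau.scale_sum_right)

lemma sig_minus: "sig (X - Y) = sig X - sig Y"
  using sig_add[of "X - Y" Y] by simp

lemma sig_0: "sig 0 = 0"
  using sig_minus[of 0 0] by simp

lemma psi0_sum: "psi0 B (sum f I) = (\<Sum>i\<in>I. psi0 B (f i))"
  by (induction I rule: infinite_finite_induct) (simp_all add: psi0_0 psi0_add)

lemma psi0_sig:
  assumes X: "B ** X = - (transpose X ** B)"
  shows "psi0 B (sig X) = X"
proof -
  \<comment> \<open>The condition defining the symplectic algebra becomes
    \<open>B S B = B S^T B\<close> for \<open>X = - S B\<close>, that is, symmetry of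
    \<open>S\<close>.\<close>
  define S where "S = - (X ** matrix_inv B)"
  have XS: "X = - (S ** B)"
    by (simp add: S_def mat_distribs matrix_mul_assoc[symmetric] B_inv)
  have "B ** (S ** B) = B ** (transpose S ** B)"
    using X unfolding XS by (simp add: mat_distribs matrix_transpose_mul skew matrix_mul_assoc)
  then have "S ** B = transpose S ** B" by (rule B_cancel_left)
  then have sym: "S = transpose S" by (rule B_cancel_right)
  have Sij: "S $ i $ j = S $ j $ i" for i j using arg_cong[OF sym, of "\<lambda>A. A $ i $ j"] by (simp add: transpose_def)
  \<comment> \<open>This is the polarised matrix \<open>e_i (B e_j)^T + e_j (B e_i)^T\<close>. For
    symmetric \<open>S\<close> its two terms contribute equally, which the factor 1/2 in
    \<open>sig\<close> compensates.\<close>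
  have pb: "psi0 B (beta (axis i 1) (axis j 1)) $ k $ l =
    (if i = k then B $ l $ j else 0) + (if j = k then B $ l $ i else 0)" for i j k l
    by (simp add: beta_def psi0_minus psi0_tmon rank1_add cvec_simps matrix_axis)
      (simp add: axis_def)
  have "- (X ** matrix_inv B) $ i $ j / 2 = S $ i $ j / 2" for i j by (simp add: S_def)
  then have sigS: "sig X = (\<Sum>i\<in>UNIV. \<Sum>j\<in>UNIV. lscale (S $ i $ j / 2) (beta (axis i 1) (axis j 1)))"
    unfolding sig_def by (simp only:)
  have "psi0 B (sig X) $ k $ l = X $ k $ l" for k l
  proof -
    have "psi0 B (sig X) $ k $ l = (\<Sum>i\<in>UNIV. \<Sum>j\<in>UNIV. S $ i $ j / 2 *
      ((if i = k then B $ l $ j else 0) + (if j = k then B $ l $ i else 0)))"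
      unfolding sigS by (simp only: psi0_sum psi0_scale sum_component vec_lambda_beta pb)
    also have "\<dots> = (\<Sum>i\<in>UNIV. \<Sum>j\<in>UNIV. if i = k then S $ i $ j / 2 * B $ l $ j else 0) +
      (\<Sum>i\<in>UNIV. \<Sum>j\<in>UNIV. if j = k then S $ i $ j / 2 * B $ l $ i else 0)"
      by (simp only: sum.distrib[symmetric]) (intro sum.cong refl, simp)
    also have "(\<Sum>i\<in>UNIV. \<Sum>j\<in>UNIV. if i = k then S $ i $ j / 2 * B $ l $ j else 0) =
      (\<Sum>j\<in>UNIV. \<Sum>i\<in>UNIV. if i = k then S $ i $ j / 2 * B $ l $ j else 0)"
      by (rule sum.swap)
    also have "\<dots> + (\<Sum>i\<in>UNIV. \<Sum>j\<in>UNIV. if j = k then S $ i $ j / 2 * B $ l $ i else 0) =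
      (\<Sum>j\<in>UNIV. S $ k $ j * B $ l $ j)"
      by (simp add: Sij[of _ k] sum.distrib[symmetric] mult.commute)
    also have "\<dots> = X $ k $ l"
    proof -
      have "B $ l $ j = - B $ j $ l" for j using arg_cong[OF skew, of "\<lambda>A. A $ j $ l"] by (simp add: transpose_def)
      then have "(\<Sum>j\<in>UNIV. S $ k $ j * B $ l $ j) = (\<Sum>j\<in>UNIV. S $ k $ j * - B $ j $ l)" by metis
      then show ?thesis by (simp add: XS matrix_matrix_mult_def sum_negf)
    qed
    finally show ?thesis .
  qed
  then show ?thesis by (simp add: vec_eq_iff)
qed

text \<open>The projection onto the kernel of \<open>psi0\<close> along the image of the section
  \<open>sig\<close>; it becomes the component in \<open>R\<close> of the splitting.\<close>

definition lam :: "'n laurent \<Rightarrow> 'n laurent" where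
  "lam c = c - sig (psi0 B c)"

lemma lam_add: "lam (c + d) = lam c + lam d"
  and lam_minus: "lam (c - d) = lam c - lam d"
  and lam_scale: "lam (lscale a c) = lscale a (lam c)"
  by (simp_all add: lam_def psi0_add psi0_minus psi0_scale sig_add sig_minus sig_scale lau.scale_right_diff_distrib)

lemma lam_ker: "psi0 B c = 0 \<Longrightarrow> lam c = c"
  by (simp add: lam_def sig_0)

lemma psi0_lam: "psi0 B (lam c) = 0"
  by (simp add: lam_def psi0_minus psi0_sig psi0_sp)

text \<open>Modulo \<open>M3\<close> the section takes \<open>r (Br)^T\<close> to half the quadratic
  expansion of \<open>beta r r\<close>, hence to \<open>(T(r) + T(-r)) / 2\<close>, the even part.
  Subtracting it from \<open>T(r)\<close> leaves the odd part.\<close>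

lemma lam_tmon: "lam (tmon r) - lscale (1 / 2) (tmon r - tmon (- r)) \<in> M3"
proof -
  let ?b = "\<Sum>i\<in>UNIV. \<Sum>j\<in>UNIV. lscale (of_int (r $ i) * of_int (r $ j)) (beta (axis i 1) (axis j 1))"
  have "rank1 B r = - ((\<chi> i j. cvec r $ i * cvec r $ j) ** B)"
    by (simp add: vec_eq_iff rank1_def matrix_matrix_mult_def mult.assoc sum_distrib_left[symmetric] row_sum)
  then have eq: "- (rank1 B r ** matrix_inv B) = (\<chi> i j. cvec r $ i * cvec r $ j)"
    by (simp add: mat_distribs matrix_mul_assoc[symmetric] B_inv)
  have "- (rank1 B r ** matrix_inv B) $ i $ j = of_int (r $ i) * of_int (r $ j)" for i j
    using arg_cong[OF eq, of "\<lambda>A. A $ i $ j"] by (simp add: cvec_def)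
  then have sig: "sig (rank1 B r) = lscale (1 / 2) ?b"
    by (simp add: sig_def lau.scale_sum_right)
  \<comment> \<open>The third difference on the points \<open>-r\<close>, 0, \<open>r\<close>,
    \<open>2r\<close>: it identifies \<open>beta r r\<close>, which is
    \<open>T(2r) - 2 T(r)\<close>, with \<open>T(r) + T(-r)\<close> modulo
    \<open>M3\<close>.\<close>
  have "fdiffs [r, r, r] tmon (- r) = beta r r - tmon r - tmon (- r) + lscale 3 (tmon 0)"
  proof -
    have "lscale 3 x = x + x + x" for x :: "'n laurent"
      using lau.scale_left_distrib[of 2 1 x] lau.scale_left_distrib[of 1 1 x] by simp
    then show ?thesis by (simp add: fdiff_def beta_def algebra_simps)
  qed
  then have "beta r r - tmon r - tmon (- r) = fdiffs [r, r, r] tmon (- r) - lscale 3 (tmon 0)"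
    by simp
  then have 1: "beta r r - tmon r - tmon (- r) \<in> M3"
    using M3_ops(3)[OF M3_third M3_ops(4)[OF M3_ops(6)]] by metis
  have "lam (tmon r) - lscale (1 / 2) (tmon r - tmon (- r)) =
    lscale (1 / 2) ((beta r r - ?b) - (beta r r - tmon r - tmon (- r)))"
  proof -
    have "c - lscale (1 / 2) b - lscale (1 / 2) (c - d) = lscale (1 / 2) ((e - b) - (e - c - d))"
      for b c d e :: "'n laurent"
      by (rule poly_mapping_eqI) (simp only: lookup_lscale lookup_minus, simp add: field_simps)
    then show ?thesis unfolding lam_def psi0_tmon sig by blast
  qed
  then show ?thesis
    by (simp only: M3_ops(4)[OF M3_ops(3)[OF beta_self 1]])
qed

text \<open>The odd part of \<open>T(r)\<close> has bracket with \<open>T(s)\<close> equal to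
  \<open>om(r, s) / 2\<close> times \<open>beta(r, s) + beta(-r, s)\<close>, which additivity of
  \<open>beta\<close> kills. Hence the component in \<open>R\<close> is central.\<close>

lemma bt_lam: "bt B (lam c) d \<in> M3"
proof -
  have 1: "bt B (lam (tmon r)) (tmon s) \<in> M3" for r s
  proof -
    let ?h = "lscale (1 / 2) (tmon r - tmon (- r))"
    have "bt B ?h (tmon s) = lscale (om B r s / 2) (beta (- r) s + beta r s)"
      by (rule poly_mapping_eqI)
        (simp only: bt_scale_left bt_minus bt_tmon om_simps beta_def lookup_lscale lookup_minus lookup_add,
          simp add: algebra_simps)
    also have "\<dots> \<in> M3" by (intro M3_ops beta_uminus)
    finally have "bt B (lam (tmon r) - ?h) (tmon s) + bt B ?h (tmon s) \<in> M3"
      using bt_M3[OF lam_tmon] M3_ops(2) by blast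
    then show ?thesis by (simp add: bt_minus)
  qed
  have 2: "bt B (lam (tmon r)) d \<in> M3" for r
    by (induction d rule: laurent_induct) (simp_all add: 1 bt_add_right bt_scale_right M3_ops)
  show ?thesis
    by (induction c rule: laurent_induct) (simp_all add: 2 lam_add lam_scale bt_add_left bt_scale_left M3_ops)
qed

text \<open>A bracket is a multiple of \<open>beta(r, s)\<close>, whose odd part is half of
  \<open>beta(r, s) - beta(-r, -s)\<close> and vanishes modulo \<open>M3\<close> by biadditivity. So
  \<open>lam\<close> induces a homomorphism to an abelian Lie algebra.\<close>

lemma lam_bt: "lam (bt B c d) \<in> M3"
proof -
  have 1: "lam (bt B (tmon r) (tmon s)) \<in> M3" for r s
  proof -
    let ?h = "\<lambda>r. lscale (1 / 2) (tmon r - tmon (- r))"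
    have "beta (- r) (- s) - beta r s = (beta (- r) (- s) + beta r (- s)) - (beta (- s) r + beta s r)"
      by (simp add: beta_commute[of r])
    also have "\<dots> \<in> M3" by (intro M3_ops(3) beta_uminus)
    finally have "beta r s - beta (- r) (- s) \<in> M3" using M3_ops(5) by fastforce
    moreover have "?h (r + s) - ?h r - ?h s = lscale (1 / 2) (beta r s - beta (- r) (- s))"
      by (simp only: lau.scale_right_diff_distrib[symmetric] beta_def) (simp add: algebra_simps)
    ultimately have "?h (r + s) - ?h r - ?h s \<in> M3" by (simp only: M3_ops(4))
    then have "((lam (tmon (r + s)) - ?h (r + s)) - (lam (tmon r) - ?h r) - (lam (tmon s) - ?h s)) +
      (?h (r + s) - ?h r - ?h s) \<in> M3"
      by (rule M3_ops(2)[OF M3_ops(3)[OF M3_ops(3)[OF lam_tmon lam_tmon] lam_tmon]])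
    then have "lam (tmon (r + s)) - lam (tmon r) - lam (tmon s) \<in> M3"
      by (simp only: algebra_simps) (simp add: algebra_simps)
    then show ?thesis by (simp add: bt_tmon lam_scale lam_minus M3_ops)
  qed
  have 2: "lam (bt B (tmon r) d) \<in> M3" for r
    by (induction d rule: laurent_induct) (simp_all add: 1 lam_add lam_scale bt_add_right bt_scale_right M3_ops)
  show ?thesis
    by (induction c rule: laurent_induct) (simp_all add: 2 lam_add lam_scale bt_add_left bt_scale_left M3_ops)
qed

definition Theta where
  "Theta Y = (let c = SOME c. Y = Q c in (psi0 B c, Q (lam c)))"

lemma Theta_Q: "Theta (Q c) = (psi0 B c, Q (lam c))"
proof -
  define d where "d = (SOME d. Q c = Q d)"
  have "Q c = Q d" unfolding d_def by (rule someI[of _ c]) simp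
  then have n: "c - d \<in> N3" by (simp add: Q_cong)
  then have "psi0 B (c - d) = 0" by (rule psi0_N3)
  then have "psi0 B c = psi0 B d" "lam c - lam d \<in> N3"
    using n by (simp_all add: psi0_minus lam_minus[symmetric] lam_ker)
  then have "psi0 B c = psi0 B d" "Q (lam c) = Q (lam d)" by (simp_all add: Q_cong)
  then show ?thesis unfolding Theta_def Let_def d_def[symmetric] by simp
qed

abbreviation "SR \<equiv> lie_sum (sp_alg B) RL"

lemma SR_ops: "lcarrier SR = {X. B ** X = - (transpose X ** B)} \<times> Q ` {c. psi0 B c = 0}"
  "lzero SR = (0, Q 0)" "ladd SR (X, Y) (X', Y') = (X + X', ladd RL Y Y')"
  "lsmult SR a (X, Y) = (mscale a X, lsmult RL a Y)"
  "lbr SR (X, Y) (X', Y') = (X ** X' - X' ** X, lbr RL Y Y')"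
  by (simp_all add: lie_sum_def sp_ops RL_ops)

lemma Q_M3: "m \<in> M3 \<Longrightarrow> Q m = Q 0"
  by (simp add: Q_cong M3_N3)

lemma Theta_iso: "lie_iso QL SR Theta"
  unfolding lie_iso_def lie_hom_def QL_ops(1)
proof (intro conjI ballI allI)
  fix x y a assume "x \<in> range Q" "y \<in> range Q"
  then obtain c d where [simp]: "x = Q c" "y = Q d" by blast
  show "Theta x \<in> lcarrier SR" by (simp add: Theta_Q SR_ops psi0_sp psi0_lam)
  show "Theta (ladd QL x y) = ladd SR (Theta x) (Theta y)"
    by (simp add: QL_ops Theta_Q SR_ops RL_ops psi0_add lam_add)
  show "Theta (lsmult QL a x) = lsmult SR a (Theta x)"
    by (simp add: QL_ops Theta_Q SR_ops RL_ops psi0_scale lam_scale)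
  \<comment> \<open>The components in \<open>R\<close> of both sides are zero, the left one because
    \<open>lam\<close> kills brackets, the right one because values of \<open>lam\<close> are
    central.\<close>
  show "Theta (lbr QL x y) = lbr SR (Theta x) (Theta y)"
    by (simp add: QL_ops Theta_Q SR_ops RL_ops psi0_bracket Q_M3[OF lam_bt] Q_M3[OF bt_lam])
next
  show "bij_betw Theta (range Q) (lcarrier SR)"
  proof (rule bij_betw_imageI)
    show "inj_on Theta (range Q)"
    proof (rule inj_onI)
      fix x y assume "x \<in> range Q" "y \<in> range Q" and eq: "Theta x = Theta y"
      then obtain c d where xy: "x = Q c" "y = Q d" by blast
      have e: "psi0 B c = psi0 B d" "lam c - lam d \<in> N3" using eq by (simp_all add: xy Theta_Q Q_cong)
      then have "psi0 B (c - d) = 0" by (simp add: psi0_minus)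
      then have "c - d \<in> N3" using e(2) by (simp add: lam_minus[symmetric] lam_ker)
      then show "x = y" by (simp add: xy Q_cong)
    qed
    have "(X, Q k) \<in> Theta ` range Q" if "B ** X = - (transpose X ** B)" "psi0 B k = 0" for X k
    proof -
      \<comment> \<open>\<open>sig X + k\<close> is the preimage: \<open>psi0\<close> sees
        \<open>sig X\<close> only, and removing \<open>sig X\<close> again leaves
        \<open>k\<close>.\<close>
      have p: "psi0 B (sig X + k) = X" using that by (simp add: psi0_add psi0_sig)
      have "Theta (Q (sig X + k)) = (X, Q k)" unfolding Theta_Q p by (simp add: lam_def p)
      then show ?thesis by (metis rangeI imageI)
    qed
    then show "Theta ` range Q = lcarrier SR"
      by (auto simp: SR_ops Theta_Q psi0_sp psi0_lam)
  qed
qed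

lemma identification: "is_identification B psi Theta"
  unfolding is_identification_def
  using Theta_iso
  by (auto simp: TB_carrier Q_def[symmetric] Theta_Q psi_Tm RL_ops lam_ker)

lemma I3_ker: "I3 B \<subseteq> lie_ker (TB B) (sp_alg B) psi"
  by (auto simp: I3_eq lie_ker_def TB_carrier psi_Tm psi0_M3 sp_ops)

lemma RL_central: "lcarrier RL \<subseteq> lie_center QL"
proof -
  have "Q (bt B c d) = Q 0" if "psi0 B c = 0" for c d
    using Q_M3[OF bt_lam[of c d]] lam_ker[OF that] by simp
  then show ?thesis by (auto simp: lie_center_def QL_ops RL_ops)
qed

lemma RL_central_sum: "{0} \<times> lcarrier RL \<subseteq> lie_center SR"
proof -
  have "Q (bt B c d) = Q 0" if "psi0 B c = 0" for c d
    using Q_M3[OF bt_lam[of c d]] lam_ker[OF that] by simp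
  moreover have "transpose 0 ** B = 0" "B ** 0 = 0" "0 ** X = 0" "X ** 0 = 0" for X :: "complex ^ 'n ^ 'n"
    by (simp_all add: vec_eq_iff matrix_matrix_mult_def transpose_def)
  ultimately show ?thesis by (auto simp: lie_center_def SR_ops RL_ops)
qed

definition Phi where "Phi x = Theta (lie_coset (TB B) (I3 B) x)"

lemma Phi_Tm: "Phi (Tm c) = Theta (Q c)"
  by (simp add: Phi_def Q_def)

lemma Phi_hom: "lie_hom (TB B) SR Phi" and Phi_surj: "Phi ` lcarrier (TB B) = lcarrier SR"
proof -
  show "Phi ` lcarrier (TB B) = lcarrier SR"
    using Theta_iso by (auto simp: lie_iso_def bij_betw_def QL_ops TB_carrier image_image Phi_Tm)
  show "lie_hom (TB B) SR Phi"
    using Theta_iso unfolding lie_iso_def lie_hom_def TB_carrier QL_ops(1)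
    by (auto simp: Phi_Tm TB_ops(2,3) TB_bracket QL_ops simp del: TB_ops(4-6))
qed

lemma Phi_eqD: "Phi (Tm c) = Phi (Tm d) \<Longrightarrow> c - d \<in> N3"
  using Theta_iso by (auto simp: Phi_Tm Q_cong[symmetric] lie_iso_def bij_betw_def QL_ops inj_on_def)

end

section \<open>Passing between modules for \<open>\<T>\<^sub>B\<close> and for the direct
  sum\<close>

lemma irreducible_pullback:
  assumes hom: "lie_hom L L' f" and surj: "f ` lcarrier L = lcarrier L'"
    and irr: "irreducible_lie_module L' s V \<sigma>"
  shows "irreducible_lie_module L s V (\<lambda>x. \<sigma> (f x))"
proof -
  interpret lie_module L' s V \<sigma> using irr by (simp add: irreducible_lie_module_def)
  have "lie_module L s V (\<lambda>x. \<sigma> (f x))"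
    by (rule lie_module.intro[OF vs subsp])
      (use hom in \<open>auto simp: lie_hom_def act_closed act_add act_scale ladd_act lsmult_act lbr_act\<close>)
  then show ?thesis
    using irr surj[symmetric] by (simp add: irreducible_lie_module_def)
qed

lemma irreducible_factor:
  assumes hom: "lie_hom L L' f" and surj: "f ` lcarrier L = lcarrier L'"
    and irr: "irreducible_lie_module L s V \<tau>"
    and fact: "\<And>x y v. x \<in> lcarrier L \<Longrightarrow> y \<in> lcarrier L \<Longrightarrow> f x = f y \<Longrightarrow> v \<in> V \<Longrightarrow> \<tau> x v = \<tau> y v"
    and closed: "\<And>x y. x \<in> lcarrier L \<Longrightarrow> y \<in> lcarrier L \<Longrightarrow> ladd L x y \<in> lcarrier L"
      "\<And>c x. x \<in> lcarrier L \<Longrightarrow> lsmult L c x \<in> lcarrier L"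
      "\<And>x y. x \<in> lcarrier L \<Longrightarrow> y \<in> lcarrier L \<Longrightarrow> lbr L x y \<in> lcarrier L"
  shows "\<exists>\<sigma>. irreducible_lie_module L' s V \<sigma> \<and> (\<forall>x\<in>lcarrier L. \<forall>v\<in>V. \<tau> x v = \<sigma> (f x) v)"
proof -
  interpret lie_module L s V \<tau> using irr by (simp add: irreducible_lie_module_def)
  define g where "g y = (SOME x. x \<in> lcarrier L \<and> f x = y)" for y
  have g: "g y \<in> lcarrier L \<and> f (g y) = y" if "y \<in> lcarrier L'" for y
  proof -
    have "y \<in> f ` lcarrier L" by (simp only: surj that)
    then have "\<exists>x. x \<in> lcarrier L \<and> f x = y" by auto
    then show ?thesis unfolding g_def by (rule someI_ex)
  qed
  have fin: "f x \<in> lcarrier L'" if "x \<in> lcarrier L" for x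
    unfolding surj[symmetric] using that by (rule imageI)
  have val: "\<tau> (g (f x)) v = \<tau> x v" if x: "x \<in> lcarrier L" and v: "v \<in> V" for x v
  proof (rule fact)
    show "g (f x) \<in> lcarrier L" "f (g (f x)) = f x" using g[OF fin[OF x]] by simp_all
  qed (rule x v)+
  have "lie_module L' s V (\<lambda>y. \<tau> (g y))"
  proof (rule lie_module.intro[OF vs subsp])
    fix x y v w c assume x: "x \<in> lcarrier L'" and v: "v \<in> V"
    have gx: "g x \<in> lcarrier L" "x = f (g x)" using g[OF x] by auto
    show "\<tau> (g x) v \<in> V" by (rule act_closed[OF gx(1) v])
    show "w \<in> V \<Longrightarrow> \<tau> (g x) (v + w) = \<tau> (g x) v + \<tau> (g x) w" by (rule act_add[OF gx(1) v])
    show "\<tau> (g x) (s c v) = s c (\<tau> (g x) v)" by (rule act_scale[OF gx(1) v])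
    have "lsmult L' c (f (g x)) = f (lsmult L c (g x))" using hom gx by (simp add: lie_hom_def)
    then have "lsmult L' c x = f (lsmult L c (g x))" using gx(2) by simp
    then show "\<tau> (g (lsmult L' c x)) v = s c (\<tau> (g x) v)"
      using val[OF closed(2)[OF gx(1)] v] lsmult_act[OF gx(1) v] by simp
    assume y: "y \<in> lcarrier L'"
    have gy: "g y \<in> lcarrier L" "y = f (g y)" using g[OF y] by auto
    have "ladd L' (f (g x)) (f (g y)) = f (ladd L (g x) (g y))"
      "lbr L' (f (g x)) (f (g y)) = f (lbr L (g x) (g y))"
      using hom gx gy by (simp_all add: lie_hom_def)
    then have "ladd L' x y = f (ladd L (g x) (g y))" "lbr L' x y = f (lbr L (g x) (g y))"
      using gx(2) gy(2) by simp_all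
    then show "\<tau> (g (ladd L' x y)) v = \<tau> (g x) v + \<tau> (g y) v"
      "\<tau> (g (lbr L' x y)) v = \<tau> (g x) (\<tau> (g y) v) - \<tau> (g y) (\<tau> (g x) v)"
      using val[OF closed(1)[OF gx(1) gy(1)] v] ladd_act[OF gx(1) gy(1) v]
        val[OF closed(3)[OF gx(1) gy(1)] v] lbr_act[OF gx(1) gy(1) v] by simp_all
  qed
  moreover have "(\<forall>y\<in>lcarrier L'. \<forall>w\<in>W. \<tau> (g y) w \<in> W) \<longrightarrow> (\<forall>x\<in>lcarrier L. \<forall>w\<in>W. \<tau> x w \<in> W)" if "W \<subseteq> V" for W
  proof (intro impI ballI)
    fix x w assume inv: "\<forall>y\<in>lcarrier L'. \<forall>w\<in>W. \<tau> (g y) w \<in> W" and x: "x \<in> lcarrier L" and w: "w \<in> W"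
    have "w \<in> V" using w that by blast
    then show "\<tau> x w \<in> W" using inv[rule_format, OF fin[OF x] w] val[OF x] by simp
  qed
  ultimately have "irreducible_lie_module L' s V (\<lambda>y. \<tau> (g y))"
    using irr unfolding irreducible_lie_module_def by blast
  then show ?thesis using val by (intro exI[of _ "\<lambda>y. \<tau> (g y)"]) auto
qed

context symplectic_form
begin

lemma B_mult_eq_0: "B *v y = 0 \<Longrightarrow> y = 0"
proof -
  assume "B *v y = 0"
  then have "matrix_inv B *v (B *v y) = 0" by simp
  then show ?thesis by (simp only: matrix_vector_mul_assoc B_inv matrix_vector_mul_lid)
qed

lemma om_nondegenerate:
  assumes "a \<noteq> 0"
  shows "\<exists>u. om B a u \<noteq> 0"
proof (rule ccontr)
  assume "\<not> ?thesis"
  then have "om B a (axis j 1) = 0" for j by blast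
  then have "B *v cvec a = 0" by (simp add: cvec_simps bform_axis vec_eq_iff)
  then have "cvec a = cvec 0" using B_mult_eq_0 by (simp add: cvec_simps)
  then show False using assms by (simp only: cvec_inj)
qed

text \<open>If all the determinants vanished, the vector \<open>y\<close>, a combination of
  \<open>s\<close> and the axis vector with a non-zero coefficient at \<open>s\<close>, would be
  orthogonal to all \<open>Bw\<close> and hence zero by non-degeneracy. Then the coordinates of
  \<open>s\<close> off the axis vanish, and the remaining one is an integer.\<close>

lemma om_independent:
  assumes s: "s \<notin> range (\<lambda>k. vector_scalar_mult k (axis i 1))"
  shows "\<exists>w w'. om B w s * om B w' (axis i 1) \<noteq> om B w (axis i 1) * om B w' s"
proof (rule ccontr)
  assume "\<not> ?thesis"
  then have eq: "om B w s * om B w' (axis i 1) = om B w (axis i 1) * om B w' s" for w w' by blast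
  obtain w' where "om B (axis i 1) w' \<noteq> 0" using om_nondegenerate[of "axis i 1"] by auto
  then have c: "om B w' (axis i 1) \<noteq> 0" using om_skew[OF skew, of w' "axis i 1"] by simp
  define y where "y = om B w' (axis i 1) *s cvec s - om B w' s *s axis i 1"
  have "bform (B *v cvec w) y = 0" for w
    using eq[of w w'] by (simp add: y_def bform_simps cvec_simps mult.commute)
  then have "bform (cvec (axis j 1)) (transpose B *v y) = 0" for j
    by (simp only: bform_transpose)
  then have "transpose B *v y = 0" by (simp add: cvec_simps bform_axis vec_eq_iff)
  then have "B *v y = 0" by (simp add: skew uminus_mult_vec)
  then have "y $ j = 0" for j using B_mult_eq_0 by (simp add: vec_eq_iff)
  then have "om B w' (axis i 1) * cvec s $ j = 0" if "j \<noteq> i" for j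
    using that by (simp add: y_def axis_def)
  then have "s $ j = 0" if "j \<noteq> i" for j using that c by (simp add: cvec_def)
  then have "s = vector_scalar_mult (s $ i) (axis i 1)" by (simp add: vec_eq_iff axis_def)
  then show False using s by blast
qed

text \<open>Here the analysis of differences enters: the operators of the \<open>T(u)\<close>, cut
  off outside \<open>V\<close>, form an instance of \<open>irr_rep\<close>, so their third
  differences vanish; with \<open>T(0) = 0\<close> all of \<open>M3\<close> acts by zero. Elements
  of \<open>N3\<close> have the same images in \<open>\<T>\<^sub>B\<close> as elements of
  \<open>M3\<close>.\<close>

lemma finite_dim_kills_I3:
  assumes card2: "\<exists>i j :: 'n. i \<noteq> j"
    and irr: "irreducible_lie_module (TB B) s V \<tau>" and fd: "finite_dim s V"
    and c: "c \<in> N3" and v: "v \<in> V"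
  shows "\<tau> (Tm c) v = 0"
proof -
  interpret lie_module "TB B" s V \<tau> using irr by (simp add: irreducible_lie_module_def)
  interpret vs: vector_space s by (rule vs)
  obtain Sp where Sp: "finite Sp" "V = vs.span Sp" using fd by (auto simp: finite_dim_def)
  interpret op_space s V Sp by unfold_locales (use Sp in auto)
  have Tin: "Tm c \<in> lcarrier (TB B)" for c by (simp add: TB_carrier)
  have tadd: "\<tau> (Tm (c + d)) v = \<tau> (Tm c) v + \<tau> (Tm d) v" if "v \<in> V" for c d v
    using ladd_act[OF Tin[of c] Tin[of d] that] by (simp only: TB_ops(2))
  have tscale: "\<tau> (Tm (lscale a c)) v = s a (\<tau> (Tm c) v)" if "v \<in> V" for a c v
    using lsmult_act[OF Tin[of c] that, of a] by (simp only: TB_ops(3))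
  have tminus: "\<tau> (Tm (c - d)) v = \<tau> (Tm c) v - \<tau> (Tm d) v" if "v \<in> V" for c d v
    using tadd[OF that, of "c - d" d] by simp
  define X where "X u v = (if v \<in> V then \<tau> (T B u) v else 0)" for u v
  have X_V: "X u v = \<tau> (Tm (tmon u)) v" if "v \<in> V" for u v
    using that by (simp add: X_def Tm_tmon)
  have XE: "X u \<in> End" for u
    using Tin[of "tmon u"] by (auto simp: End_def X_def Tm_tmon V_closed act_closed act_add act_scale)
  interpret irr_rep s V Sp X "om B"
  proof unfold_locales
    show "X u \<in> End" for u by (rule XE)
    show "X 0 = 0"
    proof
      fix v
      have "\<tau> (Tm (lscale 0 0)) v = 0" if "v \<in> V" using tscale[OF that, of 0 0] by simp
      then show "X 0 v = 0 v" by (simp add: X_def T_zero)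
    qed
    show "obr (X a) (X b) = oscale (om B a b) (X (a + b) - X a - X b)" for a b
    proof
      fix v
      show "obr (X a) (X b) v = oscale (om B a b) (X (a + b) - X a - X b) v"
      proof (cases "v \<in> V")
        case True
        then have "obr (X a) (X b) v = \<tau> (Tm (tmon a)) (\<tau> (Tm (tmon b)) v) - \<tau> (Tm (tmon b)) (\<tau> (Tm (tmon a)) v)"
          by (simp add: obr_def X_V act_closed Tin)
        also have "\<dots> = \<tau> (Tm (bt B (tmon a) (tmon b))) v"
          using lbr_act[OF Tin Tin True, of "tmon a" "tmon b"] by (simp only: TB_bracket)
        also have "\<dots> = oscale (om B a b) (X (a + b) - X a - X b) v"
          using True by (simp add: bt_tmon tscale tminus oscale_def X_V)
        finally show ?thesis .
      next
        case False
        then show ?thesis using End_off[OF obr_End[OF XE XE]] by (simp add: oscale_def X_def)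
      qed
    qed
    show "om B (a + b) c = om B a c + om B b c" for a b c by (rule om_simps)
    show "om B a b = - om B b a" for a b by (rule om_skew[OF skew])
    show "\<exists>w w'. om B w s * om B w' (axis i 1) \<noteq> om B w (axis i 1) * om B w' s"
      if "s \<notin> range (\<lambda>k. vector_scalar_mult k (axis i 1))" for s i
      using that by (rule om_independent)
    show "\<exists>u. om B a u \<noteq> 0" if "a \<noteq> 0" for a using that by (rule om_nondegenerate)
    show "\<exists>i j :: 'n. i \<noteq> j" by (rule card2)
    show "V \<noteq> {0}" using irr by (simp add: irreducible_lie_module_def)
    show "W = {0} \<or> W = V"
      if W: "vs.subspace W" "W \<subseteq> V" "\<And>u w. w \<in> W \<Longrightarrow> X u w \<in> W" for W
    proof -
      have "\<tau> (Tm c) w \<in> W" if w: "w \<in> W" for c w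
      proof -
        have wV: "w \<in> V" using w W(2) by blast
        show ?thesis
        proof (induction c rule: laurent_induct)
          case (1 k)
          show ?case using W(3)[OF w, of k] by (simp only: X_V[OF wV])
        next
          case (2 c d)
          show ?case unfolding tadd[OF wV] by (rule vs.subspace_add[OF W(1) 2])
        next
          case (3 a c)
          show ?case unfolding tscale[OF wV] by (rule vs.subspace_scale[OF W(1) 3])
        qed
      qed
      then have "\<forall>x\<in>lcarrier (TB B). \<forall>w\<in>W. \<tau> x w \<in> W" unfolding TB_carrier by blast
      then show ?thesis using irr W(1,2) unfolding irreducible_lie_module_def by blast
    qed
  qed
  have M: "\<tau> (Tm m) v = 0" if "m \<in> M3" for m
    using that
  proof (induction rule: M3_induct)
    case zero
    have "\<tau> (Tm (lscale 0 0)) v = 0" using tscale[OF v, of 0 0] by simp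
    then show ?case by (simp add: Tm_tmon T_zero)
  next
    case (third a b c q)
    have "fdiffs [a, b, c] X q = 0" using pol_3 by (simp add: pol_def fun_eq_iff del: fdiffs_simps)
    then have "fdiffs [a, b, c] X q v = 0" by (simp only: zero_fun_apply)
    then show ?case using v by (simp add: fdiff_def tminus X_V)
  next
    case (add x y)
    then show ?case by (simp add: tadd v)
  next
    case (scale a x)
    then show ?case by (simp add: tscale v)
  qed
  obtain m where "m \<in> M3" "Tm c = Tm m" using c by (auto simp: N3_def)
  then show ?thesis using M[of m] by simp
qed

lemma finite_dim_factors:
  assumes card2: "\<exists>i j :: 'n. i \<noteq> j"
    and irr: "irreducible_lie_module (TB B) s V \<tau>" and fd: "finite_dim s V"
  shows "\<exists>\<sigma>. irreducible_lie_module SR s V \<sigma> \<and> (\<forall>x\<in>lcarrier (TB B). \<forall>v\<in>V. \<tau> x v = \<sigma> (Phi x) v)"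
proof (rule irreducible_factor[OF Phi_hom Phi_surj irr])
  interpret lie_module "TB B" s V \<tau> using irr by (simp add: irreducible_lie_module_def)
  fix x y v assume "x \<in> lcarrier (TB B)" "y \<in> lcarrier (TB B)" and eq: "Phi x = Phi y" and v: "v \<in> V"
  then obtain c d where cd: "x = Tm c" "y = Tm d" by (auto simp: TB_carrier)
  have "\<tau> (Tm (c - d)) v = 0"
    using finite_dim_kills_I3[OF card2 irr fd _ v] Phi_eqD eq cd by blast
  moreover have "\<tau> (Tm (c - d + d)) v = \<tau> (Tm (c - d)) v + \<tau> (Tm d) v"
    using ladd_act[of "Tm (c - d)" "Tm d" v] v by (simp only: TB_ops(2) TB_carrier rangeI)
  ultimately show "\<tau> x v = \<tau> y v" by (simp add: cd)
next
  show "ladd (TB B) x y \<in> lcarrier (TB B)" "lbr (TB B) x y \<in> lcarrier (TB B)"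
    if "x \<in> lcarrier (TB B)" "y \<in> lcarrier (TB B)" for x y
    using that unfolding TB_carrier by (auto simp: TB_ops(2) TB_bracket simp del: TB_ops(4-6))
  show "lsmult (TB B) c x \<in> lcarrier (TB B)" if "x \<in> lcarrier (TB B)" for x c
    using that unfolding TB_carrier by (auto simp: TB_ops(3) simp del: TB_ops(4-6))
qed

end


section \<open>Irreducible jet modules\<close>

lemma lie_module_restrict:
  assumes "lie_module L s V \<tau>" "module.subspace s W" "W \<subseteq> V" "\<And>x w. x \<in> lcarrier L \<Longrightarrow> w \<in> W \<Longrightarrow> \<tau> x w \<in> W"
  shows "lie_module L s W \<tau>"
proof -
  interpret lie_module L s V \<tau> by fact
  show ?thesis
    by (rule lie_module.intro[OF vs assms(2)])
      (use assms(3,4) in \<open>auto simp: act_add act_scale ladd_act lsmult_act lbr_act subset_iff\<close>)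
qed

lemma vector_space_tensor_scale:
  assumes "vector_space s"
  shows "vector_space (tensor_scale s :: complex \<Rightarrow> (int ^ 'n::finite \<Rightarrow>\<^sub>0 'v::ab_group_add) \<Rightarrow> _)"
proof -
  interpret vector_space s by fact
  show ?thesis
    by unfold_locales
      (simp_all add: poly_mapping_eq_iff fun_eq_iff lookup_tensor_scale[OF assms] lookup_add scale_right_distrib scale_left_distrib)
qed

lemma tensor_tmon:
  assumes "vector_space s"
  shows "tensor s v (tmon k) = Poly_Mapping.single k v"
    "tensor_scale s c (Poly_Mapping.single k v) = Poly_Mapping.single k (s c v)"
proof -
  interpret vector_space s by fact
  show "tensor s v (tmon k) = Poly_Mapping.single k v"
    "tensor_scale s c (Poly_Mapping.single k v) = Poly_Mapping.single k (s c v)"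
    by (simp_all add: poly_mapping_eq_iff fun_eq_iff lookup_tensor[OF assms] lookup_tensor_scale[OF assms]
        tmon_def lookup_single when_def)
qed

text \<open>Transport of structure along a linear bijection. The actions on
  \<open>V\<^sub>0 \<otimes> \<A>\<close> are defined in this way, so the module axioms and the
  isomorphism come for free and only the formulas on pure tensors remain to be computed.\<close>

lemma jet_module_transport:
  assumes jm: "jet_module B s V \<rho> \<alpha>" and s': "vector_space s'" "module.subspace s' V'"
    and bij: "bij_betw h V' V" and add: "\<And>p q. p \<in> V' \<Longrightarrow> q \<in> V' \<Longrightarrow> h (p + q) = h p + h q"
    and sc: "\<And>c p. p \<in> V' \<Longrightarrow> h (s' c p) = s c (h p)" and g: "g = inv_into V' h"
  shows "jet_module B s' V' (\<lambda>\<eta> p. g (\<rho> \<eta> (h p))) (\<lambda>f p. g (\<alpha> f (h p)))"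
    "jet_iso B s V \<rho> \<alpha> s' V' (\<lambda>\<eta> p. g (\<rho> \<eta> (h p))) (\<lambda>f p. g (\<alpha> f (h p))) g"
proof -
  interpret jet_module B s V \<rho> \<alpha> by fact
  interpret vs: vector_space s by (rule vs)
  interpret vs': vector_space s' by fact
  have V'c: "p \<in> V' \<Longrightarrow> q \<in> V' \<Longrightarrow> p + q \<in> V'" "p \<in> V' \<Longrightarrow> q \<in> V' \<Longrightarrow> p - q \<in> V'" "p \<in> V' \<Longrightarrow> s' c p \<in> V'" for p q c
    using s'(2) by (auto intro: vs'.subspace_add vs'.subspace_diff vs'.subspace_scale)
  have Vc: "v \<in> V \<Longrightarrow> w \<in> V \<Longrightarrow> v + w \<in> V" "v \<in> V \<Longrightarrow> w \<in> V \<Longrightarrow> v - w \<in> V" "v \<in> V \<Longrightarrow> s c v \<in> V" for v w c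
    using subsp by (auto intro: vs.subspace_add vs.subspace_diff vs.subspace_scale)
  have hV: "p \<in> V' \<Longrightarrow> h p \<in> V" for p using bij by (auto simp: bij_betw_def)
  have gV: "v \<in> V \<Longrightarrow> g v \<in> V'" for v using bij unfolding g by (metis bij_betw_def inv_into_into)
  have hg: "v \<in> V \<Longrightarrow> h (g v) = v" for v using bij unfolding g by (metis bij_betw_inv_into_right)
  have gh: "p \<in> V' \<Longrightarrow> g (h p) = p" for p using bij unfolding g by (metis bij_betw_inv_into_left)
  have gadd: "g (v + w) = g v + g w" if "v \<in> V" "w \<in> V" for v w
    using gh[OF V'c(1)[OF gV[OF that(1)] gV[OF that(2)]]] add[OF gV[OF that(1)] gV[OF that(2)]] that by (simp add: hg)
  have gsc: "g (s c v) = s' c (g v)" if "v \<in> V" for v c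
    using gh[OF V'c(3)[OF gV[OF that]]] sc[OF gV[OF that]] that by (simp add: hg)
  have gdiff: "g (v - w) = g v - g w" if "v \<in> V" "w \<in> V" for v w
    using gadd[OF Vc(2)[OF that] that(2)] by simp
  note simps = hV gV hg gadd gsc gdiff add sc act_closed act_add act_scale ladd_act lsmult_act lbr_act Vc V'c
    alg_closed alg_add alg_scale add_alg scale_alg mult_alg one_alg compat
  have "lie_module (ham B) s' V' (\<lambda>\<eta> p. g (\<rho> \<eta> (h p)))"
    by (rule lie_module.intro[OF s']) (simp_all add: simps del: ham_ops)
  moreover have "jet_module_axioms B s' V' (\<lambda>\<eta> p. g (\<rho> \<eta> (h p))) (\<lambda>f p. g (\<alpha> f (h p)))"
    by (rule jet_module_axioms.intro) (simp_all add: simps gh)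
  ultimately show "jet_module B s' V' (\<lambda>\<eta> p. g (\<rho> \<eta> (h p))) (\<lambda>f p. g (\<alpha> f (h p)))"
    by (rule jet_module.intro)
  show "jet_iso B s V \<rho> \<alpha> s' V' (\<lambda>\<eta> p. g (\<rho> \<eta> (h p))) (\<lambda>f p. g (\<alpha> f (h p))) g"
    unfolding jet_iso_def using bij_betw_inv_into[OF bij] by (simp add: g[symmetric] hg gadd gsc)
qed

context skew_jet
begin

section \<open>Weight spaces and the multiplication map from the tensor product\<close>

abbreviation "wt \<equiv> weight_space s V \<rho>"

lemma wt_D: "v \<in> wt \<gamma> \<Longrightarrow> v \<in> V" "v \<in> wt \<gamma> \<Longrightarrow> \<rho> (D u 0) v = s (bform u \<gamma>) v"
  by (auto simp: weight_space_def)

lemma rho_0: "\<eta> \<in> lcarrier (ham B) \<Longrightarrow> \<rho> \<eta> 0 = 0"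
  using act_add[of \<eta> 0 0] V_closed(1) by simp

lemma alpha_0: "\<alpha> f 0 = 0"
  using alg_add[of 0 0 f] V_closed(1) by simp

lemma subspace_wt: "vs.subspace (wt \<gamma>)"
  unfolding vs.subspace_def weight_space_def
  by (auto simp: V_closed rho_0 ham_D0 act_add act_scale vs.scale_right_distrib mult.commute)

lemma alpha_wt:
  assumes "v \<in> wt \<gamma>"
  shows "\<alpha> (tmon k) v \<in> wt (\<gamma> + cvec k)"
proof -
  have v: "v \<in> V" using assms by (rule wt_D)
  have "\<rho> (D u 0) (\<alpha> (tmon k) v) = s (bform u (\<gamma> + cvec k)) (\<alpha> (tmon k) v)" for u
    using v by (simp add: compat ham_D0 D_tmon scale_alg wt_D(2)[OF assms] alg_scale bform_simps
        vs.scale_left_distrib add.commute)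
  then show ?thesis using v by (simp add: weight_space_def alg_closed)
qed

lemma DB_wt:
  assumes "v \<in> wt \<gamma>"
  shows "\<rho> (DB B r) v \<in> wt (\<gamma> + cvec r)"
proof -
  have v: "v \<in> V" using assms by (rule wt_D)
  have "\<rho> (D u 0) (\<rho> (DB B r) v) = s (bform u (\<gamma> + cvec r)) (\<rho> (DB B r) v)" for u
  proof -
    have "\<rho> (\<lambda>f. lscale (bform u (cvec r)) (DB B r f)) v = \<rho> (D u 0) (\<rho> (DB B r) v) - \<rho> (DB B r) (\<rho> (D u 0) v)"
      using lbr_act[OF ham_D0 ham_DB v, of u r] by (simp add: D0_DB_bracket)
    moreover have "\<rho> (\<lambda>f. lscale (bform u (cvec r)) (DB B r f)) v = s (bform u (cvec r)) (\<rho> (DB B r) v)"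
      using lsmult_act[OF ham_DB v] by simp
    moreover have "\<rho> (DB B r) (\<rho> (D u 0) v) = s (bform u \<gamma>) (\<rho> (DB B r) v)"
      using v by (simp add: wt_D(2)[OF assms] act_scale ham_DB)
    ultimately show ?thesis by (simp add: bform_simps vs.scale_left_distrib algebra_simps)
  qed
  then show ?thesis using v by (simp add: weight_space_def act_closed ham_DB)
qed

lemma alpha_inv: "v \<in> V \<Longrightarrow> \<alpha> (tmon k) (\<alpha> (tmon l) v) = \<alpha> (tmon (k + l)) v" "v \<in> V \<Longrightarrow> \<alpha> (tmon 0) v = v"
  by (simp_all add: mult_alg[symmetric] tmon_mult tmon_0 one_alg)

text \<open>Applying \<open>D(u, 0)\<close> to the relation and subtracting the multiple given by
  the weight of \<open>x j\<close> removes that term. The induction hypothesis gives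
  \<open>(u | k - j) x k = 0\<close> for every \<open>u\<close>, and a suitable axis vector makes
  the factor non-zero.\<close>

lemma weights_independent:
  assumes "finite K" "\<And>k. k \<in> K \<Longrightarrow> x k \<in> wt (\<beta> + cvec k)" "(\<Sum>k\<in>K. x k) = 0" "k \<in> K"
  shows "x k = 0"
  using assms
proof (induction K arbitrary: x k rule: finite_induct)
  case (insert j K)
  have xV: "x k \<in> V" if "k \<in> insert j K" for k using insert.prems(1)[OF that] by (rule wt_D)
  have zero: "\<forall>k\<in>K. s (bform u (cvec k - cvec j)) (x k) = 0" for u
  proof
    have "0 = \<rho> (D u 0) (\<Sum>k\<in>insert j K. x k)" using insert.prems(2) by (simp add: rho_0 ham_D0)
    also have "\<dots> = (\<Sum>k\<in>insert j K. \<rho> (D u 0) (x k))"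
    proof -
      have "finite I \<Longrightarrow> (\<And>k. k \<in> I \<Longrightarrow> x k \<in> V) \<Longrightarrow> \<rho> (D u 0) (\<Sum>k\<in>I. x k) = (\<Sum>k\<in>I. \<rho> (D u 0) (x k))" for I
        by (induction I rule: finite_induct) (simp_all add: rho_0 ham_D0 act_add V_sum)
      then show ?thesis using insert.hyps(1) xV by blast
    qed
    also have "\<dots> = (\<Sum>k\<in>insert j K. s (bform u (\<beta> + cvec k)) (x k))"
      by (rule sum.cong) (use insert.prems(1) in \<open>auto simp: wt_D\<close>)
    also have "\<dots> = (\<Sum>k\<in>insert j K. s (bform u (cvec k - cvec j)) (x k)) + s (bform u (\<beta> + cvec j)) (\<Sum>k\<in>insert j K. x k)"
    proof -
      have "s (bform u (\<beta> + cvec k)) (x k) = s (bform u (cvec k - cvec j)) (x k) + s (bform u (\<beta> + cvec j)) (x k)" for k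
        by (simp add: vs.scale_left_distrib[symmetric] bform_simps)
      then show ?thesis unfolding vs.scale_sum_right by (simp only: sum.distrib)
    qed
    also have "\<dots> = (\<Sum>k\<in>K. s (bform u (cvec k - cvec j)) (x k))"
      using insert.prems(2) insert.hyps by (simp add: bform_simps)
    finally have sum0: "(\<Sum>k\<in>K. s (bform u (cvec k - cvec j)) (x k)) = 0" by simp
    fix k assume k: "k \<in> K"
    show "s (bform u (cvec k - cvec j)) (x k) = 0"
      by (rule insert.IH[OF _ sum0 k]) (use insert.prems(1) subspace_wt in \<open>auto intro: vs.subspace_scale\<close>)
  qed
  have K: "x k = 0" if "k \<in> K" for k
  proof -
    have "cvec k \<noteq> cvec j" using that insert.hyps by (auto simp: cvec_inj)
    then obtain i where "(cvec k - cvec j) $ i \<noteq> 0" by (auto simp: vec_eq_iff)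
    then show ?thesis using zero[of "axis i 1"] that by (auto simp: bform_axis)
  qed
  then have "x j = 0" using insert.prems(2) insert.hyps by simp
  then show ?case using K insert.prems(3) by blast
qed simp

text \<open>The multiplication map \<open>v \<otimes> t^k \<mapsto> t^k v\<close>; its inverse on a
  weight space will be the isomorphism.\<close>

definition mv :: "(int ^ 'n \<Rightarrow>\<^sub>0 'v) \<Rightarrow> 'v" where
  "mv p = (\<Sum>k\<in>Poly_Mapping.keys p. \<alpha> (tmon k) (Poly_Mapping.lookup p k))"

lemma mv_eq: "finite K \<Longrightarrow> Poly_Mapping.keys p \<subseteq> K \<Longrightarrow> mv p = (\<Sum>k\<in>K. \<alpha> (tmon k) (Poly_Mapping.lookup p k))"
  unfolding mv_def by (rule lext_mono) (simp_all add: alpha_0)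

lemma tensor_spaceD: "p \<in> tensor_space W \<Longrightarrow> Poly_Mapping.lookup p k \<in> W"
  by (simp add: tensor_space_def)

lemma mv_V: "W \<subseteq> V \<Longrightarrow> p \<in> tensor_space W \<Longrightarrow> mv p \<in> V"
  unfolding mv_def by (intro V_sum alg_closed) (auto dest: tensor_spaceD)

lemma mv_add:
  assumes "p \<in> tensor_space V" "q \<in> tensor_space V"
  shows "mv (p + q) = mv p + mv q"
proof -
  let ?K = "Poly_Mapping.keys p \<union> Poly_Mapping.keys q"
  have "mv (p + q) = (\<Sum>k\<in>?K. \<alpha> (tmon k) (Poly_Mapping.lookup (p + q) k))"
    by (rule mv_eq) (use keys_add[of p q] in auto)
  also have "\<dots> = (\<Sum>k\<in>?K. \<alpha> (tmon k) (Poly_Mapping.lookup p k)) + (\<Sum>k\<in>?K. \<alpha> (tmon k) (Poly_Mapping.lookup q k))"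
    by (simp add: lookup_add alg_add tensor_spaceD[OF assms(1)] tensor_spaceD[OF assms(2)] sum.distrib)
  also have "\<dots> = mv p + mv q" using mv_eq[of ?K p] mv_eq[of ?K q] by simp
  finally show ?thesis .
qed

lemma mv_scale:
  assumes "p \<in> tensor_space V"
  shows "mv (tensor_scale s c p) = s c (mv p)"
proof -
  have "mv (tensor_scale s c p) = (\<Sum>k\<in>Poly_Mapping.keys p. \<alpha> (tmon k) (Poly_Mapping.lookup (tensor_scale s c p) k))"
    by (rule mv_eq) (auto simp: in_keys_iff lookup_tensor_scale[OF vs])
  then show ?thesis
    by (simp add: mv_def lookup_tensor_scale[OF vs] alg_scale tensor_spaceD[OF assms] vs.scale_sum_right)
qed

lemma mv_single: "mv (Poly_Mapping.single k v) = \<alpha> (tmon k) v"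
  by (simp add: mv_def alpha_0)

lemma subspace_tensor_space:
  assumes "vs.subspace W"
  shows "module.subspace (tensor_scale s) (tensor_space W :: (int ^ 'n \<Rightarrow>\<^sub>0 'v) set)"
proof -
  interpret ts: vector_space "tensor_scale s :: complex \<Rightarrow> (int ^ 'n \<Rightarrow>\<^sub>0 'v) \<Rightarrow> _"
    by (rule vector_space_tensor_scale[OF vs])
  show ?thesis
    unfolding ts.subspace_def tensor_space_def
    using assms by (auto simp: lookup_add lookup_tensor_scale[OF vs] vs.subspace_def)
qed

text \<open>The terms \<open>t^k v\<close> with \<open>v\<close> in one weight space have distinct
  weights for distinct \<open>k\<close>, so they are independent, and each \<open>t^k\<close> acts
  invertibly.\<close>

lemma mv_inj: "inj_on mv (tensor_space (wt \<beta>))"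
proof (rule inj_onI)
  fix p q assume p: "p \<in> tensor_space (wt \<beta>)" and q: "q \<in> tensor_space (wt \<beta>)" and eq: "mv p = mv q"
  let ?K = "Poly_Mapping.keys p \<union> Poly_Mapping.keys q"
  let ?x = "\<lambda>k. \<alpha> (tmon k) (Poly_Mapping.lookup p k - Poly_Mapping.lookup q k)"
  have d: "Poly_Mapping.lookup p k - Poly_Mapping.lookup q k \<in> wt \<beta>" for k
    using tensor_spaceD[OF p] tensor_spaceD[OF q] subspace_wt by (intro vs.subspace_diff)
  have "(\<Sum>k\<in>?K. ?x k) = 0"
  proof -
    have "?x k = \<alpha> (tmon k) (Poly_Mapping.lookup p k) - \<alpha> (tmon k) (Poly_Mapping.lookup q k)" for k
      using alg_add[of "Poly_Mapping.lookup p k - Poly_Mapping.lookup q k" "Poly_Mapping.lookup q k" "tmon k"]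
        wt_D(1)[OF d[of k]] wt_D(1)[OF tensor_spaceD[OF q, of k]] by simp
    then show ?thesis using eq mv_eq[of ?K p] mv_eq[of ?K q] by (simp add: sum_subtractf)
  qed
  then have x: "?x k = 0" if "k \<in> ?K" for k
    using weights_independent[of ?K ?x \<beta> k] alpha_wt[OF d] that by simp
  have "Poly_Mapping.lookup p k = Poly_Mapping.lookup q k" for k
  proof (cases "k \<in> ?K")
    case True
    have "\<alpha> (tmon (- k)) (?x k) = Poly_Mapping.lookup p k - Poly_Mapping.lookup q k"
      using alpha_inv[OF wt_D(1)[OF d[of k]]] by simp
    then show ?thesis using x[OF True] by (simp add: alpha_0)
  qed (simp add: in_keys_iff)
  then show "p = q" by (rule poly_mapping_eqI)
qed

lemma D_shift:
  assumes v: "v \<in> wt \<beta>" and \<tau>: "\<tau> (T B r) v = \<alpha> (tmon (- r)) (\<rho> (DB B r) v) - \<rho> (D (B *v cvec r) 0) v"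
  shows "\<rho> (DB B r) (\<alpha> (tmon k) v) =
      \<alpha> (tmon (k + r)) (s (bform (B *v cvec r) (cvec k + \<beta>)) v + \<tau> (T B r) v)"
    "\<rho> (D u 0) (\<alpha> (tmon k) v) = \<alpha> (tmon k) (s (bform u (cvec k + \<beta>)) v)"
proof -
  have vV: "v \<in> V" using v by (rule wt_D)
  have rV: "\<rho> (DB B r) v \<in> V" using vV by (simp add: act_closed ham_DB)
  show "\<rho> (D u 0) (\<alpha> (tmon k) v) = \<alpha> (tmon k) (s (bform u (cvec k + \<beta>)) v)"
    using wt_D(2)[OF alpha_wt[OF v]] vV by (simp add: alg_scale add.commute)
  have "s (bform (B *v cvec r) (cvec k + \<beta>)) v + \<tau> (T B r) v =
    s (om B r k) v + \<alpha> (tmon (- r)) (\<rho> (DB B r) v)"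
    by (simp add: \<tau> wt_D(2)[OF v] bform_simps vs.scale_left_distrib)
  then have "\<alpha> (tmon (k + r)) (s (bform (B *v cvec r) (cvec k + \<beta>)) v + \<tau> (T B r) v) =
     s (om B r k) (\<alpha> (tmon (k + r)) v) + \<alpha> (tmon k) (\<rho> (DB B r) v)"
    using vV rV by (simp add: alg_add V_closed alg_closed alg_scale alpha_inv)
  then show "\<rho> (DB B r) (\<alpha> (tmon k) v) =
      \<alpha> (tmon (k + r)) (s (bform (B *v cvec r) (cvec k + \<beta>)) v + \<tau> (T B r) v)"
    using vV by (simp add: compat ham_DB DB_tmon scale_alg)
qed

text \<open>The span of all \<open>t^k w\<close> with \<open>w\<close> in \<open>W\<close> is stable
  under functions, and under \<open>ham B\<close> by the formulas of \<open>D_shift\<close>, because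
  \<open>W\<close> is stable under the \<open>T(r)\<close>. By irreducibility it is
  \<open>V\<close>, and it is contained in the image of the graded space with coefficients in
  \<open>W\<close>.\<close>

lemma submodule_generated:
  assumes W: "vs.subspace W" "W \<subseteq> wt \<beta>"
    and \<tau>: "\<And>r v. v \<in> V \<Longrightarrow> \<tau> (T B r) v = \<alpha> (tmon (- r)) (\<rho> (DB B r) v) - \<rho> (D (B *v cvec r) 0) v"
    and inv: "\<And>r w. w \<in> W \<Longrightarrow> \<tau> (T B r) w \<in> W"
    and irr: "irreducible_jet_module B s V \<rho> \<alpha>" and W0: "W \<noteq> {0}"
  shows "V \<subseteq> mv ` tensor_space W"
proof -
  let ?S = "{\<alpha> (tmon k) w | k w. w \<in> W}"
  define U where "U = vs.span ?S"
  have WV: "w \<in> V" if "w \<in> W" for w using that W(2) wt_D(1) by blast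
  have UV: "U \<subseteq> V"
    unfolding U_def by (rule vs.span_minimal) (use subsp WV in \<open>auto simp: alg_closed\<close>)
  have gen: "\<alpha> (tmon k) w \<in> U" if "w \<in> W" for k w
    unfolding U_def by (rule vs.span_base) (use that in blast)
  have lin: "g u \<in> U" if u: "u \<in> U" and g: "\<And>v w. v \<in> V \<Longrightarrow> w \<in> V \<Longrightarrow> g (v + w) = g v + g w"
      "\<And>c v. v \<in> V \<Longrightarrow> g (s c v) = s c (g v)" "\<And>k w. w \<in> W \<Longrightarrow> g (\<alpha> (tmon k) w) \<in> U" for g u
  proof -
    have g0: "g 0 = 0" using g(1)[of 0 0] V_closed(1) by simp
    have "vs.subspace {u \<in> V. g u \<in> U}"
      unfolding vs.subspace_def
      by (auto simp: V_closed g0 g(1,2) U_def vs.span_zero vs.span_add vs.span_scale)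
    moreover have "?S \<subseteq> {u \<in> V. g u \<in> U}" using g(3) WV by (auto simp: alg_closed)
    ultimately have "U \<subseteq> {u \<in> V. g u \<in> U}" unfolding U_def by (rule vs.span_minimal[rotated])
    then show ?thesis using u by blast
  qed
  have Uops: "u + u' \<in> U" "s c u \<in> U" "0 \<in> U" if "u \<in> U" "u' \<in> U" for u u' c
    using that by (auto simp: U_def vs.span_add vs.span_scale vs.span_zero)
  have comb: "s c w + \<tau> (T B r) w \<in> W" if "w \<in> W" for c r w
    using inv[OF that] that W(1) by (auto intro: vs.subspace_add vs.subspace_scale)
  have rho: "\<rho> \<eta> u \<in> U" if \<eta>: "\<eta> \<in> lcarrier (ham B)" and u: "u \<in> U" for \<eta> u
    using \<eta> u
  proof (induction arbitrary: u rule: ham_induct)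
    case zero
    then show ?case using UV Uops(3) by (auto simp: rho_zero)
  next
    case (DB r)
    show ?case
    proof (rule lin[OF DB])
      fix k w assume w: "w \<in> W"
      show "\<rho> (DB B r) (\<alpha> (tmon k) w) \<in> U"
        using D_shift(1)[where \<tau> = \<tau>, of w \<beta>] w W(2) \<tau>[OF WV[OF w]] gen[OF comb[OF w]] by auto
    qed (simp_all add: act_add act_scale ham_DB)
  next
    case (D0 u')
    show ?case
    proof (rule lin[OF D0])
      fix k w assume w: "w \<in> W"
      have "s c w \<in> W" for c using w W(1) by (auto intro: vs.subspace_scale)
      then show "\<rho> (D u' 0) (\<alpha> (tmon k) w) \<in> U"
        using D_shift(2)[where \<tau> = \<tau>, of w \<beta> 0] w W(2) \<tau>[OF WV[OF w]] gen by auto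
    qed (simp_all add: act_add act_scale ham_D0)
  next
    case (add X Y)
    have "u \<in> V" using add.prems UV by blast
    then have "\<rho> (\<lambda>f. X f + Y f) u = \<rho> X u + \<rho> Y u" using ladd_act[OF add.hyps] by simp
    then show ?case using Uops(1) add.IH[OF add.prems] by simp
  next
    case (scale c X)
    have "u \<in> V" using scale.prems UV by blast
    then have "\<rho> (\<lambda>f. lscale c (X f)) u = s c (\<rho> X u)" using lsmult_act[OF scale.hyps] by simp
    then show ?case using Uops(2)[OF scale.IH[OF scale.prems] scale.prems] by simp
  qed
  have alpha: "\<alpha> f u \<in> U" if u: "u \<in> U" for f u
  proof (induction f rule: laurent_induct)
    case (1 j)
    show ?case
    proof (rule lin[OF u])
      show "\<alpha> (tmon j) (\<alpha> (tmon k) w) \<in> U" if "w \<in> W" for k w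
        using gen[OF that] WV[OF that] by (simp add: alpha_inv)
    qed (simp_all add: alg_add alg_scale)
  next
    case (2 f g)
    then show ?case using Uops(1) add_alg[of u f g] u UV by auto
  next
    case (3 a f)
    then show ?case using Uops(2)[OF 3 3] scale_alg[of u a f] u UV by auto
  qed
  have "U = {0} \<or> U = V"
    using irr UV rho alpha unfolding irreducible_jet_module_def by (auto simp: U_def)
  moreover obtain w where "w \<in> W" "w \<noteq> 0" using W0 W(1) vs.subspace_0 by blast
  then have "w \<in> U" "w \<noteq> 0" using gen[of w 0] WV by (auto simp: alpha_inv)
  ultimately have "U = V" by blast
  moreover have "U \<subseteq> mv ` tensor_space W"
    unfolding U_def
  proof (rule vs.span_minimal)
    interpret ts: vector_space "tensor_scale s :: complex \<Rightarrow> (int ^ 'n \<Rightarrow>\<^sub>0 'v) \<Rightarrow> _"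
      by (rule vector_space_tensor_scale[OF vs])
    have sub: "ts.subspace (tensor_space W)" by (rule subspace_tensor_space[OF W(1)])
    have tV: "p \<in> tensor_space V" if "p \<in> tensor_space W" for p
      using that WV by (auto simp: tensor_space_def)
    show "vs.subspace (mv ` tensor_space W)"
      unfolding vs.subspace_def
    proof (intro conjI ballI allI)
      have "mv 0 \<in> mv ` tensor_space W" using ts.subspace_0[OF sub] by blast
      then show "0 \<in> mv ` tensor_space W" by (simp add: mv_def)
      fix x y c assume "x \<in> mv ` tensor_space W"
      then obtain p where p: "p \<in> tensor_space W" "x = mv p" by blast
      show "s c x \<in> mv ` tensor_space W"
        using mv_scale[OF tV[OF p(1)], of c] ts.subspace_scale[OF sub p(1), of c] p(2) by (metis imageI)
      assume "y \<in> mv ` tensor_space W"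
      then obtain q where q: "q \<in> tensor_space W" "y = mv q" by blast
      show "x + y \<in> mv ` tensor_space W"
        using mv_add[OF tV[OF p(1)] tV[OF q(1)]] ts.subspace_add[OF sub p(1) q(1)] p(2) q(2) by (metis imageI)
    qed
    show "?S \<subseteq> mv ` tensor_space W"
    proof clarify
      fix k :: "int ^ 'n" and w assume w: "w \<in> W"
      have "Poly_Mapping.single k w \<in> tensor_space W"
        using w vs.subspace_0[OF W(1)] by (simp add: tensor_space_def lookup_single when_def)
      then show "\<alpha> (tmon k) w \<in> mv ` tensor_space W" using mv_single[of k w] by (metis imageI)
    qed
  qed
  ultimately show ?thesis by simp
qed

text \<open>\<open>submodule_generated\<close> is used twice: for the whole weight space it gives
  surjectivity of \<open>mv\<close>, and for a proper submodule \<open>W\<close> it gives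
  irreducibility, by comparing coefficients at \<open>t^0\<close>.\<close>

theorem irreducible_jet_structure:
  assumes irr: "irreducible_jet_module B s V \<rho> \<alpha>" and \<beta>: "wt \<beta> \<noteq> {0}"
  shows "\<exists>\<tau> \<rho>' \<alpha>' \<phi>.
     irreducible_lie_module (TB B) s (wt \<beta>) \<tau> \<and>
     (\<forall>r. \<forall>v\<in>wt \<beta>. \<tau> (T B r) v = \<alpha> (tmon (- r)) (\<rho> (DB B r) v) - \<rho> (D (B *v cvec r) 0) v) \<and>
     jet_tensor_module B \<beta> s (wt \<beta>) \<tau> \<rho>' \<alpha>' \<and>
     jet_iso B s V \<rho> \<alpha> (tensor_scale s) (tensor_space (wt \<beta>)) \<rho>' \<alpha>' \<phi>"
proof -
  obtain \<tau> where \<tau>m: "lie_module (TB B) s V \<tau>"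
    and \<tau>: "\<And>r v. v \<in> V \<Longrightarrow> \<tau> (T B r) v = \<alpha> (tmon (- r)) (\<rho> (DB B r) v) - \<rho> (D (B *v cvec r) 0) v"
    using TB_module by blast
  interpret t: lie_module "TB B" s V \<tau> by (rule \<tau>m)
  let ?W = "wt \<beta>" and ?TS = "tensor_space (wt \<beta>) :: (int ^ 'n \<Rightarrow>\<^sub>0 'v) set"
  have WV: "?W \<subseteq> V" by (auto simp: weight_space_def)
  have TW: "\<tau> (T B r) w \<in> ?W" if w: "w \<in> ?W" for r w
  proof -
    have "\<alpha> (tmon (- r)) (\<rho> (DB B r) w) \<in> wt ((\<beta> + cvec r) + cvec (- r))"
      by (rule alpha_wt[OF DB_wt[OF w]])
    moreover have "s (bform (B *v cvec r) \<beta>) w \<in> ?W" by (rule vs.subspace_scale[OF subspace_wt w])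
    ultimately show ?thesis
      using w WV by (simp add: \<tau> subset_iff wt_D(2) cvec_simps vs.subspace_diff[OF subspace_wt])
  qed
  have Tm_in: "\<tau> (Tm c) w \<in> W" if W: "vs.subspace W" "W \<subseteq> V" "\<And>r w. w \<in> W \<Longrightarrow> \<tau> (T B r) w \<in> W" and w: "w \<in> W" for c w W
  proof (induction c rule: laurent_induct)
    case (1 k)
    then show ?case using W(3)[OF w] by (simp add: Tm_tmon)
  next
    case (2 c d)
    have "\<tau> (ladd (TB B) (Tm c) (Tm d)) w = \<tau> (Tm c) w + \<tau> (Tm d) w"
      by (rule t.ladd_act) (use w W(2) in \<open>auto simp: TB_carrier\<close>)
    then show ?case using vs.subspace_add[OF W(1) 2] by (simp only: TB_ops(2))
  next
    case (3 a c)
    have "\<tau> (lsmult (TB B) a (Tm c)) w = s a (\<tau> (Tm c) w)"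
      by (rule t.lsmult_act) (use w W(2) in \<open>auto simp: TB_carrier\<close>)
    then show ?case using vs.subspace_scale[OF W(1) 3] by (simp only: TB_ops(3))
  qed
  have lm: "lie_module (TB B) s ?W \<tau>"
    by (rule lie_module_restrict[OF \<tau>m subspace_wt WV])
      (use Tm_in[OF subspace_wt WV TW] in \<open>auto simp: TB_carrier\<close>)
  have irrW: "irreducible_lie_module (TB B) s ?W \<tau>"
    unfolding irreducible_lie_module_def
  proof (intro conjI lm \<beta> allI impI)
    fix W assume W: "vs.subspace W \<and> W \<subseteq> ?W \<and> (\<forall>x\<in>lcarrier (TB B). \<forall>w\<in>W. \<tau> x w \<in> W)"
    have inv: "\<tau> (T B r) w \<in> W" if "w \<in> W" for r w
      using W that by (auto simp: TB_carrier Tm_tmon[symmetric])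
    show "W = {0} \<or> W = ?W"
    proof (cases "W = {0}")
      case False
      have sub: "V \<subseteq> mv ` tensor_space W"
        by (rule submodule_generated[where \<tau> = \<tau> and \<beta> = \<beta>]) (use W \<tau> inv irr False in auto)
      have "v \<in> W" if v: "v \<in> ?W" for v
      proof -
        have "v \<in> V" using v WV by blast
        then obtain p where p: "p \<in> tensor_space W" "v = mv p" using sub by blast
        \<comment> \<open>A weight vector \<open>v\<close> is the image both of
          \<open>v \<otimes> 1\<close> and of some \<open>p\<close> with coefficients in
          \<open>W\<close>; injectivity of \<open>mv\<close> identifies the two, and the coefficient
          at 0 puts \<open>v\<close> into \<open>W\<close>.\<close>
        have "Poly_Mapping.single 0 v \<in> ?TS"
          using v vs.subspace_0[OF subspace_wt] by (simp add: tensor_space_def lookup_single when_def)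
        moreover have "p \<in> ?TS" using p(1) W by (auto simp: tensor_space_def)
        moreover have "mv (Poly_Mapping.single 0 v) = mv p"
          using p(2) \<open>v \<in> V\<close> by (simp add: mv_single alpha_inv)
        ultimately have "Poly_Mapping.single 0 v = p" using mv_inj[of \<beta>] by (auto dest: inj_onD)
        then show ?thesis using tensor_spaceD[OF p(1), of 0] by auto
      qed
      then show ?thesis using W by blast
    qed simp
  qed
  have "V \<subseteq> mv ` ?TS"
    by (rule submodule_generated[where \<tau> = \<tau> and \<beta> = \<beta>]) (use subspace_wt \<tau> TW irr \<beta> in auto)
  moreover have "mv ` ?TS \<subseteq> V" using mv_V[OF WV] by blast
  ultimately have bij: "bij_betw mv ?TS V" using mv_inj by (auto simp: bij_betw_def)
  have tV: "p \<in> tensor_space V" if "p \<in> ?TS" for p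
    using that WV by (auto simp: tensor_space_def)
  define \<phi> where "\<phi> = inv_into ?TS mv"
  note tr = jet_module_transport[OF _ vector_space_tensor_scale[OF vs] subspace_tensor_space[OF subspace_wt] bij
      mv_add[OF tV tV] mv_scale[OF tV] \<phi>_def]
  have jm: "jet_module B s V \<rho> \<alpha>" using irr by (simp add: irreducible_jet_module_def)
  let ?\<rho> = "\<lambda>\<eta> p. \<phi> (\<rho> \<eta> (mv p))" and ?\<alpha> = "\<lambda>f p. \<phi> (\<alpha> f (mv p))"
  have \<phi>: "\<phi> (\<alpha> (tmon k) v) = Poly_Mapping.single k v" if "v \<in> ?W" for k v
  proof -
    have "Poly_Mapping.single k v \<in> ?TS"
      using that vs.subspace_0[OF subspace_wt] by (simp add: tensor_space_def lookup_single when_def)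
    then have "\<phi> (mv (Poly_Mapping.single k v)) = Poly_Mapping.single k v"
      unfolding \<phi>_def by (rule inv_into_f_f[OF mv_inj])
    then show ?thesis by (simp add: mv_single)
  qed
  have "jet_tensor_module B \<beta> s ?W \<tau> ?\<rho> ?\<alpha>"
    unfolding jet_tensor_module_def tensor_tmon[OF vs] mv_single
  proof (intro conjI ballI allI)
    show "jet_module B (tensor_scale s) ?TS ?\<rho> ?\<alpha>" using tr(1)[OF jm] by blast
    fix v r k u assume v: "v \<in> ?W"
    have vV: "v \<in> V" using v WV by blast
    have sc: "s c v \<in> ?W" for c by (rule vs.subspace_scale[OF subspace_wt v])
    show "\<phi> (\<rho> (DB B r) (\<alpha> (tmon k) v)) =
        Poly_Mapping.single (k + r) (s (bform (B *v cvec r) (cvec k + \<beta>)) v) + Poly_Mapping.single (k + r) (\<tau> (T B r) v)"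
      unfolding D_shift(1)[where \<tau> = \<tau>, OF v \<tau>[OF vV]]
      by (subst \<phi>[OF vs.subspace_add[OF subspace_wt sc TW[OF v]]]) (simp add: single_add)
    show "\<phi> (\<rho> (D u 0) (\<alpha> (tmon k) v)) = Poly_Mapping.single k (s (bform u (cvec k + \<beta>)) v)"
      unfolding D_shift(2)[where \<tau> = \<tau>, OF v \<tau>[OF vV]] by (rule \<phi>[OF sc])
    show "\<phi> (\<alpha> (tmon r) (\<alpha> (tmon k) v)) = Poly_Mapping.single (k + r) v"
      using \<phi>[OF v, of "k + r"] vV by (simp add: alpha_inv add.commute)
  qed
  moreover have "jet_iso B s V \<rho> \<alpha> (tensor_scale s) ?TS ?\<rho> ?\<alpha> \<phi>" using tr(2)[OF jm] by blast
  ultimately show ?thesis using irrW \<tau> WV by (intro exI[of _ \<tau>] exI[of _ ?\<rho>] exI[of _ ?\<alpha>] exI[of _ \<phi>]) auto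
qed

end


section \<open>The classification\<close>

theorem theorem4p1:
  fixes m :: nat and B :: "complex ^ 'n ^ 'n::finite"
  assumes "CARD('n) = 2 * m" and "transpose B = - B" and "det B \<noteq> 0"
  shows
    "(\<forall>(s :: complex \<Rightarrow> 'v::ab_group_add \<Rightarrow> 'v) V \<rho> \<alpha> \<beta>.
        irreducible_jet_module B s V \<rho> \<alpha> \<and>
        (\<forall>\<gamma>. finite_dim s (weight_space s V \<rho> \<gamma>)) \<and>
        weight_space s V \<rho> \<beta> \<noteq> {0} \<longrightarrow>
        (\<exists>\<tau> \<rho>' \<alpha>' \<phi>.
           irreducible_lie_module (TB B) s (weight_space s V \<rho> \<beta>) \<tau> \<and>
           (\<forall>r. \<forall>v\<in>weight_space s V \<rho> \<beta>.
              \<tau> (T B r) v = \<alpha> (tmon (- r)) (\<rho> (DB B r) v) - \<rho> (D (B *v cvec r) 0) v) \<and>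
           jet_tensor_module B \<beta> s (weight_space s V \<rho> \<beta>) \<tau> \<rho>' \<alpha>' \<and>
           jet_iso B s V \<rho> \<alpha>
             (tensor_scale s) (tensor_space (weight_space s V \<rho> \<beta>)) \<rho>' \<alpha>' \<phi>)) \<and>
     (\<exists>\<psi> \<Theta>. is_psi B \<psi> \<and> I3 B \<subseteq> lie_ker (TB B) (sp_alg B) \<psi> \<and> is_identification B \<psi> \<Theta> \<and>
        lcarrier (R_alg B \<psi>) \<subseteq> lie_center (lie_quot (TB B) (I3 B)) \<and>
        {0} \<times> lcarrier (R_alg B \<psi>) \<subseteq> lie_center (lie_sum (sp_alg B) (R_alg B \<psi>)) \<and>
        (\<forall>(s :: complex \<Rightarrow> 'w::ab_group_add \<Rightarrow> 'w) V\<^sub>0 \<tau>.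
           irreducible_lie_module (TB B) s V\<^sub>0 \<tau> \<and> finite_dim s V\<^sub>0 \<longrightarrow>
           (\<exists>\<sigma>. irreducible_lie_module (lie_sum (sp_alg B) (R_alg B \<psi>)) s V\<^sub>0 \<sigma> \<and>
             (\<forall>x\<in>lcarrier (TB B). \<forall>v\<in>V\<^sub>0.
                \<tau> x v = \<sigma> (\<Theta> (lie_coset (TB B) (I3 B) x)) v))) \<and>
        (\<forall>(s :: complex \<Rightarrow> 'w \<Rightarrow> 'w) V\<^sub>0 \<sigma>.
           irreducible_lie_module (lie_sum (sp_alg B) (R_alg B \<psi>)) s V\<^sub>0 \<sigma> \<and> finite_dim s V\<^sub>0 \<longrightarrow>
           (\<exists>\<tau>. irreducible_lie_module (TB B) s V\<^sub>0 \<tau> \<and>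
             (\<forall>x\<in>lcarrier (TB B). \<forall>v\<in>V\<^sub>0.
                \<tau> x v = \<sigma> (\<Theta> (lie_coset (TB B) (I3 B) x)) v))))"
proof -
  interpret symplectic_form B
    by unfold_locales (rule assms)+
  \<comment> \<open>An even number of coordinates cannot be 1, so a second axis exists; the
    extrapolation at the origin leaves one axis in the direction of another.\<close>
  have card2: "\<exists>i j :: 'n. i \<noteq> j"
  proof (rule ccontr)
    assume "\<not> ?thesis"
    then have "(UNIV :: 'n set) = {undefined}" by auto
    then have "CARD('n) = card {undefined :: 'n}" by (rule arg_cong)
    then have "CARD('n) = 1" by simp
    then show False using assms(1) by presburger
  qed
  show ?thesis
  proof (intro conjI allI impI exI[of _ psi] exI[of _ Theta])
    fix s :: "complex \<Rightarrow> 'v \<Rightarrow> 'v" and V \<rho> \<alpha> \<beta>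
    assume a: "irreducible_jet_module B s V \<rho> \<alpha> \<and>
        (\<forall>\<gamma>. finite_dim s (weight_space s V \<rho> \<gamma>)) \<and> weight_space s V \<rho> \<beta> \<noteq> {0}"
    then have "jet_module B s V \<rho> \<alpha>" by (simp add: irreducible_jet_module_def)
    then interpret skew_jet B s V \<rho> \<alpha>
      by (rule skew_jet.intro[OF skew_form_axioms])
    show "\<exists>\<tau> \<rho>' \<alpha>' \<phi>.
           irreducible_lie_module (TB B) s (weight_space s V \<rho> \<beta>) \<tau> \<and>
           (\<forall>r. \<forall>v\<in>weight_space s V \<rho> \<beta>.
              \<tau> (T B r) v = \<alpha> (tmon (- r)) (\<rho> (DB B r) v) - \<rho> (D (B *v cvec r) 0) v) \<and>
           jet_tensor_module B \<beta> s (weight_space s V \<rho> \<beta>) \<tau> \<rho>' \<alpha>' \<and>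
           jet_iso B s V \<rho> \<alpha>
             (tensor_scale s) (tensor_space (weight_space s V \<rho> \<beta>)) \<rho>' \<alpha>' \<phi>"
      using a by (intro irreducible_jet_structure) auto
  next
    fix s :: "complex \<Rightarrow> 'w \<Rightarrow> 'w" and V\<^sub>0 \<tau>
    assume "irreducible_lie_module (TB B) s V\<^sub>0 \<tau> \<and> finite_dim s V\<^sub>0"
    then show "\<exists>\<sigma>. irreducible_lie_module SR s V\<^sub>0 \<sigma> \<and>
             (\<forall>x\<in>lcarrier (TB B). \<forall>v\<in>V\<^sub>0. \<tau> x v = \<sigma> (Theta (lie_coset (TB B) (I3 B) x)) v)"
      using finite_dim_factors[OF card2] unfolding Phi_def by blast
  next
    fix s :: "complex \<Rightarrow> 'w \<Rightarrow> 'w" and V\<^sub>0 \<sigma>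
    assume "irreducible_lie_module SR s V\<^sub>0 \<sigma> \<and> finite_dim s V\<^sub>0"
    then have "irreducible_lie_module (TB B) s V\<^sub>0 (\<lambda>x. \<sigma> (Phi x))"
      using irreducible_pullback[OF Phi_hom Phi_surj] by blast
    then show "\<exists>\<tau>. irreducible_lie_module (TB B) s V\<^sub>0 \<tau> \<and>
             (\<forall>x\<in>lcarrier (TB B). \<forall>v\<in>V\<^sub>0. \<tau> x v = \<sigma> (Theta (lie_coset (TB B) (I3 B) x)) v)"
      unfolding Phi_def by blast
  qed (rule is_psi I3_ker identification RL_central RL_central_sum)+
qed

end
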